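(* Let $\mathscr{D}(\mathcal{S})=(\boldsymbol{y}_0,\boldsymbol{y}_1,\boldsymbol{y}_2,\ldots)\subset[0,1)^{\mathbb{N}}$ be the explicitly constructed sequence described in the context. For every $s\ge 1$ and $N\ge 1$ let $\mathcal{P}_{N,s}=\{\boldsymbol{y}_0^{(s)},\ldots,\boldsymbol{y}_{N-1}^{(s)}\}\subset[0,1)^s$, where $\boldsymbol{y}_n^{(s)}$ is the projection of $\boldsymbol{y}_n$ onto its first $s$ coordinates. Then for every $s\ge1$: (i) for every even integer $q$ with $2\le q<\infty$ there is a constant $C_{q,s}>0$ such that for all $N\ge 2$ with dyadic expansion $N=2^{m_1}+2^{m_2}+\cdots+2^{m_r}$, $m_1>m_2>\cdots>m_r\ge 0$, $$\mathcal{L}_q(\mathcal{P}_{N,s})\le C_{q,s}\,\frac{r^{3/2-1/q}}{N}\sqrt{\sum_{v=1}^r m_v^{s-1}};$$ (ii) for every real $q$ with $2\le q<\infty$ there is a constant $C_{q,s}>0$ such that for all $m\ge1$, $$\mathcal{L}_q(\mathcal{P}_{2^m,s})\le C_{q,s}\,\frac{m^{(s-1)/2}}{2^m}.$$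
   Context: $\mathcal{L}_q$ discrepancy: for a finite list of points $P=\{\boldsymbol{x}_0,\ldots,\boldsymbol{x}_{N-1}\}\subset[0,1)^s$ and $\boldsymbol{\theta}\in[0,1]^s$, the local discrepancy is $\delta(P;\boldsymbol{\theta})=\frac1N\#\{0\le n<N:\boldsymbol{x}_n\in[\boldsymbol{0},\boldsymbol{\theta})\}-\prod_{j=1}^s\theta_j$, where $[\boldsymbol{0},\boldsymbol{\theta})=\prod_{j=1}^s[0,\theta_j)$, and $\mathcal{L}_q(P)=\left(\int_{[0,1]^s}|\delta(P;\boldsymbol{\theta})|^q\,d\boldsymbol{\theta}\right)^{1/q}$. The convention $0^0=1$ is used in $m_v^{s-1}$. Construction. Elements $0,1\in\mathbb{F}_2$ are identified with the integers $0,1$. Let $p_1=x$ and let $p_2,p_3,\ldots$ be an enumeration of all other irreducible polynomials over $\mathbb{F}_2$, in nondecreasing order of degree (ties in arbitrary order); let $e_j=\deg p_j$. For $j,k\ge1$ write $k-1=(i-1)e_j+z$ with $i\ge1$, $0\le z<e_j$, expand $x^{e_j-z-1}/p_j(x)^i=\sum_{\ell\ge1}a_\ell(i,j,z)x^{-\ell}$ in $\mathbb{F}_2((x^{-1}))$, and set $c_{j,k,\ell}=a_\ell(i,j,z)$; let $C_j=(c_{j,k,\ell})_{k,\ell\ge1}$ (then $c_{j,k,\ell}=0$ for $k>\ell$). The digital sequence $\mathcal{S}=(\boldsymbol{x}_0,\boldsymbol{x}_1,\ldots)$ with generating matrices $(C_j)_{j\ge1}$ is defined as follows: for $n\in\mathbb{N}_0$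 with binary digits $n=\sum_{i\ge0}n_i2^i$, put $x_{j,n,k}=\sum_{\ell\ge1}n_{\ell-1}c_{j,k,\ell}\in\mathbb{F}_2$, $x_{j,n}=\sum_{k\ge1}x_{j,n,k}2^{-k}$ (a finite sum), and $\boldsymbol{x}_n=(x_{1,n},x_{2,n},\ldots)\in[0,1)^{\mathbb{N}}$. Digit interlacing: for $x_1,x_2\in[0,1)$ with dyadic expansions $x_r=\sum_{d\ge1}\xi_{r,d}2^{-d}$ (finite expansions for dyadic rationals), $\mathscr{D}(x_1,x_2)=\sum_{d\ge1}\left(\xi_{1,d}2^{-(2d-1)}+\xi_{2,d}2^{-2d}\right)$; for $\boldsymbol{x}=(x_1,x_2,\ldots)\in[0,1)^{\mathbb{N}}$, $\mathscr{D}(\boldsymbol{x})=(\mathscr{D}(x_1,x_2),\mathscr{D}(x_3,x_4),\ldots)$. Finally $\boldsymbol{y}_n=\mathscr{D}(\boldsymbol{x}_n)$ and $\mathscr{D}(\mathcal{S})=(\boldsymbol{y}_0,\boldsymbol{y}_1,\ldots)$. *)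

theory Defs
  imports
    "HOL-Analysis.Analysis"
    "HOL-Library.Z2"
    "HOL-Computational_Algebra.Computational_Algebra"
begin

text \<open>
  Conventions: the field with two elements is the type \<^typ>\<open>bit\<close>. Points are functions
  \<^typ>\<open>nat \<Rightarrow> real\<close> whose coordinates are indexed from 1, so that a point of the
  \<open>s\<close>-dimensional unit cube uses the coordinates in \<open>{1..s}\<close>. Matrices, digits and the
  enumeration of the irreducible polynomials are indexed from 1 as well, their values at
  index 0 being irrelevant.
\<close>

definition local_discrepancy :: "nat \<Rightarrow> (nat \<Rightarrow> real) list \<Rightarrow> (nat \<Rightarrow> real) \<Rightarrow> real" where
  "local_discrepancy s P \<theta> =
     real (card {n. n < length P \<and> (\<forall>j\<in>{1..s}. (P ! n) j \<in> {0..<\<theta> j})}) / real (length P)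
       - (\<Prod>j\<in>{1..s}. \<theta> j)"

definition Lq_discrepancy :: "nat \<Rightarrow> real \<Rightarrow> (nat \<Rightarrow> real) list \<Rightarrow> real" where
  "Lq_discrepancy s q P =
     (LINT \<theta>:({1..s} \<rightarrow>\<^sub>E {0..1})|(\<Pi>\<^sub>M j\<in>{1..s}. lborel).
        \<bar>local_discrepancy s P \<theta>\<bar> powr q) powr (1 / q)"

text \<open>Two distinct polynomials over \<^typ>\<open>bit\<close> are never associated, as 1 is the only unit.\<close>

definition irreducible_enumeration :: "(nat \<Rightarrow> bit poly) \<Rightarrow> bool" where
  "irreducible_enumeration p \<longleftrightarrow>
     p 1 = [:0, 1:] \<and>
     bij_betw p {2..} {f. irreducible f \<and> f \<noteq> [:0, 1:]} \<and>
     mono_on {2..} (\<lambda>j. degree (p j))"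

text \<open>
  A Laurent series in \<open>x\<^sup>-\<^sup>1\<close> is a \<^typ>\<open>bit fls\<close> whose formal variable \<^const>\<open>fls_X\<close> stands for
  \<open>x\<^sup>-\<^sup>1\<close>. Hence \<open>x\<close> itself is \<^const>\<open>fls_X_inv\<close>, and the coefficient of \<open>x\<^sup>-\<^sup>l\<close> is the one with
  index \<open>l\<close>.
\<close>

definition poly_to_fls :: "bit poly \<Rightarrow> bit fls" where
  "poly_to_fls f = poly (map_poly fls_const f) fls_X_inv"

definition gen_matrix :: "(nat \<Rightarrow> bit poly) \<Rightarrow> nat \<Rightarrow> nat \<Rightarrow> nat \<Rightarrow> bit" where
  "gen_matrix p j k l =
     (let e = degree (p j); i = (k - 1) div e + 1; z = (k - 1) mod e
      in fls_nth (poly_to_fls (monom 1 (e - z - 1)) / poly_to_fls (p j) ^ i) (int l))"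

text \<open>
  The set of \<open>i\<close> such that the binary digit of \<open>n\<close> at position \<open>i\<close> is 1 is finite, so the
  following sum is a genuine one. Here \<open>bit n i\<close> is that binary digit (as a truth value).
\<close>

definition digital_digit :: "(nat \<Rightarrow> bit poly) \<Rightarrow> nat \<Rightarrow> nat \<Rightarrow> nat \<Rightarrow> bit" where
  "digital_digit p j n k = (\<Sum>i\<in>{i. bit n i}. gen_matrix p j k (i + 1))"

definition digital_seq :: "(nat \<Rightarrow> bit poly) \<Rightarrow> nat \<Rightarrow> nat \<Rightarrow> real" where
  "digital_seq p n j = (\<Sum>k. of_bit (digital_digit p j n (k + 1)) / 2 ^ (k + 1))"

text \<open>
  For \<open>x \<in> [0,1)\<close> the numbers \<open>dyadic_digit x d\<close>, \<open>d \<ge> 1\<close>, are the digits of the dyadic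
  expansion of \<open>x\<close>; for a dyadic rational they vanish for all large \<open>d\<close>.
\<close>

definition dyadic_digit :: "real \<Rightarrow> nat \<Rightarrow> real" where
  "dyadic_digit x d = of_int (\<lfloor>2 ^ d * x\<rfloor> mod 2)"

definition interlace :: "real \<Rightarrow> real \<Rightarrow> real" where
  "interlace x\<^sub>1 x\<^sub>2 =
     (\<Sum>d. dyadic_digit x\<^sub>1 (d + 1) / 2 ^ (2 * (d + 1) - 1)
         + dyadic_digit x\<^sub>2 (d + 1) / 2 ^ (2 * (d + 1)))"

definition interlace_point :: "(nat \<Rightarrow> real) \<Rightarrow> nat \<Rightarrow> real" where
  "interlace_point x j = interlace (x (2 * j - 1)) (x (2 * j))"

definition interlaced_seq :: "(nat \<Rightarrow> bit poly) \<Rightarrow> nat \<Rightarrow> nat \<Rightarrow> real" where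
  "interlaced_seq p n = interlace_point (digital_seq p n)"

definition interlaced_points :: "(nat \<Rightarrow> bit poly) \<Rightarrow> nat \<Rightarrow> nat \<Rightarrow> (nat \<Rightarrow> real) list" where
  "interlaced_points p N s = map (\<lambda>n. restrict (interlaced_seq p n) {1..s}) [0..<N]"

end

theory Submission
  imports Defs
begin

text \<open>
  Split the first \<open>N\<close> points into \<open>r\<close> blocks of \<open>2\<^sup>m\<close> points with \<open>m = m\<^sub>1, \<dots>, m\<^sub>r\<close>. Each block is a
  digitally shifted order 2 digital net, and it suffices to bound the \<open>L\<^sub>2\<^sub>k\<close> norm of its
  unnormalised discrepancy by a multiple of \<open>(m + 1)\<^bsup>(s - 1)/2\<^esup>\<close>, uniformly in the shift: the triangle and
  Cauchy--Schwarz inequalities then even give the power \<open>1/2 \<le> 3/2 - 1/q\<close> of \<open>r\<close>.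

  Up to a bounded error \<open>\<theta>\<close> may be replaced by a grid point with \<open>m\<close> digits per coordinate. The discrepancy is
  then a sum of dyadic martingale differences indexed by \<open>i \<in> {0..m}\<^sup>s\<close>, and the square of its \<open>L\<^sub>2\<^sub>k\<close>
  norm is at most a constant times the sum of the squares of their norms. The order 2 property makes
  the difference with index \<open>i\<close> geometrically small in \<open>m - |i|\<close> if \<open>|i| \<le> m\<close>; if \<open>|i| > m\<close>, it is
  essentially supported on the few boxes that contain points, so that its norm is geometrically small
  in \<open>|i| - m\<close>. Hence only the \<open>O((m + 1)\<^bsup>s - 1\<^esup>)\<close> indices near \<open>|i| = m\<close> count.
\<close>

section \<open>A type 2 inequality for sums of dyadic martingale differences\<close>

text \<open>The target (m+1)^((s-1)/2) has a factor sqrt (m+1) less than the number (m+1)^s of Haar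
  indices suggests, so the blocks with |i| < m must decay. With ties counted one half, the block of
  index i carries in each coordinate just the Walsh functions with digits i and i+d, with a
  coefficient of size at most 2^-d. A net of order 1 would annihilate them for |i| + |d| <= m - T;
  the surviving coefficients, of size about 2^-(m-|i|), would merely balance the 2^(m-|i|) points in
  a box. Order 2 weighs the second highest digit as well and annihilates them for 2|i| + |d| <= 2m -
  2T, so that the survivors have size about 2^-(2(m-|i|)) and beat the number of points. Interlacing
  two components per coordinate provides exactly this. Even exponents 2k allow purely algebraic
  moment bounds over a finite grid; in (ii), other exponents are reduced to an even one. Integrals
  over the cube enter only at the end, through step functions that majorize the discrepancy.\<close>

lemma weighted_power_mean:
  fixes x \<alpha> :: "'a \<Rightarrow> real"
  assumes "finite I" "I \<noteq> {}" and \<alpha>: "\<And>i. i \<in> I \<Longrightarrow> \<alpha> i > 0" and x: "\<And>i. i \<in> I \<Longrightarrow> x i \<ge> 0"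
  shows "(\<Sum>i\<in>I. x i) ^ n \<le> (\<Sum>i\<in>I. \<alpha> i) ^ n * (\<Sum>i\<in>I. \<alpha> i / (\<Sum>i\<in>I. \<alpha> i) * (x i / \<alpha> i) ^ n)"
proof -
  \<comment> \<open>Jensen's inequality at the points \<open>x i / \<alpha> i\<close> with weights
    \<open>\<alpha> i / S\<close>. If \<open>\<alpha> i\<close> is proportional to a bound for the
    norm of \<open>x i\<close>, summing or integrating the right side gives Minkowski's inequality
    without forming any norm.\<close>
  define S where "S = (\<Sum>i\<in>I. \<alpha> i)"
  have S: "S > 0" unfolding S_def using assms by (intro sum_pos) auto
  have conv: "convex_on {0..} (\<lambda>t::real. t ^ n)"
  proof (cases "even n")
    case True
    then show ?thesis using convex_power_even convex_on_subset by blast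
  next
    case False
    then show ?thesis using convex_power_odd by blast
  qed
  have "(\<Sum>i\<in>I. (\<alpha> i / S) *\<^sub>R (x i / \<alpha> i)) ^ n \<le> (\<Sum>i\<in>I. \<alpha> i / S * (x i / \<alpha> i) ^ n)"
  proof (rule convex_on_sum[OF _ _ conv])
    show "(\<Sum>i\<in>I. \<alpha> i / S) = 1" using S by (simp add: S_def flip: sum_divide_distrib)
  qed (use assms S in \<open>auto simp: less_imp_le\<close>)
  also have "(\<Sum>i\<in>I. (\<alpha> i / S) *\<^sub>R (x i / \<alpha> i)) = (\<Sum>i\<in>I. x i) / S"
    unfolding sum_divide_distrib using \<alpha> by (intro sum.cong) (auto simp: less_imp_neq[symmetric])
  finally show ?thesis using S unfolding S_def[symmetric]
    by (simp add: power_divide divide_le_eq mult.commute)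
qed

text \<open>Minkowski's inequality for \<open>k\<close>-th powers. The common factor
  \<open>c\<close>, in the application the number of grid points, lets the bounds \<open>A\<close>
  and \<open>B\<close> of the normalised norms simply add up.\<close>

lemma sum_power_add_le:
  fixes u v :: "'a \<Rightarrow> real"
  assumes "finite X" "k \<ge> 1" and u: "\<And>a. a \<in> X \<Longrightarrow> u a \<ge> 0" and v: "\<And>a. a \<in> X \<Longrightarrow> v a \<ge> 0"
    and "A \<ge> 0" "B \<ge> 0" and uA: "(\<Sum>a\<in>X. u a ^ k) \<le> c * A ^ k" and vB: "(\<Sum>a\<in>X. v a ^ k) \<le> c * B ^ k"
  shows "(\<Sum>a\<in>X. (u a + v a) ^ k) \<le> c * (A + B) ^ k"
proof -
  \<comment> \<open>\<open>weighted_power_mean\<close> divides by \<open>A\<close> and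
    \<open>B\<close>; if one of them is 0, the function that it bounds vanishes on
    \<open>X\<close>.\<close>
  have zero: "w a = 0" if "(\<Sum>a\<in>X. w a ^ k) \<le> c * 0 ^ k" "a \<in> X" "\<And>a. a \<in> X \<Longrightarrow> w a \<ge> 0"
    for w :: "'a \<Rightarrow> real" and a
  proof -
    have "(\<Sum>a\<in>X. w a ^ k) = 0"
      using that(1,3) \<open>k \<ge> 1\<close> by (intro antisym sum_nonneg) (auto simp: power_0_left)
    then have "w a ^ k = 0"
      using that \<open>finite X\<close> by (subst (asm) sum_nonneg_eq_0_iff) auto
    then show ?thesis by simp
  qed
  consider "A = 0" | "B = 0" | "A > 0" "B > 0" using assms by fastforce
  then show ?thesis
  proof cases
    case 1
    then show ?thesis using zero[of u] uA vB u by (simp cong: sum.cong)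
  next
    case 2
    then show ?thesis using zero[of v] uA vB v by (simp cong: sum.cong)
  next
    case 3
    have pt: "(u a + v a) ^ k \<le> (A + B) ^ k * (A / (A + B) * (u a / A) ^ k + B / (A + B) * (v a / B) ^ k)"
      if "a \<in> X" for a
      using weighted_power_mean[of UNIV "\<lambda>b. if b then A else B" "\<lambda>b. if b then u a else v a" k]
        3 u v that by (simp add: UNIV_bool add.commute)
    have "(\<Sum>a\<in>X. (u a + v a) ^ k)
        \<le> (\<Sum>a\<in>X. (A + B) ^ k * (A / (A + B) * (u a / A) ^ k + B / (A + B) * (v a / B) ^ k))"
      by (intro sum_mono pt)
    also have "\<dots> = (A + B) ^ k * (A / (A + B) * ((\<Sum>a\<in>X. u a ^ k) / A ^ k)
        + B / (A + B) * ((\<Sum>a\<in>X. v a ^ k) / B ^ k))"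
      by (simp only: power_divide sum.distrib flip: sum_distrib_left sum_divide_distrib)
    also have "\<dots> \<le> (A + B) ^ k * (A / (A + B) * c + B / (A + B) * c)"
      using 3 uA vB by (intro mult_left_mono add_mono) (auto simp: divide_le_eq)
    also have "\<dots> = c * (A + B) ^ k"
    proof -
      have "A / (A + B) * c + B / (A + B) * c = c"
        using 3 by (metis add_divide_distrib add_pos_pos distrib_right divide_self_if less_irrefl mult_1)
      then show ?thesis by simp
    qed
    finally show ?thesis .
  qed
qed

text \<open>Averaging over the sign of \<open>y\<close> removes its odd powers. The even ones are
  compared term by term with the binomial expansion of the right side; the constant stems from the
  crude estimate \<open>2 * k choose (2 * l) \<le> (2 * k) ^ (2 * l)\<close>.\<close>

lemma two_point_inequality:
  fixes x y :: real
  shows "(x + y) ^ (2 * k) + (x - y) ^ (2 * k) \<le> 2 * (x\<^sup>2 + (2 * real k)\<^sup>2 * y\<^sup>2) ^ k"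
proof -
  define f where "f l = real (2 * k choose l) * x ^ (2 * k - l) * y ^ l" for l
  have "(x + y) ^ (2 * k) = (\<Sum>l\<le>2*k. f l)"
    unfolding f_def using binomial_ring[of y x "2*k"] by (simp add: algebra_simps)
  moreover have "(x - y) ^ (2 * k) = (\<Sum>l\<le>2*k. (-1) ^ l * f l)"
    unfolding f_def using binomial_ring[of "-y" x "2*k"]
    by (simp add: algebra_simps power_minus[of y])
  ultimately have "(x + y) ^ (2 * k) + (x - y) ^ (2 * k) = (\<Sum>l\<le>2*k. if even l then 2 * f l else 0)"
    by (simp flip: sum.distrib) (intro sum.cong, auto)
  also have "\<dots> = (\<Sum>l<2*k. if even l then 2 * f l else 0) + 2 * f (2 * k)"
    by (simp flip: lessThan_Suc_atMost)
  also have "\<dots> = (\<Sum>l\<le>k. 2 * f (2 * l))"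
    using sum_split_even_odd[of "\<lambda>l. 2 * f l" "\<lambda>_. 0" k] by (simp flip: lessThan_Suc_atMost)
  also have "\<dots> \<le> (\<Sum>l\<le>k. 2 * (real (k choose l) * ((2 * real k)\<^sup>2 * y\<^sup>2) ^ l * (x\<^sup>2) ^ (k - l)))"
  proof (rule sum_mono)
    fix l assume l: "l \<in> {..k}"
    have "real (2 * k choose (2 * l)) \<le> (2 * real k) ^ (2 * l)"
      using binomial_le_pow[of "2*l" "2*k"] l by (metis atMost_iff mult_le_mono2 of_nat_le_iff of_nat_mult of_nat_numeral of_nat_power)
    also have "\<dots> \<le> real (k choose l) * (2 * real k) ^ (2 * l)"
    proof -
      have "real (k choose l) \<ge> 1" using l by (simp add: Suc_leI)
      then show ?thesis using mult_right_mono[of 1 "real (k choose l)" "(2 * real k) ^ (2 * l)"] by simp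
    qed
    finally have "f (2 * l) \<le> real (k choose l) * (2 * real k) ^ (2 * l) * (x ^ (2 * k - 2 * l) * y ^ (2 * l))"
      unfolding f_def mult.assoc[of "real _" "x ^ _"]
      by (intro mult_right_mono) (auto simp flip: diff_mult_distrib2)
    also have "\<dots> = real (k choose l) * ((2 * real k)\<^sup>2 * y\<^sup>2) ^ l * (x\<^sup>2) ^ (k - l)"
      by (simp add: power_mult power_mult_distrib flip: diff_mult_distrib2)
    finally show "2 * f (2 * l) \<le> 2 * (real (k choose l) * ((2 * real k)\<^sup>2 * y\<^sup>2) ^ l * (x\<^sup>2) ^ (k - l))"
      by simp
  qed
  also have "\<dots> = 2 * (x\<^sup>2 + (2 * real k)\<^sup>2 * y\<^sup>2) ^ k"
    using binomial_ring[of "(2 * real k)\<^sup>2 * y\<^sup>2" "x\<^sup>2" k] by (simp add: sum_distrib_left add.commute)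
  finally show ?thesis .
qed

text \<open>The type 2 property of \<open>L\<^sub>2\<^sub>k\<close> for one martingale difference: the measure-preserving flip \<open>\<phi>\<close>
  lets one average over \<open>g \<plusminus> d\<close>, which replaces Burkholder's inequality.\<close>

lemma type2_step:
  fixes g d :: "'a \<Rightarrow> real"
  assumes "finite X" "k \<ge> 1" and \<phi>: "bij_betw \<phi> X X"
    and g: "\<And>a. a \<in> X \<Longrightarrow> g (\<phi> a) = g a" and d: "\<And>a. a \<in> X \<Longrightarrow> d (\<phi> a) = - d a"
    and "A \<ge> 0" "B \<ge> 0" and gA: "(\<Sum>a\<in>X. g a ^ (2 * k)) \<le> c * A ^ k"
    and dB: "(\<Sum>a\<in>X. d a ^ (2 * k)) \<le> c * B ^ k"
  shows "(\<Sum>a\<in>X. (g a + d a) ^ (2 * k)) \<le> c * (A + (2 * real k)\<^sup>2 * B) ^ k"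
proof -
  have "(\<Sum>a\<in>X. (g a + d a) ^ (2 * k)) = (\<Sum>a\<in>X. (g (\<phi> a) + d (\<phi> a)) ^ (2 * k))"
    using sum.reindex_bij_betw[OF \<phi>, of "\<lambda>a. (g a + d a) ^ (2 * k)"] by simp
  also have "\<dots> = (\<Sum>a\<in>X. (g a - d a) ^ (2 * k))" by (intro sum.cong) (auto simp: g d)
  finally have "2 * (\<Sum>a\<in>X. (g a + d a) ^ (2 * k)) = (\<Sum>a\<in>X. (g a + d a) ^ (2 * k) + (g a - d a) ^ (2 * k))"
    by (simp add: sum.distrib)
  also have "\<dots> \<le> (\<Sum>a\<in>X. 2 * ((g a)\<^sup>2 + (2 * real k)\<^sup>2 * (d a)\<^sup>2) ^ k)"
    by (intro sum_mono two_point_inequality)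
  also have "\<dots> \<le> 2 * (c * (A + (2 * real k)\<^sup>2 * B) ^ k)"
    unfolding sum_distrib_left[symmetric]
  proof (intro mult_left_mono sum_power_add_le)
    show "(\<Sum>a\<in>X. ((g a)\<^sup>2) ^ k) \<le> c * A ^ k" using gA by (simp add: power_mult)
    have "(\<Sum>a\<in>X. ((2 * real k)\<^sup>2 * (d a)\<^sup>2) ^ k) = ((2 * real k)\<^sup>2) ^ k * (\<Sum>a\<in>X. d a ^ (2 * k))"
      by (simp add: power_mult power_mult_distrib sum_distrib_left)
    also have "\<dots> \<le> ((2 * real k)\<^sup>2) ^ k * (c * B ^ k)" using dB by (intro mult_left_mono) auto
    finally show "(\<Sum>a\<in>X. ((2 * real k)\<^sup>2 * (d a)\<^sup>2) ^ k) \<le> c * ((2 * real k)\<^sup>2 * B) ^ k"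
      by (simp add: power_mult_distrib mult_ac)
  qed (use assms in auto)
  finally show ?thesis by simp
qed

lemma sum_PiE_insert:
  assumes "x \<notin> J"
  shows "(\<Sum>i\<in>PiE (insert x J) S. F i) = (\<Sum>y\<in>S x. \<Sum>i\<in>PiE J S. F (i(x := y)))"
proof -
  have "(\<Sum>i\<in>PiE (insert x J) S. F i) = (\<Sum>(y, i)\<in>S x \<times> PiE J S. F (i(x := y)))"
    unfolding PiE_insert_eq
    by (subst sum.reindex[OF inj_combinator[OF assms]]) (simp add: case_prod_unfold)
  then show ?thesis by (simp add: sum.cartesian_product)
qed

text \<open>Invariance under \<open>\<phi> j l\<close> for \<open>i j < l\<close> and the sign
  change for \<open>i j = l\<close> encode a martingale difference of level \<open>i j\<close> in
  each coordinate. Induction on the coordinates: for a fixed value \<open>y\<close> of the new index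
  the induction hypothesis bounds the sum over the others, and \<open>type2_step\<close> then adds
  the levels 1, ..., m one by one to level 0. Every coordinate costs one factor (2k)^2.\<close>

lemma type2_multiparameter:
  fixes F :: "('j \<Rightarrow> nat) \<Rightarrow> 'a \<Rightarrow> real"
  assumes "finite J" "finite X" "k \<ge> 1"
    and "\<And>j l. j \<in> J \<Longrightarrow> l \<in> {1..m} \<Longrightarrow> bij_betw (\<phi> j l) X X"
    and "\<And>i j l a. i \<in> PiE J (\<lambda>_. {..m}) \<Longrightarrow> j \<in> J \<Longrightarrow> l \<in> {1..m} \<Longrightarrow> i j < l \<Longrightarrow> a \<in> X \<Longrightarrow> F i (\<phi> j l a) = F i a"
    and "\<And>i j l a. i \<in> PiE J (\<lambda>_. {..m}) \<Longrightarrow> j \<in> J \<Longrightarrow> l \<in> {1..m} \<Longrightarrow> i j = l \<Longrightarrow> a \<in> X \<Longrightarrow> F i (\<phi> j l a) = - F i a"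
    and "\<And>i. i \<in> PiE J (\<lambda>_. {..m}) \<Longrightarrow> B i \<ge> 0"
    and "\<And>i. i \<in> PiE J (\<lambda>_. {..m}) \<Longrightarrow> (\<Sum>a\<in>X. F i a ^ (2 * k)) \<le> c * B i ^ k"
  shows "(\<Sum>a\<in>X. (\<Sum>i\<in>PiE J (\<lambda>_. {..m}). F i a) ^ (2 * k))
    \<le> c * (((2 * real k)\<^sup>2) ^ card J * (\<Sum>i\<in>PiE J (\<lambda>_. {..m}). B i)) ^ k"
  using assms(1,4-)
proof (induction J arbitrary: F B rule: finite_induct)
  case empty
  then show ?case by simp
next
  case (insert x J)
  define K where "K = (2 * real k)\<^sup>2"
  have K: "K \<ge> 1" unfolding K_def using \<open>k \<ge> 1\<close> by (intro one_le_power) simp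
  define G where "G y a = (\<Sum>i\<in>PiE J (\<lambda>_. {..m}). F (i(x := y)) a)" for y a
  define B' where "B' y = K ^ card J * (\<Sum>i\<in>PiE J (\<lambda>_. {..m}). B (i(x := y)))" for y
  have upd: "i(x := y) \<in> PiE (insert x J) (\<lambda>_. {..m})" if "i \<in> PiE J (\<lambda>_. {..m})" "y \<le> m" for i y
    using that by (auto simp: PiE_def extensional_def)
  have G: "(\<Sum>a\<in>X. G y a ^ (2 * k)) \<le> c * B' y ^ k" if "y \<le> m" for y
    unfolding G_def B'_def K_def
  proof (rule insert.IH)
    fix i j l a assume *: "i \<in> PiE J (\<lambda>_. {..m})" "j \<in> J" "l \<in> {1..m}" "a \<in> X"
    have [simp]: "j \<noteq> x" using * insert.hyps by auto
    show "F (i(x := y)) (\<phi> j l a) = F (i(x := y)) a" if "i j < l"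
      using * that \<open>y \<le> m\<close> by (intro insert.prems(2) upd) auto
    show "F (i(x := y)) (\<phi> j l a) = - F (i(x := y)) a" if "i j = l"
      using * that \<open>y \<le> m\<close> by (intro insert.prems(3) upd) auto
  next
    fix i assume i: "i \<in> PiE J (\<lambda>_. {..m})"
    show "B (i(x := y)) \<ge> 0" by (rule insert.prems(4)[OF upd[OF i that]])
    show "(\<Sum>a\<in>X. F (i(x := y)) a ^ (2 * k)) \<le> c * B (i(x := y)) ^ k"
      by (rule insert.prems(5)[OF upd[OF i that]])
  qed (use insert.prems(1) in auto)
  have B'_nonneg: "B' y \<ge> 0" if "y \<le> m" for y
    unfolding B'_def using K that by (intro mult_nonneg_nonneg sum_nonneg insert.prems(4) upd) auto
  have Ginv: "G y (\<phi> x l a) = G y a" if "y < l" "l \<le> m" "a \<in> X" for y l a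
    unfolding G_def using that by (intro sum.cong refl insert.prems(2) upd) auto
  have Ganti: "G l (\<phi> x l a) = - G l a" if "1 \<le> l" "l \<le> m" "a \<in> X" for l a
    unfolding G_def sum_negf[symmetric] using that by (intro sum.cong refl insert.prems(3) upd) auto
  have main: "(\<Sum>a\<in>X. (\<Sum>y\<le>n. G y a) ^ (2 * k)) \<le> c * (\<Sum>y\<le>n. K * B' y) ^ k" if "n \<le> m" for n
    using that
  proof (induction n)
    case 0
    \<comment> \<open>Inserting the factor \<open>K \<ge> 1\<close> at level 0 needs a sign: a
      negative \<open>c\<close> with \<open>B' 0 > 0\<close> would bound a sum of even powers by a
      negative number.\<close>
    have "c \<ge> 0 \<or> B' 0 = 0"
    proof (rule ccontr)
      assume "\<not> ?thesis"
      then have "c * B' 0 ^ k < 0" using B'_nonneg[of 0] by (simp add: mult_neg_pos)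
      moreover have "0 \<le> (\<Sum>a\<in>X. G 0 a ^ (2 * k))" by (intro sum_nonneg) simp
      ultimately show False using G[of 0] by linarith
    qed
    then have "c * B' 0 ^ k \<le> c * (K * B' 0) ^ k"
    proof
      assume "c \<ge> 0"
      moreover have "B' 0 \<le> K * B' 0" using K B'_nonneg[of 0] mult_right_mono[of 1 K "B' 0"] by simp
      ultimately show ?thesis using B'_nonneg[of 0] by (intro mult_left_mono power_mono) auto
    qed simp
    then show ?case using G[of 0] by simp
  next
    case (Suc n)
    have "(\<Sum>a\<in>X. ((\<Sum>y\<le>n. G y a) + G (Suc n) a) ^ (2 * k))
       \<le> c * ((\<Sum>y\<le>n. K * B' y) + (2 * real k)\<^sup>2 * B' (Suc n)) ^ k"
    proof (rule type2_step[where \<phi> = "\<phi> x (Suc n)"])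
      show "(\<Sum>y\<le>n. K * B' y) \<ge> 0"
        using K B'_nonneg Suc by (intro sum_nonneg mult_nonneg_nonneg) auto
      show "(\<Sum>y\<le>n. G y (\<phi> x (Suc n) a)) = (\<Sum>y\<le>n. G y a)" if "a \<in> X" for a
        using Suc that by (intro sum.cong refl Ginv) auto
    qed (use Suc assms insert.prems(1) G B'_nonneg Ganti in auto)
    then show ?case by (simp add: K_def)
  qed
  have "(\<Sum>i\<in>PiE (insert x J) (\<lambda>_. {..m}). F i a) = (\<Sum>y\<le>m. G y a)" for a
    using sum_PiE_insert[OF insert.hyps(2), where S = "\<lambda>_. {..m}" and F = "\<lambda>i. F i a"] by (simp add: G_def)
  moreover have "K ^ card (insert x J) * (\<Sum>i\<in>PiE (insert x J) (\<lambda>_. {..m}). B i) = (\<Sum>y\<le>m. K * B' y)"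
    using sum_PiE_insert[OF insert.hyps(2), where S = "\<lambda>_. {..m}" and F = B] insert.hyps
    by (simp add: B'_def sum_distrib_left mult.assoc)
  ultimately show ?case using main[of m] by (simp add: K_def)
qed

section \<open>Haar decomposition of the step function\<close>

text \<open>A number \<open>y < 2\<^sup>m\<close> stands for the dyadic fraction \<open>y / 2\<^sup>m\<close>, so its \<open>l\<close>-th digit is
  the bit at position \<open>m - l\<close>.\<close>

definition rad :: "nat \<Rightarrow> nat \<Rightarrow> nat \<Rightarrow> real" where
  "rad m l y = (if bit y (m - l) then -1 else 1)"

text \<open>Ties count one half: with this convention the Haar coefficients of the step function are
  finite Walsh sums without a boundary term.\<close>

definition half_step :: "nat \<Rightarrow> nat \<Rightarrow> real" where
  "half_step y a = (if y < a then 1 else if y = a then 1 / 2 else 0)"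

text \<open>Coefficient of the Walsh function with digits \<open>haar_freq i d\<close>;
  \<open>d = 0\<close> is the constant term. For \<open>i \<ge> 1\<close>, \<open>a\<close> enters
  only through the sign of the Haar function. For \<open>i = 0\<close> the function expanded is the
  mean of \<open>half_step y\<close> over all \<open>a\<close>, that is, 1 - (y + 1/2) /
  2^m.\<close>

definition haar_coeff :: "nat \<Rightarrow> nat \<Rightarrow> nat \<Rightarrow> nat \<Rightarrow> real" where
  "haar_coeff m i d a =
     (if i = 0 then 1 / 2 / 2 ^ d else rad m i a * (if d = 0 then - 1 / 4 else 1 / 4 / 2 ^ d))"

definition haar_freq :: "nat \<Rightarrow> nat \<Rightarrow> nat set" where
  "haar_freq i d = (if d = 0 then {} else {i, i + d} - {0})"

text \<open>As a function of \<open>a\<close> this is the \<open>i\<close>-th dyadic martingale difference of \<open>half_step y\<close>;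
  as a function of \<open>y\<close> it is a tent function on a dyadic interval, expanded into Walsh functions.\<close>

definition haar_part :: "nat \<Rightarrow> nat \<Rightarrow> nat \<Rightarrow> nat \<Rightarrow> real" where
  "haar_part m i y a = of_bool (a div 2 ^ (m - (i - 1)) = y div 2 ^ (m - (i - 1))) *
     (\<Sum>d\<le>m - i. haar_coeff m i d a * (\<Prod>l\<in>haar_freq i d. rad m l y))"

lemma rad_cases: "rad m l y = 1 \<or> rad m l y = -1"
  by (simp add: rad_def)

lemma half_step_eq_sum_haar_part:
  assumes "y < 2 ^ m" "a < 2 ^ m"
  shows "half_step y a = (\<Sum>i\<le>m. haar_part m i y a)"
proof -
  define W where "W i = (\<Sum>d\<in>{1..m - i}. rad m (i + d) y / 2 ^ d)" for i
  \<comment> \<open>\<open>P i\<close> is the mean of \<open>half_step y\<close> over the numbers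
    with the same first \<open>i\<close> digits as \<open>a\<close>. On a tie it depends on the
    remaining digits of \<open>y\<close>, which \<open>W i\<close> collects. The induction
    identifies each part with the increment from \<open>P i\<close> to
    \<open>P (Suc i)\<close>.\<close>
  define P where "P i = (let y' = y div 2 ^ (m - i); a' = a div 2 ^ (m - i) in
     if y' < a' then 1 else if y' = a' then 1 / 2 + W i / 2 else 0)" for i
  have split0: "(\<Sum>d\<le>n. f d) = f 0 + (\<Sum>d\<in>{1..n}. f d)" for f :: "nat \<Rightarrow> real" and n
    by (metis One_nat_def atMost_atLeast0 le0 sum.atLeast_Suc_atMost)
  have "(\<Sum>i'\<le>i. haar_part m i' y a) = P i" if "i \<le> m" for i
    using that
  proof (induction i)
    case 0
    have "(\<Sum>d\<in>{1..m}. haar_coeff m 0 d a * (\<Prod>l\<in>haar_freq 0 d. rad m l y)) = W 0 / 2"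
      unfolding W_def sum_divide_distrib by (intro sum.cong) (auto simp: haar_coeff_def haar_freq_def)
    then show ?case using assms
      by (simp add: haar_part_def P_def split0 haar_coeff_def haar_freq_def)
  next
    case (Suc i)
    have W: "W i = (rad m (Suc i) y + W (Suc i)) / 2"
    proof -
      have "W i = (\<Sum>d\<in>{0..m - Suc i}. rad m (i + Suc d) y / 2 ^ Suc d)"
      proof -
        have n: "m - i = Suc (m - Suc i)" using Suc.prems by simp
        show ?thesis unfolding W_def n One_nat_def sum.shift_bounds_cl_Suc_ivl ..
      qed
      also have "\<dots> = rad m (Suc i) y / 2 + (\<Sum>d\<in>{1..m - Suc i}. rad m (i + Suc d) y / 2 ^ Suc d)"
        by (simp add: split0 atLeast0AtMost)
      also have "(\<Sum>d\<in>{1..m - Suc i}. rad m (i + Suc d) y / 2 ^ Suc d) = W (Suc i) / 2"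
        unfolding W_def sum_divide_distrib by (intro sum.cong) auto
      finally show ?thesis by simp
    qed
    have S: "(\<Sum>d\<in>{1..m - Suc i}. haar_coeff m (Suc i) d a * (\<Prod>l\<in>haar_freq (Suc i) d. rad m l y))
        = rad m (Suc i) a * rad m (Suc i) y * W (Suc i) / 4"
      unfolding W_def sum_divide_distrib sum_distrib_left
      by (intro sum.cong) (auto simp: haar_coeff_def haar_freq_def)
    define y' a' where "y' = y div 2 ^ (m - Suc i)" and "a' = a div 2 ^ (m - Suc i)"
    have pow: "(2::nat) ^ (m - i) = 2 ^ (m - Suc i) * 2"
      using Suc.prems by (metis Suc_diff_Suc Suc_le_eq power_Suc2)
    have yi: "y div 2 ^ (m - i) = y' div 2" and ai: "a div 2 ^ (m - i) = a' div 2"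
      by (simp_all add: y'_def a'_def pow div_mult2_eq)
    have ry: "rad m (Suc i) y = (if odd y' then -1 else 1)"
      and ra: "rad m (Suc i) a = (if odd a' then -1 else 1)"
      by (simp_all add: rad_def bit_iff_odd y'_def a'_def)
    have "haar_part m (Suc i) y a = of_bool (a' div 2 = y' div 2) *
        (rad m (Suc i) a * (rad m (Suc i) y * W (Suc i) - 1) / 4)"
      unfolding haar_part_def split0 S by (simp add: yi ai haar_coeff_def haar_freq_def algebra_simps)
    moreover have "P i + of_bool (a' div 2 = y' div 2) *
        (rad m (Suc i) a * (rad m (Suc i) y * W (Suc i) - 1) / 4) = P (Suc i)"
    proof -
      define b where "b = (odd y')"
      define c where "c = (odd a')"
      define Y A' where "Y = y' div 2" and "A' = a' div 2"
      have y': "y' = 2 * Y + of_bool b" and a': "a' = 2 * A' + of_bool c"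
        unfolding b_def c_def Y_def A'_def by (auto simp: elim: oddE evenE)
      have P1: "P i = (if Y < A' then 1 else if Y = A' then 1 / 2 + (rad m (Suc i) y + W (Suc i)) / 4 else 0)"
        unfolding P_def yi ai W Let_def Y_def A'_def by simp
      have P2: "P (Suc i) = (if y' < a' then 1 else if y' = a' then 1 / 2 + W (Suc i) / 2 else 0)"
        unfolding P_def Let_def y'_def a'_def ..
      have ry': "rad m (Suc i) y = (if b then -1 else 1)" "rad m (Suc i) a = (if c then -1 else 1)"
        by (simp_all add: ry ra b_def c_def)
      consider "Y < A'" | "A' < Y" | "Y = A'" by linarith
      then show ?thesis
        unfolding P1 P2 Y_def[symmetric] A'_def[symmetric] ry' y' a'
        by cases (cases b; cases c; simp add: field_simps)+
    qed
    ultimately show ?case using Suc by simp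
  qed
  from this[of m] show ?thesis by (simp add: P_def W_def half_step_def)
qed

section \<open>Point counts and character sums over boxes\<close>

text \<open>A character is described by the set \<open>K\<close> of pairs (coordinate, digit). Order 2 means that, unless it
  is trivial, it sums to zero over the point set as soon as the two highest digits of all coordinates
  have a small total, where \<open>v\<^sub>j\<close> bounds the highest and \<open>u\<^sub>j\<close> the second highest digit in coordinate \<open>j\<close>.\<close>

definition order2_net :: "nat \<Rightarrow> nat \<Rightarrow> nat \<Rightarrow> (nat \<Rightarrow> nat \<Rightarrow> nat) \<Rightarrow> bool" where
  "order2_net s T m Y \<longleftrightarrow>
     (\<forall>n<2 ^ m. \<forall>j\<in>{1..s}. Y n j < 2 ^ m) \<and>
     (\<forall>u v K. (\<forall>j\<in>{1..s}. u j \<le> v j) \<and> K \<noteq> {} \<and>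
        K \<subseteq> (SIGMA j:{1..s}. ({1..u j} \<union> {v j}) \<inter> {1..m}) \<and>
        (\<Sum>j\<in>{1..s}. u j + v j) + 2 * T \<le> 2 * m \<longrightarrow>
        (\<Sum>n<2 ^ m. \<Prod>(j, l)\<in>K. rad m l (Y n j)) = 0)"

definition box_count :: "nat \<Rightarrow> nat \<Rightarrow> (nat \<Rightarrow> nat \<Rightarrow> nat) \<Rightarrow> (nat \<Rightarrow> nat) \<Rightarrow> (nat \<Rightarrow> nat) \<Rightarrow> real" where
  "box_count s m Y r a =
     (\<Sum>n<2 ^ m. \<Prod>j\<in>{1..s}. of_bool (a j div 2 ^ (m - r j) = Y n j div 2 ^ (m - r j)))"

text \<open>Each factor is the indicator of one agreeing digit. Multiplied out, a box becomes a sum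
  of characters.\<close>

lemma prefix_eq_prod:
  assumes "y < 2 ^ m" "a < 2 ^ m" "r \<le> m"
  shows "of_bool (a div 2 ^ (m - r) = y div 2 ^ (m - r)) = (\<Prod>l\<in>{1..r}. (rad m l a * rad m l y + 1) / 2)"
  using \<open>r \<le> m\<close>
proof (induction r)
  case 0
  then show ?case using assms by simp
next
  case (Suc r)
  define y' a' where "y' = y div 2 ^ (m - Suc r)" and "a' = a div 2 ^ (m - Suc r)"
  have pow: "(2::nat) ^ (m - r) = 2 ^ (m - Suc r) * 2"
    using Suc.prems by (metis Suc_diff_Suc Suc_le_eq power_Suc2)
  have yi: "y div 2 ^ (m - r) = y' div 2" and ai: "a div 2 ^ (m - r) = a' div 2"
    by (simp_all add: y'_def a'_def pow div_mult2_eq)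
  have rads: "(rad m (Suc r) a * rad m (Suc r) y + 1) / 2 = of_bool (odd a' = odd y')"
    by (auto simp: rad_def bit_iff_odd y'_def a'_def)
  have "a' = y' \<longleftrightarrow> a' div 2 = y' div 2 \<and> odd a' = odd y'"
    by presburger
  then have "of_bool (a' = y') = of_bool (a' div 2 = y' div 2) * (of_bool (odd a' = odd y') :: real)"
    by simp
  then show ?case
    using Suc by (simp add: rads yi ai flip: y'_def a'_def)
qed

text \<open>The box expands into characters \<open>K\<close> on the digits up to \<open>r j\<close>,
  while \<open>E\<close> lies strictly above them. Hence the digits cannot cancel, \<open>K\<close>
  and \<open>E\<close> combine to a character on their union, and the net property kills all of
  these but the trivial one.\<close>

lemma box_char_sum:
  assumes net: "order2_net s T m Y" and a: "\<And>j. j \<in> {1..s} \<Longrightarrow> a j < 2 ^ m"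
    and uv: "\<And>j. j \<in> {1..s} \<Longrightarrow> u j \<le> v j" and sum_uv: "(\<Sum>j\<in>{1..s}. u j + v j) + 2 * T \<le> 2 * m"
    and r: "\<And>j. j \<in> {1..s} \<Longrightarrow> r j \<le> u j" "\<And>j. j \<in> {1..s} \<Longrightarrow> r j \<le> m"
    and E: "\<And>j. j \<in> {1..s} \<Longrightarrow> E j \<subseteq> ({1..u j} \<union> {v j}) \<inter> {1..m} - {1..r j}"
  shows "(\<Sum>n<2 ^ m. \<Prod>j\<in>{1..s}. of_bool (a j div 2 ^ (m - r j) = Y n j div 2 ^ (m - r j)) *
        (\<Prod>l\<in>E j. rad m l (Y n j)))
      = (if \<forall>j\<in>{1..s}. E j = {} then 2 ^ m / 2 ^ (\<Sum>j\<in>{1..s}. r j) else 0)"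
proof -
  define I where "I = (SIGMA j:{1..s}. {1..r j})"
  define E' where "E' = (SIGMA j:{1..s}. E j)"
  define g where "g n = (\<lambda>(j, l). rad m l (Y n j))" for n
  define \<alpha> where "\<alpha> = (\<lambda>(j, l). rad m l (a j))"
  have finE: "finite (E j)" if "j \<in> {1..s}" for j
    using E[OF that] finite_subset[of "E j" "{1..m}"] by auto
  have fin: "finite I" "finite E'" unfolding I_def E'_def using finE by auto
  have disj: "I \<inter> E' = {}" unfolding I_def E'_def using E by fastforce
  have cardI: "card I = (\<Sum>j\<in>{1..s}. r j)" unfolding I_def by simp
  have Y: "Y n j < 2 ^ m" if "n < 2 ^ m" "j \<in> {1..s}" for n j
    using net that unfolding order2_net_def by blast
  have term_eq: "(\<Prod>j\<in>{1..s}. of_bool (a j div 2 ^ (m - r j) = Y n j div 2 ^ (m - r j)) * (\<Prod>l\<in>E j. rad m l (Y n j)))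
      = (\<Sum>K\<in>Pow I. prod \<alpha> K / 2 ^ card I * prod (g n) (K \<union> E'))" if n: "n < 2 ^ m" for n
  proof -
    have "(\<Prod>j\<in>{1..s}. of_bool (a j div 2 ^ (m - r j) = Y n j div 2 ^ (m - r j)) * (\<Prod>l\<in>E j. rad m l (Y n j)))
       = (\<Prod>j\<in>{1..s}. \<Prod>l\<in>{1..r j}. (rad m l (a j) * rad m l (Y n j) + 1) / 2) *
         (\<Prod>j\<in>{1..s}. \<Prod>l\<in>E j. rad m l (Y n j))"
      unfolding prod.distrib using n Y a r by (intro arg_cong2[of _ _ _ _ "(*)"] prod.cong prefix_eq_prod) auto
    also have "(\<Prod>j\<in>{1..s}. \<Prod>l\<in>{1..r j}. (rad m l (a j) * rad m l (Y n j) + 1) / 2)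
        = (\<Prod>x\<in>I. (\<alpha> x * g n x + 1) / 2)"
      unfolding I_def \<alpha>_def g_def by (subst prod.Sigma) (auto simp: case_prod_unfold)
    also have "\<dots> = (\<Sum>K\<in>Pow I. \<Prod>x\<in>K. \<alpha> x * g n x) / 2 ^ card I"
      using prod_add[OF fin(1), of "\<lambda>x. \<alpha> x * g n x" "\<lambda>_. 1"] by (simp add: prod_dividef)
    also have "(\<Prod>j\<in>{1..s}. \<Prod>l\<in>E j. rad m l (Y n j)) = prod (g n) E'"
      unfolding E'_def g_def using finE by (subst prod.Sigma) auto
    also have "(\<Sum>K\<in>Pow I. \<Prod>x\<in>K. \<alpha> x * g n x) / 2 ^ card I * prod (g n) E'
        = (\<Sum>K\<in>Pow I. prod \<alpha> K / 2 ^ card I * prod (g n) (K \<union> E'))"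
      unfolding sum_divide_distrib sum_distrib_right
    proof (intro sum.cong refl)
      fix K assume "K \<in> Pow I"
      then have "prod (g n) (K \<union> E') = prod (g n) K * prod (g n) E'"
        using fin disj by (intro prod.union_disjoint) (auto intro: finite_subset)
      then show "(\<Prod>x\<in>K. \<alpha> x * g n x) / 2 ^ card I * prod (g n) E' = prod \<alpha> K / 2 ^ card I * prod (g n) (K \<union> E')"
        by (simp add: prod.distrib)
    qed
    finally show ?thesis .
  qed
  have char0: "(\<Sum>n<2 ^ m. prod (g n) (K \<union> E')) = (if K \<union> E' = {} then 2 ^ m else 0)" if "K \<subseteq> I" for K
  proof (cases "K \<union> E' = {}")
    case False
    have sub: "K \<union> E' \<subseteq> (SIGMA j:{1..s}. ({1..u j} \<union> {v j}) \<inter> {1..m})"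
    proof -
      have "I \<subseteq> (SIGMA j:{1..s}. ({1..u j} \<union> {v j}) \<inter> {1..m})"
        unfolding I_def using r by (fastforce intro: order_trans)
      moreover have "E' \<subseteq> (SIGMA j:{1..s}. ({1..u j} \<union> {v j}) \<inter> {1..m})"
        unfolding E'_def using E by fastforce
      ultimately show ?thesis using that by blast
    qed
    have "(\<Sum>n<2 ^ m. \<Prod>(j, l)\<in>K \<union> E'. rad m l (Y n j)) = 0"
      using net[unfolded order2_net_def, THEN conjunct2, rule_format, of u v "K \<union> E'"] False sub uv sum_uv
      by auto
    then show ?thesis using False by (simp add: g_def)
  qed simp
  have "(\<Sum>n<2 ^ m. \<Prod>j\<in>{1..s}. of_bool (a j div 2 ^ (m - r j) = Y n j div 2 ^ (m - r j)) *
        (\<Prod>l\<in>E j. rad m l (Y n j)))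
      = (\<Sum>n<2 ^ m. \<Sum>K\<in>Pow I. prod \<alpha> K / 2 ^ card I * prod (g n) (K \<union> E'))"
    by (intro sum.cong refl term_eq) auto
  also have "\<dots> = (\<Sum>K\<in>Pow I. prod \<alpha> K / 2 ^ card I * (\<Sum>n<2 ^ m. prod (g n) (K \<union> E')))"
    by (subst sum.swap) (simp add: sum_distrib_left)
  also have "\<dots> = (\<Sum>K\<in>Pow I. if K = {} then (if E' = {} then 2 ^ m / 2 ^ card I else 0) else 0)"
    by (intro sum.cong refl) (auto simp: char0)
  also have "\<dots> = (if E' = {} then 2 ^ m / 2 ^ card I else 0)"
    using fin by (simp add: sum.delta)
  also have "E' = {} \<longleftrightarrow> (\<forall>j\<in>{1..s}. E j = {})" unfolding E'_def by auto
  finally show ?thesis by (simp only: cardI)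
qed

lemma box_count_nonneg: "box_count s m Y r a \<ge> 0"
  unfolding box_count_def by (intro sum_nonneg prod_nonneg) auto

lemma box_count_eq:
  assumes "order2_net s T m Y" "\<And>j. j \<in> {1..s} \<Longrightarrow> a j < 2 ^ m" "\<And>j. j \<in> {1..s} \<Longrightarrow> r j \<le> m"
    and "(\<Sum>j\<in>{1..s}. r j) + T \<le> m"
  shows "box_count s m Y r a = 2 ^ m / 2 ^ (\<Sum>j\<in>{1..s}. r j)"
  using box_char_sum[OF assms(1,2), where u = r and v = r and r = r and E = "\<lambda>_. {}"] assms(3,4)
  by (simp add: box_count_def sum.distrib)

lemma sum_eq_witness_le:
  fixes r :: "'a \<Rightarrow> nat"
  assumes "finite J" "c \<le> (\<Sum>j\<in>J. r j)"
  shows "\<exists>r'. (\<forall>j\<in>J. r' j \<le> r j) \<and> (\<Sum>j\<in>J. r' j) = c"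
  using assms
proof (induction J arbitrary: c rule: finite_induct)
  case (insert x J)
  have "c - min c (r x) \<le> (\<Sum>j\<in>J. r j)" using insert.prems insert.hyps by simp
  then obtain r' where r': "\<forall>j\<in>J. r' j \<le> r j" "(\<Sum>j\<in>J. r' j) = c - min c (r x)"
    using insert.IH by blast
  have "(\<Sum>j\<in>insert x J. (r'(x := min c (r x))) j) = min c (r x) + (\<Sum>j\<in>J. r' j)"
    using insert.hyps by (simp add: sum.insert) (intro sum.cong, auto)
  then show ?case using r' by (intro exI[of _ "r'(x := min c (r x))"]) auto
qed simp

lemma box_count_mono:
  assumes "\<And>j. j \<in> {1..s} \<Longrightarrow> r' j \<le> r j" "\<And>j. j \<in> {1..s} \<Longrightarrow> r j \<le> m"
  shows "box_count s m Y r a \<le> box_count s m Y r' a"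
  unfolding box_count_def
proof (intro sum_mono prod_mono conjI)
  fix n j assume j: "j \<in> {1..s}"
  have "x div 2 ^ (m - r' j) = x div 2 ^ (m - r j) div 2 ^ (r j - r' j)" for x :: nat
    using assms[OF j] by (simp add: div_mult2_eq[symmetric] flip: power_add)
  then show "of_bool (a j div 2 ^ (m - r j) = Y n j div 2 ^ (m - r j))
      \<le> (of_bool (a j div 2 ^ (m - r' j) = Y n j div 2 ^ (m - r' j)) :: real)"
    by simp
qed auto

text \<open>Beyond total resolution \<open>m - T\<close> the net property gives no exact count, but
  a fine box lies in a coarser one whose total resolution \<open>c\<close> is still
  admissible.\<close>

lemma box_count_le:
  assumes net: "order2_net s T m Y" and a: "\<And>j. j \<in> {1..s} \<Longrightarrow> a j < 2 ^ m"
    and r: "\<And>j. j \<in> {1..s} \<Longrightarrow> r j \<le> m"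
  shows "box_count s m Y r a \<le> 2 ^ (T + (m - (\<Sum>j\<in>{1..s}. r j)))"
proof -
  define c where "c = min (\<Sum>j\<in>{1..s}. r j) (m - T)"
  obtain r' where r': "\<forall>j\<in>{1..s}. r' j \<le> r j" "(\<Sum>j\<in>{1..s}. r' j) = c"
    using sum_eq_witness_le[of "{1..s}" c r] by (auto simp: c_def)
  have "box_count s m Y r a \<le> box_count s m Y r' a" using r r' by (intro box_count_mono) auto
  also have "\<dots> \<le> 2 ^ (m - c)"
  proof (cases "T \<le> m")
    case True
    have "r' j \<le> m" if "j \<in> {1..s}" for j using r r' that order_trans by blast
    then have "box_count s m Y r' a = 2 ^ m / 2 ^ c"
      using box_count_eq[OF net a, where r = r'] r' True by (auto simp: c_def)
    then show ?thesis by (simp add: c_def power_diff)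
  next
    case False
    \<comment> \<open>Now \<open>m - T = 0\<close> and hence \<open>c = 0\<close>; the total number
      of points is bound enough.\<close>
    have "box_count s m Y r' a \<le> (\<Sum>n<(2::nat) ^ m. 1)"
      unfolding box_count_def by (intro sum_mono prod_le_1) auto
    then show ?thesis using False by (simp add: c_def)
  qed
  also have "(2::real) ^ (m - c) \<le> 2 ^ (T + (m - (\<Sum>j\<in>{1..s}. r j)))"
    by (intro power_increasing) (auto simp: c_def)
  finally show ?thesis .
qed

lemma card_same_prefix:
  fixes y :: nat
  assumes "y < 2 ^ m" "r \<le> m"
  shows "(\<Sum>a<2 ^ m. of_bool (a div 2 ^ (m - r) = y div 2 ^ (m - r))) = (2 ^ m / 2 ^ r :: real)"
proof -
  define q where "q = (2::nat) ^ (m - r)"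
  have q: "q > 0" "2 ^ m = 2 ^ r * q" using assms by (simp_all add: q_def flip: power_add)
  define c where "c = y div q"
  have "c < 2 ^ r" unfolding c_def using assms q by (simp add: less_mult_imp_div_less)
  then have le: "c * q + q \<le> 2 ^ m"
    unfolding q(2) by (metis Suc_leI add.commute mult_Suc mult_le_mono1)
  have iff: "a div q = c \<longleftrightarrow> c * q \<le> a \<and> a < c * q + q" for a :: nat
  proof
    assume "a div q = c"
    then show "c * q \<le> a \<and> a < c * q + q"
      using dividend_less_div_times[OF q(1), of a] div_times_less_eq_dividend[of a q] by auto
  next
    assume "c * q \<le> a \<and> a < c * q + q"
    then show "a div q = c" by (intro div_nat_eqI) (simp_all add: mult.commute)
  qed
  have "{a\<in>{..<2 ^ m}. a div q = c} = {c * q..<c * q + q}"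
    unfolding iff using le by auto
  moreover have "(\<Sum>a<2 ^ m. of_bool (a div q = c)) = (\<Sum>a\<in>{a\<in>{..<2 ^ m}. a div q = c}. 1 :: real)"
    unfolding of_bool_def by (rule sum.inter_filter[symmetric]) simp
  ultimately have "(\<Sum>a<2 ^ m. of_bool (a div q = c)) = real q"
    by simp
  moreover have "real q = 2 ^ m / 2 ^ r" using assms(2) unfolding q_def by (simp only: of_nat_power) (simp add: power_diff)
  ultimately show ?thesis unfolding c_def q_def by simp
qed

text \<open>Double counting: every point is seen from the same number of grid values
  \<open>a\<close>. This works at every resolution, also where most boxes are empty and
  \<open>box_count_eq\<close> fails.\<close>

lemma sum_box_count:
  assumes net: "order2_net s T m Y" and r: "\<And>j. j \<in> {1..s} \<Longrightarrow> r j \<le> m"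
  shows "(\<Sum>a\<in>PiE {1..s} (\<lambda>_. {..<2 ^ m}). box_count s m Y r a)
    = (2 ^ m) ^ s * (2 ^ m / 2 ^ (\<Sum>j\<in>{1..s}. r j))"
proof -
  have Y: "Y n j < 2 ^ m" if "n < 2 ^ m" "j \<in> {1..s}" for n j
    using net that unfolding order2_net_def by blast
  have "(\<Sum>a\<in>PiE {1..s} (\<lambda>_. {..<2 ^ m}). box_count s m Y r a)
    = (\<Sum>n<2 ^ m. \<Sum>a\<in>PiE {1..s} (\<lambda>_. {..<2 ^ m}).
        \<Prod>j\<in>{1..s}. of_bool (a j div 2 ^ (m - r j) = Y n j div 2 ^ (m - r j)))"
    unfolding box_count_def by (rule sum.swap)
  also have "\<dots> = (\<Sum>n<2 ^ m. \<Prod>j\<in>{1..s}. \<Sum>a<2 ^ m.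
        of_bool (a div 2 ^ (m - r j) = Y n j div 2 ^ (m - r j)))"
    by (subst prod_sum_PiE) auto
  also have "\<dots> = (\<Sum>n<(2::nat) ^ m. \<Prod>j\<in>{1..s}. 2 ^ m / 2 ^ r j)"
    using Y r by (intro sum.cong prod.cong refl card_same_prefix) auto
  also have "\<dots> = (2 ^ m) ^ s * (2 ^ m / 2 ^ (\<Sum>j\<in>{1..s}. r j))"
    by (simp add: prod_dividef power_sum)
  finally show ?thesis .
qed

section \<open>Haar decomposition of the discrepancy\<close>

text \<open>The factor (a + 1/2) / 2^m is the mean of \<open>half_step y a\<close> over all y < 2^m,
  so the volume term is what perfectly distributed points would contribute.\<close>

definition discrete_discrepancy :: "nat \<Rightarrow> nat \<Rightarrow> (nat \<Rightarrow> nat \<Rightarrow> nat) \<Rightarrow> (nat \<Rightarrow> nat) \<Rightarrow> real" where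
  "discrete_discrepancy s m Y a =
     (\<Sum>n<2 ^ m. \<Prod>j\<in>{1..s}. half_step (Y n j) (a j)) - 2 ^ m * (\<Prod>j\<in>{1..s}. (real (a j) + 1 / 2) / 2 ^ m)"

text \<open>The subtracted factors are the means of \<open>haar_part\<close> over all
  \<open>y\<close>: the Walsh terms with \<open>d > 0\<close> average to zero on the prefix
  interval, which has the share 1 / 2^(i-1). For \<open>i = 0\<close> truncated subtraction gives
  the share 1, as it should.\<close>

definition haar_block :: "nat \<Rightarrow> nat \<Rightarrow> (nat \<Rightarrow> nat \<Rightarrow> nat) \<Rightarrow> (nat \<Rightarrow> nat) \<Rightarrow> (nat \<Rightarrow> nat) \<Rightarrow> real" where
  "haar_block s m Y i a =
     (\<Sum>n<2 ^ m. \<Prod>j\<in>{1..s}. haar_part m (i j) (Y n j) (a j)) -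
     2 ^ m * (\<Prod>j\<in>{1..s}. haar_coeff m (i j) 0 (a j) / 2 ^ (i j - 1))"

definition haar_error :: "nat \<Rightarrow> nat \<Rightarrow> (nat \<Rightarrow> nat \<Rightarrow> nat) \<Rightarrow> (nat \<Rightarrow> nat) \<Rightarrow> (nat \<Rightarrow> nat) \<Rightarrow> (nat \<Rightarrow> nat) \<Rightarrow> real" where
  "haar_error s m Y i d a =
     (\<Sum>n<2 ^ m. \<Prod>j\<in>{1..s}.
        of_bool (a j div 2 ^ (m - (i j - 1)) = Y n j div 2 ^ (m - (i j - 1))) *
        (\<Prod>l\<in>haar_freq (i j) (d j). rad m l (Y n j))) -
     (if \<forall>j\<in>{1..s}. d j = 0 then 2 ^ m / 2 ^ (\<Sum>j\<in>{1..s}. i j - 1) else 0)"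

text \<open>The partial sum up to level \<open>n\<close> is the midpoint of the dyadic interval of
  length 2^-n that contains \<open>a\<close>; passing to the next level moves it by a quarter of
  that length.\<close>

lemma sum_haar_coeff_mean_eq:
  assumes "a < 2 ^ m"
  shows "(\<Sum>i\<le>m. haar_coeff m i 0 a / 2 ^ (i - 1)) = (real a + 1 / 2) / 2 ^ m"
proof -
  have "(\<Sum>i\<le>n. haar_coeff m i 0 a / 2 ^ (i - 1)) = (real (a div 2 ^ (m - n)) + 1 / 2) / 2 ^ n" if "n \<le> m" for n
    using that
  proof (induction n)
    case 0
    then show ?case using assms by (simp add: haar_coeff_def)
  next
    case (Suc n)
    define a' where "a' = a div 2 ^ (m - Suc n)"
    have pow: "(2::nat) ^ (m - n) = 2 ^ (m - Suc n) * 2"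
      using Suc.prems by (metis Suc_diff_Suc Suc_le_eq power_Suc2)
    have ai: "a div 2 ^ (m - n) = a' div 2"
      by (simp add: a'_def pow div_mult2_eq)
    have r: "rad m (Suc n) a = (if odd a' then -1 else 1)"
      by (simp add: rad_def bit_iff_odd a'_def)
    have a': "real a' = 2 * real (a' div 2) + of_bool (odd a')"
      by (cases "odd a'") (auto elim!: oddE evenE)
    have "(\<Sum>i\<le>Suc n. haar_coeff m i 0 a / 2 ^ (i - 1))
        = (real (a' div 2) + 1 / 2) / 2 ^ n - rad m (Suc n) a / 4 / 2 ^ n"
      using Suc by (simp add: ai haar_coeff_def)
    also have "\<dots> = (real a' + 1 / 2) / 2 ^ Suc n"
      unfolding a' r by (simp add: field_simps)
    finally show ?case by (simp add: a'_def)
  qed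
  from this[of m] show ?thesis by simp
qed

lemma discrete_discrepancy_eq_sum:
  assumes Y: "\<And>n j. n < 2 ^ m \<Longrightarrow> j \<in> {1..s} \<Longrightarrow> Y n j < 2 ^ m"
    and a: "\<And>j. j \<in> {1..s} \<Longrightarrow> a j < 2 ^ m"
  shows "discrete_discrepancy s m Y a = (\<Sum>i\<in>PiE {1..s} (\<lambda>_. {..m}). haar_block s m Y i a)"
proof -
  have "(\<Sum>n<2 ^ m. \<Prod>j\<in>{1..s}. half_step (Y n j) (a j))
      = (\<Sum>n<2 ^ m. \<Prod>j\<in>{1..s}. \<Sum>i\<le>m. haar_part m i (Y n j) (a j))"
    using Y a by (intro sum.cong prod.cong refl half_step_eq_sum_haar_part) auto
  also have "\<dots> = (\<Sum>i\<in>PiE {1..s} (\<lambda>_. {..m}). \<Sum>n<2 ^ m. \<Prod>j\<in>{1..s}. haar_part m (i j) (Y n j) (a j))"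
    by (subst prod_sum_PiE) (auto intro: sum.swap)
  finally have 1: "(\<Sum>n<2 ^ m. \<Prod>j\<in>{1..s}. half_step (Y n j) (a j)) = \<dots>" .
  have "(\<Prod>j\<in>{1..s}. (real (a j) + 1 / 2) / 2 ^ m) = (\<Prod>j\<in>{1..s}. \<Sum>i\<le>m. haar_coeff m i 0 (a j) / 2 ^ (i - 1))"
    using a by (intro prod.cong refl sum_haar_coeff_mean_eq[symmetric]) auto
  also have "\<dots> = (\<Sum>i\<in>PiE {1..s} (\<lambda>_. {..m}). \<Prod>j\<in>{1..s}. haar_coeff m (i j) 0 (a j) / 2 ^ (i j - 1))"
    by (subst prod_sum_PiE) auto
  finally show ?thesis
    unfolding discrete_discrepancy_def haar_block_def sum_subtractf 1 by (simp add: sum_distrib_left)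
qed

section \<open>Bounds for a single Haar block\<close>

lemma abs_haar_coeff_le: "\<bar>haar_coeff m i d a\<bar> \<le> 1 / 2 ^ d"
  using rad_cases[of m i a] by (auto simp: haar_coeff_def divide_simps abs_mult)

lemma haar_freq_eq_empty_iff: "haar_freq i d = {} \<longleftrightarrow> d = 0"
  by (auto simp: haar_freq_def)

lemma haar_block_eq_sum_error:
  "haar_block s m Y i a = (\<Sum>d\<in>PiE {1..s} (\<lambda>j. {..m - i j}).
     (\<Prod>j\<in>{1..s}. haar_coeff m (i j) (d j) (a j)) * haar_error s m Y i d a)"
proof -
  define D where "D = PiE {1..s} (\<lambda>j. {..m - i j})"
  define P where "P n j = (of_bool (a j div 2 ^ (m - (i j - 1)) = Y n j div 2 ^ (m - (i j - 1))) :: real)" for n j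
  define c where "c d = (\<Prod>j\<in>{1..s}. haar_coeff m (i j) (d j) (a j))" for d
  define R where "R = (\<Sum>j\<in>{1..s}. i j - 1)"
  have finD: "finite D" unfolding D_def by (intro finite_PiE) auto
  have "(\<Prod>j\<in>{1..s}. haar_part m (i j) (Y n j) (a j))
      = (\<Sum>d\<in>D. c d * (\<Prod>j\<in>{1..s}. P n j * (\<Prod>l\<in>haar_freq (i j) (d j). rad m l (Y n j))))" for n
    unfolding haar_part_def P_def[symmetric] sum_distrib_left D_def c_def
    by (subst prod_sum_PiE) (auto simp: prod.distrib mult_ac)
  then have "(\<Sum>n<2 ^ m. \<Prod>j\<in>{1..s}. haar_part m (i j) (Y n j) (a j))
      = (\<Sum>d\<in>D. c d * (\<Sum>n<2 ^ m. \<Prod>j\<in>{1..s}. P n j * (\<Prod>l\<in>haar_freq (i j) (d j). rad m l (Y n j))))"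
    by (subst sum_distrib_left, subst sum.swap) simp
  moreover have "2 ^ m * (\<Prod>j\<in>{1..s}. haar_coeff m (i j) 0 (a j) / 2 ^ (i j - 1))
      = (\<Sum>d\<in>D. c d * (if \<forall>j\<in>{1..s}. d j = 0 then 2 ^ m / 2 ^ R else 0))"
  proof -
    \<comment> \<open>The volume term has no factor with \<open>d j > 0\<close>, so it is matched
      with the single index \<open>z\<close>.\<close>
    define z where "z = restrict (\<lambda>_. 0::nat) {1..s}"
    have z: "z \<in> D" "c z = (\<Prod>j\<in>{1..s}. haar_coeff m (i j) 0 (a j))"
      by (auto simp: z_def D_def c_def)
    have "(\<Sum>d\<in>D. c d * (if \<forall>j\<in>{1..s}. d j = 0 then 2 ^ m / 2 ^ R else 0))
        = (\<Sum>d\<in>D. if d = z then c z * (2 ^ m / 2 ^ R) else 0)"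
    proof (intro sum.cong refl)
      fix d assume "d \<in> D"
      then have "d = z \<longleftrightarrow> (\<forall>j\<in>{1..s}. d j = 0)"
        unfolding D_def z_def by (auto simp: PiE_def extensional_def restrict_def fun_eq_iff)
      then show "c d * (if \<forall>j\<in>{1..s}. d j = 0 then 2 ^ m / 2 ^ R else 0) = (if d = z then c z * (2 ^ m / 2 ^ R) else 0)"
        by auto
    qed
    also have "\<dots> = c z * (2 ^ m / 2 ^ R)" using finD z by simp
    finally show ?thesis unfolding z R_def by (simp add: prod_dividef power_sum)
  qed
  ultimately show ?thesis
    unfolding haar_block_def haar_error_def P_def[symmetric] R_def[symmetric] c_def[symmetric] D_def[symmetric]
    by (simp add: right_diff_distrib sum_subtractf)
qed

text \<open>The box involves digits up to \<open>i j - 1\<close> and the Walsh function adds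
  \<open>i j\<close> and \<open>i j + d j\<close>. So \<open>i j\<close> bounds the second highest
  digit and \<open>i j + d j\<close> the highest one, with total 2|i| + |d|. This is the place where
  order 2 acts.\<close>

lemma haar_error_eq_0:
  assumes net: "order2_net s T m Y" and a: "\<And>j. j \<in> {1..s} \<Longrightarrow> a j < 2 ^ m"
    and i: "\<And>j. j \<in> {1..s} \<Longrightarrow> i j \<le> m" and d: "\<And>j. j \<in> {1..s} \<Longrightarrow> d j \<le> m - i j"
    and sum: "2 * (\<Sum>j\<in>{1..s}. i j) + (\<Sum>j\<in>{1..s}. d j) + 2 * T \<le> 2 * m"
  shows "haar_error s m Y i d a = 0"
proof -
  have "(\<Sum>n<2 ^ m. \<Prod>j\<in>{1..s}. of_bool (a j div 2 ^ (m - (i j - 1)) = Y n j div 2 ^ (m - (i j - 1))) *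
        (\<Prod>l\<in>haar_freq (i j) (d j). rad m l (Y n j)))
      = (if \<forall>j\<in>{1..s}. haar_freq (i j) (d j) = {} then 2 ^ m / 2 ^ (\<Sum>j\<in>{1..s}. i j - 1) else 0)"
  proof (rule box_char_sum[OF net a, where u = i and v = "\<lambda>j. i j + d j"])
    show "(\<Sum>j\<in>{1..s}. i j + (i j + d j)) + 2 * T \<le> 2 * m"
      using sum by (simp add: sum.distrib)
    fix j assume j: "j \<in> {1..s}"
    show "haar_freq (i j) (d j) \<subseteq> ({1..i j} \<union> {i j + d j}) \<inter> {1..m} - {1..i j - 1}"
      using i[OF j] d[OF j] by (auto simp: haar_freq_def split: if_splits)
    show "i j - 1 \<le> m" using i[OF j] by simp
  qed auto
  then show ?thesis by (simp add: haar_error_def haar_freq_eq_empty_iff)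
qed

lemma abs_haar_error_le:
  "\<bar>haar_error s m Y i d a\<bar> \<le> box_count s m Y (\<lambda>j. i j - 1) a + 2 ^ m / 2 ^ (\<Sum>j\<in>{1..s}. i j - 1)"
proof -
  have "\<bar>\<Sum>n<2 ^ m. \<Prod>j\<in>{1..s}. of_bool (a j div 2 ^ (m - (i j - 1)) = Y n j div 2 ^ (m - (i j - 1))) *
        (\<Prod>l\<in>haar_freq (i j) (d j). rad m l (Y n j))\<bar> \<le> box_count s m Y (\<lambda>j. i j - 1) a"
    unfolding box_count_def
  proof (rule order_trans[OF sum_abs sum_mono])
    fix n
    have "\<bar>\<Prod>l\<in>L. rad m l y\<bar> = 1" for L y
      unfolding abs_prod by (intro prod.neutral) (auto simp: rad_def)
    then show "\<bar>\<Prod>j\<in>{1..s}. of_bool (a j div 2 ^ (m - (i j - 1)) = Y n j div 2 ^ (m - (i j - 1))) *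
        (\<Prod>l\<in>haar_freq (i j) (d j). rad m l (Y n j))\<bar>
        \<le> (\<Prod>j\<in>{1..s}. of_bool (a j div 2 ^ (m - (i j - 1)) = Y n j div 2 ^ (m - (i j - 1))))"
      by (simp add: abs_prod abs_mult)
  qed
  then show ?thesis unfolding haar_error_def by (smt (verit, best) divide_nonneg_nonneg zero_le_power)
qed

lemma sum_PiE_power_le:
  fixes x :: real
  assumes "0 \<le> x" "x < 1"
  shows "(\<Sum>d\<in>PiE {1..s} (\<lambda>j. {..b j}). x ^ (\<Sum>j\<in>{1..s}. d j)) \<le> (1 / (1 - x)) ^ s"
proof -
  have geo: "(\<Sum>d\<le>n. x ^ d) \<le> 1 / (1 - x)" for n
    using assms sum_gp_strict[of x "Suc n"] by (auto simp: lessThan_Suc_atMost divide_right_mono)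
  have "(\<Sum>d\<in>PiE {1..s} (\<lambda>j. {..b j}). x ^ (\<Sum>j\<in>{1..s}. d j)) = (\<Prod>j\<in>{1..s}. \<Sum>d\<le>b j. x ^ d)"
    by (subst prod_sum_PiE) (auto simp: power_sum)
  also have "\<dots> \<le> (\<Prod>j\<in>{1..s}. 1 / (1 - x))"
    using assms by (intro prod_mono conjI geo sum_nonneg) auto
  finally show ?thesis by simp
qed

lemma abs_haar_coeff_prod_le:
  "\<bar>\<Prod>j\<in>{1..s}. haar_coeff m (i j) (d j) (a j)\<bar> \<le> (1 / 2) ^ (\<Sum>j\<in>{1..s}. d j)"
proof -
  have "\<bar>\<Prod>j\<in>{1..s}. haar_coeff m (i j) (d j) (a j)\<bar> \<le> (\<Prod>j\<in>{1..s}. (1 / 2) ^ d j)"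
    unfolding abs_prod using abs_haar_coeff_le by (intro prod_mono) (auto simp: power_divide)
  then show ?thesis by (simp add: power_sum)
qed

text \<open>Serves the case |i| > m, where no cancellation is available: the block is large only on
  boxes that contain points, and a moment bound follows from averaging the counts.\<close>

lemma abs_haar_block_le_count:
  "\<bar>haar_block s m Y i a\<bar> \<le> 2 ^ s * (box_count s m Y (\<lambda>j. i j - 1) a + 2 ^ m / 2 ^ (\<Sum>j\<in>{1..s}. i j - 1))"
  (is "_ \<le> _ * ?z")
proof -
  have z: "?z \<ge> 0" using box_count_nonneg by (simp add: add_nonneg_nonneg)
  have "\<bar>haar_block s m Y i a\<bar> \<le> (\<Sum>d\<in>PiE {1..s} (\<lambda>j. {..m - i j}). (1 / 2) ^ (\<Sum>j\<in>{1..s}. d j) * ?z)"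
    unfolding haar_block_eq_sum_error
    by (intro order_trans[OF sum_abs sum_mono])
      (simp only: abs_mult, intro mult_mono abs_haar_coeff_prod_le abs_haar_error_le, auto)
  also have "\<dots> \<le> (1 / (1 - 1 / 2)) ^ s * ?z"
    unfolding sum_distrib_right[symmetric] by (intro mult_right_mono sum_PiE_power_le z) auto
  finally show ?thesis by simp
qed

lemma sum_le_sum_pred:
  fixes i :: "nat \<Rightarrow> nat"
  shows "(\<Sum>j\<in>{1..s}. i j) \<le> (\<Sum>j\<in>{1..s}. i j - 1) + s"
proof -
  have "(\<Sum>j\<in>{1..s}. i j) \<le> (\<Sum>j\<in>{1..s}. (i j - 1) + 1)" by (intro sum_mono) auto
  then show ?thesis by (simp only: sum.distrib) simp
qed

text \<open>The error vanishes unless \<open>|d| \<ge> 2 (m - |i|) - 2 T\<close>, and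
  \<open>2\<^sup>-\<^sup>|\<^sup>d\<^sup>| = (3/4)\<^sup>|\<^sup>d\<^sup>| (2/3)\<^sup>|\<^sup>d\<^sup>|\<close>; as \<open>2 (2/3)\<^sup>2 < 1\<close>, the second factor beats
  the number \<open>2\<^sup>m\<^sup>-\<^sup>|\<^sup>i\<^sup>|\<close> of points in a box.\<close>

lemma abs_haar_block_le_geometric:
  assumes net: "order2_net s T m Y" and a: "\<And>j. j \<in> {1..s} \<Longrightarrow> a j < 2 ^ m"
    and i: "\<And>j. j \<in> {1..s} \<Longrightarrow> i j \<le> m" and le: "(\<Sum>j\<in>{1..s}. i j) \<le> m"
  shows "\<bar>haar_block s m Y i a\<bar> \<le> 2 ^ (T + s + 1) * (9 / 4) ^ T * 4 ^ s * (8 / 9) ^ (m - (\<Sum>j\<in>{1..s}. i j))"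
proof -
  define n where "n = m - (\<Sum>j\<in>{1..s}. i j)"
  define R where "R = (\<Sum>j\<in>{1..s}. i j - 1)"
  have R: "m - R \<le> n + s" "R \<le> m"
    using sum_le_sum_pred[of i s] le sum_mono[of "{1..s}" "\<lambda>j. i j - 1" i] unfolding n_def R_def by auto
  have err: "\<bar>haar_error s m Y i d a\<bar> \<le> 2 ^ (T + s + 1) * 2 ^ n" for d
  proof -
    have "box_count s m Y (\<lambda>j. i j - 1) a \<le> 2 ^ (T + (m - R))"
      unfolding R_def using i by (intro box_count_le[OF net a]) (auto intro: le_diff_conv[THEN iffD2] trans_le_add1)
    moreover have "(2::real) ^ m / 2 ^ R = 2 ^ (m - R)" using R by (simp add: power_diff)
    moreover have "(2::real) ^ (m - R) \<le> 2 ^ (T + (n + s))" "(2::real) ^ (T + (m - R)) \<le> 2 ^ (T + (n + s))"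
      using R by (auto intro!: power_increasing)
    ultimately have "\<bar>haar_error s m Y i d a\<bar> \<le> 2 ^ (T + (n + s)) + 2 ^ (T + (n + s))"
      using abs_haar_error_le[of s m Y i d a] unfolding R_def by linarith
    then show ?thesis by (simp add: power_add mult_ac)
  qed
  have term_le: "\<bar>(\<Prod>j\<in>{1..s}. haar_coeff m (i j) (d j) (a j)) * haar_error s m Y i d a\<bar>
      \<le> (3 / 4) ^ (\<Sum>j\<in>{1..s}. d j) * (2 ^ (T + s + 1) * (9 / 4) ^ T * (8 / 9) ^ n)"
    if d: "d \<in> PiE {1..s} (\<lambda>j. {..m - i j})" for d
  proof (cases "2 * (\<Sum>j\<in>{1..s}. i j) + (\<Sum>j\<in>{1..s}. d j) + 2 * T \<le> 2 * m")
    case True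
    then have "haar_error s m Y i d a = 0"
      using d by (intro haar_error_eq_0[OF net a i]) auto
    then show ?thesis by simp
  next
    case False
    define D where "D = (\<Sum>j\<in>{1..s}. d j)"
    have D: "2 * n \<le> D + 2 * T" using False le unfolding n_def D_def by auto
    have "(2 / 3 :: real) ^ (D + 2 * T) \<le> (2 / 3) ^ (2 * n)"
      using D by (intro power_decreasing) auto
    then have "(2 / 3 :: real) ^ D * (4 / 9) ^ T \<le> (4 / 9) ^ n"
      by (simp add: power_add power_mult power2_eq_square)
    then have "(2 / 3 :: real) ^ D * ((4 / 9) ^ T * (9 / 4) ^ T) \<le> (4 / 9) ^ n * (9 / 4) ^ T"
      unfolding mult.assoc[symmetric] by (intro mult_right_mono) auto
    then have D': "(2 / 3 :: real) ^ D \<le> (4 / 9) ^ n * (9 / 4) ^ T"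
      by (simp flip: power_mult_distrib)
    have "\<bar>(\<Prod>j\<in>{1..s}. haar_coeff m (i j) (d j) (a j)) * haar_error s m Y i d a\<bar>
        \<le> (1 / 2) ^ D * (2 ^ (T + s + 1) * 2 ^ n)"
      unfolding abs_mult D_def by (intro mult_mono abs_haar_coeff_prod_le err) auto
    also have "(1 / 2 :: real) ^ D = (3 / 4) ^ D * (2 / 3) ^ D"
      by (simp flip: power_mult_distrib)
    also have "(3 / 4 :: real) ^ D * (2 / 3) ^ D * (2 ^ (T + s + 1) * 2 ^ n)
        \<le> (3 / 4) ^ D * ((4 / 9) ^ n * (9 / 4) ^ T) * (2 ^ (T + s + 1) * 2 ^ n)"
      using D' by (intro mult_right_mono mult_left_mono) auto
    also have "\<dots> = (3 / 4) ^ D * (2 ^ (T + s + 1) * (9 / 4) ^ T * ((4 / 9) ^ n * 2 ^ n))"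
      by (simp only: mult_ac)
    also have "(4 / 9 :: real) ^ n * 2 ^ n = (8 / 9) ^ n"
      by (simp flip: power_mult_distrib)
    finally show ?thesis unfolding D_def .
  qed
  have "\<bar>haar_block s m Y i a\<bar> \<le> (\<Sum>d\<in>PiE {1..s} (\<lambda>j. {..m - i j}).
      (3 / 4) ^ (\<Sum>j\<in>{1..s}. d j) * (2 ^ (T + s + 1) * (9 / 4) ^ T * (8 / 9) ^ n))"
    unfolding haar_block_eq_sum_error by (intro order_trans[OF sum_abs sum_mono] term_le)
  also have "\<dots> \<le> (1 / (1 - 3 / 4)) ^ s * (2 ^ (T + s + 1) * (9 / 4) ^ T * (8 / 9) ^ n)"
    unfolding sum_distrib_right[symmetric] by (intro mult_right_mono sum_PiE_power_le) auto
  also have "\<dots> = 2 ^ (T + s + 1) * (9 / 4) ^ T * 4 ^ s * (8 / 9) ^ n" by simp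
  finally show ?thesis unfolding n_def .
qed

section \<open>Moments of the blocks and their sum over all indices\<close>

lemma sum_power_inj_le:
  fixes \<rho> :: real
  assumes "0 \<le> \<rho>" "\<rho> < 1" "finite S" "inj_on g S"
  shows "(\<Sum>y\<in>S. \<rho> ^ g y) \<le> 1 / (1 - \<rho>)"
proof -
  have "(\<Sum>y\<in>S. \<rho> ^ g y) = (\<Sum>n\<in>g ` S. \<rho> ^ n)" using assms by (simp add: sum.reindex)
  also have "\<dots> \<le> (\<Sum>n. \<rho> ^ n)" using assms by (intro sum_le_suminf summable_geometric) auto
  also have "\<dots> = 1 / (1 - \<rho>)" using assms by (intro suminf_geometric) auto
  finally show ?thesis .
qed

text \<open>With truncated subtraction the exponent is the distance of |i| from m. Once all
  coordinates but the last are fixed, the last one attains each distance at most twice, so two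
  geometric series remain.\<close>

lemma sum_PiE_dist_le:
  fixes \<rho> :: real
  assumes "0 \<le> \<rho>" "\<rho> < 1" "s \<ge> 1"
  shows "(\<Sum>i\<in>PiE {1..s} (\<lambda>_. {..m}). \<rho> ^ ((\<Sum>j\<in>{1..s}. i j) - m + (m - (\<Sum>j\<in>{1..s}. i j))))
      \<le> real (m + 1) ^ (s - 1) * (2 / (1 - \<rho>))"
proof -
  define J where "J = {1..s - 1}"
  have J: "{1..s} = insert s J" "s \<notin> J" using assms unfolding J_def by auto
  have inner: "(\<Sum>y\<le>m. \<rho> ^ ((y + c) - m + (m - (y + c)))) \<le> 2 / (1 - \<rho>)" for c
  proof -
    have "(\<Sum>y\<le>m. \<rho> ^ ((y + c) - m + (m - (y + c))))
        = (\<Sum>y\<in>{y. y \<le> m \<and> y + c \<le> m}. \<rho> ^ ((y + c) - m + (m - (y + c))))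
        + (\<Sum>y\<in>{y. y \<le> m \<and> \<not> y + c \<le> m}. \<rho> ^ ((y + c) - m + (m - (y + c))))"
      by (subst sum.union_disjoint[symmetric]) (auto intro!: sum.cong)
    also have "\<dots> \<le> 1 / (1 - \<rho>) + 1 / (1 - \<rho>)"
      using assms by (intro add_mono sum_power_inj_le) (auto simp: inj_on_def)
    finally show ?thesis by simp
  qed
  have "(\<Sum>i\<in>PiE {1..s} (\<lambda>_. {..m}). \<rho> ^ ((\<Sum>j\<in>{1..s}. i j) - m + (m - (\<Sum>j\<in>{1..s}. i j))))
      = (\<Sum>i\<in>PiE J (\<lambda>_. {..m}). \<Sum>y\<le>m. \<rho> ^ ((y + (\<Sum>j\<in>J. i j)) - m + (m - (y + (\<Sum>j\<in>J. i j)))))"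
  proof -
    have eq: "(\<Sum>j\<in>insert s J. (i(s := y)) j) = y + (\<Sum>j\<in>J. i j)" for i :: "nat \<Rightarrow> nat" and y
    proof -
      have "(\<Sum>j\<in>J. (i(s := y)) j) = (\<Sum>j\<in>J. i j)" using J(2) by (intro sum.cong) auto
      then show ?thesis using J(2) by (subst sum.insert) (auto simp: J_def)
    qed
    show ?thesis
      unfolding J(1) sum_PiE_insert[OF J(2), where S = "\<lambda>_. {..m}"] eq by (rule sum.swap)
  qed
  also have "\<dots> \<le> (\<Sum>i\<in>PiE J (\<lambda>_. {..m}). 2 / (1 - \<rho>))" by (intro sum_mono inner)
  also have "\<dots> = real (m + 1) ^ (s - 1) * (2 / (1 - \<rho>))"
    by (simp add: card_PiE J_def)
  finally show ?thesis .
qed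

text \<open>Each condition on \<open>\<rho>\<close> serves one regime. For |i| <= m the pointwise
  decay 8/9 is squared to 64/81. For |i| > m it is the mean of the block that decays, like
  (1/2)^(|i|-m), irrespective of the exponent; to appear as a \<open>k\<close>-th power, this
  requires 1/2 <= \<rho>^k.\<close>

lemma haar_block_moment_le:
  fixes s T k m :: nat
  assumes net: "order2_net s T m Y" and i: "i \<in> PiE {1..s} (\<lambda>_. {..m})" and "k \<ge> 1"
    and \<rho>: "64 / 81 \<le> \<rho>" "1 / 2 \<le> \<rho> ^ k"
  shows "(\<Sum>a\<in>PiE {1..s} (\<lambda>_. {..<2 ^ m}). haar_block s m Y i a ^ (2 * k))
    \<le> (2 ^ m) ^ s * ((2 ^ (T + s + 1) * (9 / 4) ^ T * 4 ^ s)\<^sup>2 *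
        \<rho> ^ ((\<Sum>j\<in>{1..s}. i j) - m + (m - (\<Sum>j\<in>{1..s}. i j)))) ^ k"
proof -
  define l where "l = (\<Sum>j\<in>{1..s}. i j)"
  define R where "R = (\<Sum>j\<in>{1..s}. i j - 1)"
  define Z :: real where "Z = 2 ^ (T + s + 1)"
  define C where "C = Z * (9 / 4) ^ T * 4 ^ s"
  define X where "X = PiE {1..s} (\<lambda>_. {..<(2::nat) ^ m})"
  have cardX: "real (card X) = (2 ^ m) ^ s" unfolding X_def by (simp add: card_PiE)
  have aX: "a j < 2 ^ m" if "a \<in> X" "j \<in> {1..s}" for a j using that unfolding X_def by auto
  have ij: "i j \<le> m" if "j \<in> {1..s}" for j using i that by auto
  have \<rho>0: "\<rho> > 0" using \<rho> by simp
  have C: "2 ^ s * Z \<le> C"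
  proof -
    have "Z * (1 * 2 ^ s) \<le> Z * ((9 / 4) ^ T * 4 ^ s)"
      by (intro mult_left_mono mult_mono power_mono) (auto simp: Z_def)
    then show ?thesis by (simp add: C_def mult_ac)
  qed
  show ?thesis
  proof (cases "l \<le> m")
    case True
    have "haar_block s m Y i a ^ (2 * k) \<le> (C\<^sup>2 * \<rho> ^ (m - l)) ^ k" if "a \<in> X" for a
    proof -
      have "\<bar>haar_block s m Y i a\<bar> \<le> C * (8 / 9) ^ (m - l)"
        using abs_haar_block_le_geometric[OF net, of a i] aX that ij True
        unfolding C_def Z_def l_def by blast
      then have "(haar_block s m Y i a)\<^sup>2 \<le> (C * (8 / 9) ^ (m - l))\<^sup>2"
        by (metis abs_ge_zero power2_abs power_mono)
      also have "\<dots> = C\<^sup>2 * (64 / 81) ^ (m - l)"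
        by (simp add: power_mult_distrib power_mult[symmetric] mult.commute[of _ 2]) (simp add: power_mult power_divide)
      also have "\<dots> \<le> C\<^sup>2 * \<rho> ^ (m - l)" using \<rho> by (intro mult_left_mono power_mono) auto
      finally show ?thesis by (simp add: power_mult power_mono)
    qed
    then have "(\<Sum>a\<in>X. haar_block s m Y i a ^ (2 * k)) \<le> real (card X) * (C\<^sup>2 * \<rho> ^ (m - l)) ^ k"
      by (intro sum_bounded_above) auto
    then show ?thesis
      using True unfolding cardX unfolding C_def Z_def X_def l_def by simp
  next
    case False
    define b where "b a = box_count s m Y (\<lambda>j. i j - 1) a" for a
    define h where "h = (2 ^ m / 2 ^ R :: real)"
    have R: "m - R \<le> s" "l \<le> R + s" using False sum_le_sum_pred[of i s] unfolding l_def R_def by auto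
    have h: "0 \<le> h" "h \<le> 2 ^ s * (1 / 2) ^ (l - m)"
    proof -
      have "(2::real) ^ m * 2 ^ (l - m) \<le> 2 ^ R * 2 ^ s"
        using R False unfolding power_add[symmetric] by (intro power_increasing) auto
      then show "h \<le> 2 ^ s * (1 / 2) ^ (l - m)" by (simp add: h_def field_simps)
    qed (simp add: h_def)
    have hs: "h \<le> 2 ^ (T + s)"
    proof -
      have "2 ^ s * (1 / 2 :: real) ^ (l - m) \<le> 2 ^ s * 1" by (intro mult_left_mono power_le_one) auto
      also have "\<dots> \<le> (2 :: real) ^ (T + s)" by (simp add: power_increasing)
      finally show ?thesis using h by simp
    qed
    have b: "0 \<le> b a" "b a \<le> 2 ^ (T + s)" if "a \<in> X" for a
    proof -
      show "0 \<le> b a" unfolding b_def by (rule box_count_nonneg)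
      have "b a \<le> 2 ^ (T + (m - R))" unfolding b_def R_def
      proof (rule box_count_le[OF net])
        show "i j - 1 \<le> m" if "j \<in> {1..s}" for j using ij[OF that] by simp
      qed (use aX that in auto)
      also have "\<dots> \<le> 2 ^ (T + s)" using R by (intro power_increasing) auto
      finally show "b a \<le> 2 ^ (T + s)" .
    qed
    \<comment> \<open>All but one of the 2k factors are bounded by their maximum \<open>Z\<close>;
      the last one is kept, since its mean over the grid is known from
      \<open>sum_box_count\<close>.\<close>
    have pt: "haar_block s m Y i a ^ (2 * k) \<le> (2 ^ s) ^ (2 * k) * Z ^ (2 * k - 1) * (b a + h)" if "a \<in> X" for a
    proof -
      have z: "0 \<le> b a + h" "b a + h \<le> Z" using b[OF that] h hs unfolding Z_def by auto
      have "\<bar>haar_block s m Y i a\<bar> \<le> 2 ^ s * (b a + h)"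
        using abs_haar_block_le_count unfolding b_def h_def R_def by blast
      then have "\<bar>haar_block s m Y i a\<bar> ^ (2 * k) \<le> (2 ^ s * (b a + h)) ^ (2 * k)"
        by (intro power_mono) auto
      also have "\<dots> = (2 ^ s) ^ (2 * k) * ((b a + h) ^ (2 * k - 1) * (b a + h))"
        using \<open>k \<ge> 1\<close> unfolding power_mult_distrib
        by (metis Suc_diff_1 mult_pos_pos not_one_le_zero power_Suc2 zero_less_numeral not_gr_zero)
      also have "\<dots> \<le> (2 ^ s) ^ (2 * k) * (Z ^ (2 * k - 1) * (b a + h))"
        using z by (intro mult_left_mono mult_right_mono power_mono) auto
      finally have "\<bar>haar_block s m Y i a\<bar> ^ (2 * k) \<le> (2 ^ s) ^ (2 * k) * (Z ^ (2 * k - 1) * (b a + h))" .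
      moreover have "\<bar>haar_block s m Y i a\<bar> ^ (2 * k) = haar_block s m Y i a ^ (2 * k)"
        by (rule power_even_abs) simp
      ultimately show ?thesis by (simp only: mult.assoc)
    qed
    have "(\<Sum>a\<in>X. haar_block s m Y i a ^ (2 * k)) \<le> (2 ^ s) ^ (2 * k) * Z ^ (2 * k - 1) * (\<Sum>a\<in>X. b a + h)"
      unfolding sum_distrib_left by (intro sum_mono pt)
    also have "(\<Sum>a\<in>X. b a + h) = (2 ^ m) ^ s * (2 * h)"
    proof -
      have "(\<Sum>a\<in>X. b a) = (2 ^ m) ^ s * h"
        unfolding X_def b_def h_def R_def
      proof (rule sum_box_count[OF net])
        show "i j - 1 \<le> m" if "j \<in> {1..s}" for j using ij[OF that] by simp
      qed
      then show ?thesis by (simp add: sum.distrib cardX)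
    qed
    also have "(2 ^ s) ^ (2 * k) * Z ^ (2 * k - 1) * ((2 ^ m) ^ s * (2 * h))
        \<le> (2 ^ s) ^ (2 * k) * Z ^ (2 * k - 1) * ((2 ^ m) ^ s * (Z * (1 / 2) ^ (l - m)))"
    proof -
      have "2 * h \<le> 2 * (2 ^ s * (1 / 2) ^ (l - m))" using h by simp
      also have "\<dots> = 2 ^ (s + 1) * (1 / 2) ^ (l - m)" by simp
      also have "\<dots> \<le> Z * (1 / 2) ^ (l - m)"
        unfolding Z_def by (intro mult_right_mono power_increasing) auto
      finally show ?thesis by (intro mult_left_mono) (auto simp: Z_def)
    qed
    also have "\<dots> = (2 ^ m) ^ s * ((2 ^ s * Z) ^ (2 * k) * (1 / 2) ^ (l - m))"
    proof -
      have "Z ^ (2 * k) = Z ^ (2 * k - 1) * Z"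
        using \<open>k \<ge> 1\<close> by (metis Suc_diff_1 mult_pos_pos not_one_le_zero power_Suc2 zero_less_numeral not_gr_zero)
      then show ?thesis by (simp add: power_mult_distrib mult_ac)
    qed
    also have "\<dots> \<le> (2 ^ m) ^ s * (C ^ (2 * k) * (\<rho> ^ k) ^ (l - m))"
      using C \<rho> by (intro mult_left_mono mult_mono power_mono) (auto simp: Z_def C_def)
    also have "C ^ (2 * k) * (\<rho> ^ k) ^ (l - m) = (C\<^sup>2 * \<rho> ^ (l - m)) ^ k"
      by (simp add: power_mult_distrib power_mult[symmetric] mult.commute)
    finally show ?thesis
      using False unfolding C_def Z_def X_def l_def by simp
  qed
qed

section \<open>Behaviour of the Haar blocks under digit flips\<close>

lemma flip_bit_less:
  fixes y :: nat
  assumes "y < 2 ^ m" "n < m"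
  shows "flip_bit n y < 2 ^ m"
proof -
  have "take_bit m (flip_bit n y) = flip_bit n (take_bit m y)"
    using assms by (simp add: take_bit_flip_bit_eq)
  also have "take_bit m y = y" using assms by (simp add: take_bit_nat_eq_self_iff)
  finally show ?thesis by (simp add: take_bit_nat_eq_self_iff)
qed

lemma div_flip_bit:
  fixes y :: nat
  assumes "n < k"
  shows "flip_bit n y div 2 ^ k = y div 2 ^ k"
proof -
  have "drop_bit k (flip_bit n y) = drop_bit k y"
    by (rule bit_eqI) (use assms in \<open>auto simp: bit_drop_bit_eq bit_flip_bit_iff\<close>)
  then show ?thesis by (simp add: drop_bit_eq_div)
qed

lemma rad_flip_bit:
  assumes "l \<le> m" "i \<le> m"
  shows "rad m i (flip_bit (m - l) a) = (if i = l then - rad m i a else rad m i a)"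
proof -
  have "m - l = m - i \<longleftrightarrow> i = l" using assms by linarith
  then show ?thesis unfolding rad_def bit_flip_bit_iff by simp
qed

lemma haar_coeff_flip_bit:
  assumes "1 \<le> l" "l \<le> m" "i \<le> l"
  shows "haar_coeff m i d (flip_bit (m - l) a) = (if i = l then - haar_coeff m i d a else haar_coeff m i d a)"
proof -
  have "rad m i (flip_bit (m - l) a) = (if i = l then - rad m i a else rad m i a)"
    using assms by (intro rad_flip_bit) auto
  then show ?thesis using assms unfolding haar_coeff_def by (cases "i = l") simp_all
qed

text \<open>As \<open>i \<le> l\<close>, the flip leaves the prefix of length \<open>i - 1\<close>
  alone, and beyond the prefix \<open>a\<close> occurs only in the sign
  \<open>rad m i a\<close>.\<close>

lemma haar_part_flip_bit:
  assumes "1 \<le> l" "l \<le> m" "i \<le> l"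
  shows "haar_part m i y (flip_bit (m - l) a) = (if i = l then - haar_part m i y a else haar_part m i y a)"
proof -
  have pre: "flip_bit (m - l) a div 2 ^ (m - (i - 1)) = a div 2 ^ (m - (i - 1))"
    using assms by (intro div_flip_bit) auto
  show ?thesis unfolding haar_part_def pre haar_coeff_flip_bit[OF assms] by (simp add: sum_negf)
qed

lemma haar_block_flip_bit:
  assumes "1 \<le> l" "l \<le> m" "j \<in> {1..s}" "i j \<le> l"
  shows "haar_block s m Y i (a(j := flip_bit (m - l) (a j)))
     = (if i j = l then - haar_block s m Y i a else haar_block s m Y i a)"
proof -
  have remove: "(\<Prod>j'\<in>{1..s}. f j' ((a(j := b)) j')) = f j b * (\<Prod>j'\<in>{1..s} - {j}. f j' (a j'))"
    for f :: "nat \<Rightarrow> nat \<Rightarrow> real" and b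
  proof -
    have "(\<Prod>j'\<in>{1..s} - {j}. f j' ((a(j := b)) j')) = (\<Prod>j'\<in>{1..s} - {j}. f j' (a j'))"
      by (intro prod.cong) auto
    then show ?thesis using assms by (subst prod.remove[of _ j]) auto
  qed
  have base: "(\<Prod>j'\<in>{1..s}. f j' (a j')) = f j (a j) * (\<Prod>j'\<in>{1..s} - {j}. f j' (a j'))"
    for f :: "nat \<Rightarrow> nat \<Rightarrow> real"
    using assms by (subst prod.remove[of _ j]) auto
  have flip: "(\<Prod>j'\<in>{1..s}. f j' ((a(j := flip_bit (m - l) (a j))) j'))
      = (if i j = l then -1 else 1) * (\<Prod>j'\<in>{1..s}. f j' (a j'))"
    if "f j (flip_bit (m - l) (a j)) = (if i j = l then - f j (a j) else f j (a j))"
    for f :: "nat \<Rightarrow> nat \<Rightarrow> real"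
    unfolding remove base that by simp
  have "(\<Prod>j'\<in>{1..s}. haar_part m (i j') (Y n j') ((a(j := flip_bit (m - l) (a j))) j'))
      = (if i j = l then -1 else 1) * (\<Prod>j'\<in>{1..s}. haar_part m (i j') (Y n j') (a j'))" for n
    by (rule flip[of "\<lambda>j'. haar_part m (i j') (Y n j')"]) (rule haar_part_flip_bit[OF assms(1,2,4)])
  moreover have "(\<Prod>j'\<in>{1..s}. haar_coeff m (i j') 0 ((a(j := flip_bit (m - l) (a j))) j') / 2 ^ (i j' - 1))
      = (if i j = l then -1 else 1) * (\<Prod>j'\<in>{1..s}. haar_coeff m (i j') 0 (a j') / 2 ^ (i j' - 1))"
    by (rule flip[of "\<lambda>j' b. haar_coeff m (i j') 0 b / 2 ^ (i j' - 1)"]) (simp add: haar_coeff_flip_bit[OF assms(1,2,4)])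
  ultimately show ?thesis
    unfolding haar_block_def by (simp add: sum_negf)
qed

lemma discrete_discrepancy_moment_le:
  fixes s T k m :: nat
  assumes net: "order2_net s T m Y" and "s \<ge> 1" "k \<ge> 1"
    and \<rho>: "64 / 81 \<le> \<rho>" "1 / 2 \<le> \<rho> ^ k" "\<rho> < 1"
  shows "(\<Sum>a\<in>PiE {1..s} (\<lambda>_. {..<2 ^ m}). discrete_discrepancy s m Y a ^ (2 * k))
    \<le> (2 ^ m) ^ s * (((2 * real k)\<^sup>2) ^ s * (2 ^ (T + s + 1) * (9 / 4) ^ T * 4 ^ s)\<^sup>2 * (2 / (1 - \<rho>)) *
        real (m + 1) ^ (s - 1)) ^ k"
proof -
  define X where "X = PiE {1..s} (\<lambda>_. {..<(2::nat) ^ m})"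
  define C :: real where "C = (2 ^ (T + s + 1) * (9 / 4) ^ T * 4 ^ s)\<^sup>2"
  define B where "B i = C * \<rho> ^ ((\<Sum>j\<in>{1..s}. i j) - m + (m - (\<Sum>j\<in>{1..s}. i j)))" for i
  define \<phi> where "\<phi> j l a = a(j := flip_bit (m - l) (a j))" for j l and a :: "nat \<Rightarrow> nat"
  have C0: "C \<ge> 0" unfolding C_def by simp
  have Y: "Y n j < 2 ^ m" if "n < 2 ^ m" "j \<in> {1..s}" for n j
    using net that unfolding order2_net_def by blast
  have "(\<Sum>a\<in>X. discrete_discrepancy s m Y a ^ (2 * k))
      = (\<Sum>a\<in>X. (\<Sum>i\<in>PiE {1..s} (\<lambda>_. {..m}). haar_block s m Y i a) ^ (2 * k))"
    by (intro sum.cong refl arg_cong2[of _ _ _ _ "(^)"] discrete_discrepancy_eq_sum Y) (auto simp: X_def)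
  also have "\<dots> \<le> (2 ^ m) ^ s * (((2 * real k)\<^sup>2) ^ card {1..s} * (\<Sum>i\<in>PiE {1..s} (\<lambda>_. {..m}). B i)) ^ k"
  proof (rule type2_multiparameter[where \<phi> = \<phi>])
    show "finite X" unfolding X_def by (intro finite_PiE) auto
    show "bij_betw (\<phi> j l) X X" if "j \<in> {1..s}" "l \<in> {1..m}" for j l
    proof -
      have "\<phi> j l a \<in> X" if a: "a \<in> X" for a
        using a \<open>j \<in> {1..s}\<close> \<open>l \<in> {1..m}\<close> unfolding \<phi>_def X_def
        by (auto simp: PiE_iff extensional_def intro!: flip_bit_less)
      moreover have "flip_bit n (flip_bit n b) = b" for n and b :: nat
        by (rule bit_eqI) (auto simp: bit_flip_bit_iff)
      then have "\<phi> j l (\<phi> j l a) = a" for a unfolding \<phi>_def by simp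
      ultimately show ?thesis by (intro bij_betw_byWitness[where f' = "\<phi> j l"]) auto
    qed
    show "(\<Sum>a\<in>X. haar_block s m Y i a ^ (2 * k)) \<le> (2 ^ m) ^ s * B i ^ k"
      if "i \<in> PiE {1..s} (\<lambda>_. {..m})" for i
      using haar_block_moment_le[OF net that \<open>k \<ge> 1\<close> \<rho>(1,2)] unfolding X_def B_def C_def .
    show "0 \<le> B i" for i using C0 \<rho>(1) unfolding B_def by simp
    fix i j l a assume *: "j \<in> {1..s}" "l \<in> {1..m}"
    show "haar_block s m Y i (\<phi> j l a) = haar_block s m Y i a" if "i j < l"
      using * that unfolding \<phi>_def by (subst haar_block_flip_bit) auto
    show "haar_block s m Y i (\<phi> j l a) = - haar_block s m Y i a" if "i j = l"
      using * that unfolding \<phi>_def by (subst haar_block_flip_bit) auto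
  qed (use \<open>k \<ge> 1\<close> in auto)
  also have "\<dots> \<le> (2 ^ m) ^ s * (((2 * real k)\<^sup>2) ^ s * (C * (real (m + 1) ^ (s - 1) * (2 / (1 - \<rho>))))) ^ k"
  proof (intro mult_left_mono power_mono)
    have "(\<Sum>i\<in>PiE {1..s} (\<lambda>_. {..m}). B i) \<le> C * (real (m + 1) ^ (s - 1) * (2 / (1 - \<rho>)))"
      unfolding B_def sum_distrib_left[symmetric]
      using \<rho> \<open>s \<ge> 1\<close> by (intro mult_left_mono[OF _ C0] sum_PiE_dist_le) auto
    then show "((2 * real k)\<^sup>2) ^ card {1..s} * (\<Sum>i\<in>PiE {1..s} (\<lambda>_. {..m}). B i)
      \<le> ((2 * real k)\<^sup>2) ^ s * (C * (real (m + 1) ^ (s - 1) * (2 / (1 - \<rho>))))"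
      unfolding card_atLeastAtMost diff_Suc_1 by (intro mult_left_mono) auto
    show "0 \<le> ((2 * real k)\<^sup>2) ^ card {1..s} * (\<Sum>i\<in>PiE {1..s} (\<lambda>_. {..m}). B i)"
      using C0 \<rho> unfolding B_def by (intro mult_nonneg_nonneg sum_nonneg) auto
  qed auto
  finally show ?thesis unfolding X_def C_def by (simp only: mult_ac)
qed

section \<open>Independence of the rows of the generating matrices\<close>

lemma poly_to_fls_0 [simp]: "poly_to_fls 0 = 0"
  by (simp add: poly_to_fls_def)

lemma poly_to_fls_pCons: "poly_to_fls (pCons a f) = fls_const a + fls_X_inv * poly_to_fls f"
  by (simp add: poly_to_fls_def map_poly_pCons)

lemma fls_nth_poly_to_fls: "fls_nth (poly_to_fls f) l = (if l \<le> 0 then coeff f (nat (- l)) else 0)"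
proof (induction f arbitrary: l)
  case (pCons a f)
  have "fls_nth (fls_X_inv * poly_to_fls f) l = fls_nth (poly_to_fls f) (l + 1)"
    by (simp add: fls_X_inv_times_conv_shift)
  also have "\<dots> = (if l + 1 \<le> 0 then coeff f (nat (- (l + 1))) else 0)" by (rule pCons.IH)
  finally have X: "fls_nth (fls_X_inv * poly_to_fls f) l = \<dots>" .
  show ?case
  proof (cases "l < 0")
    case True
    then have "nat (- l) = Suc (nat (- (l + 1)))" by simp
    then show ?thesis using True by (simp add: poly_to_fls_pCons X del: add_bit_eq_xor)
  next
    case False
    then show ?thesis using X by (cases "l = 0") (simp_all add: poly_to_fls_pCons del: add_bit_eq_xor)
  qed
qed simp

lemma poly_to_fls_add: "poly_to_fls (f + g) = poly_to_fls f + poly_to_fls g"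
  by (rule fls_eqI) (simp add: fls_nth_poly_to_fls del: add_bit_eq_xor)

lemma poly_to_fls_smult: "poly_to_fls (smult a f) = fls_const a * poly_to_fls f"
  by (rule fls_eqI) (simp add: fls_nth_poly_to_fls del: mult_bit_eq_and)

lemma poly_to_fls_mult: "poly_to_fls (f * g) = poly_to_fls f * poly_to_fls g"
proof (induction f)
  case (pCons a f)
  have "poly_to_fls (pCons a f * g) = fls_const a * poly_to_fls g + fls_X_inv * poly_to_fls (f * g)"
    by (simp add: mult_pCons_left poly_to_fls_add poly_to_fls_smult poly_to_fls_pCons)
  then show ?case by (simp add: pCons.IH poly_to_fls_pCons algebra_simps)
qed simp

lemma poly_to_fls_1 [simp]: "poly_to_fls 1 = 1"
  by (simp add: poly_to_fls_def)

lemma poly_to_fls_power: "poly_to_fls (f ^ n) = poly_to_fls f ^ n"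
  by (induction n) (simp_all add: poly_to_fls_mult)

lemma poly_to_fls_sum: "poly_to_fls (\<Sum>i\<in>A. f i) = (\<Sum>i\<in>A. poly_to_fls (f i))"
  by (induction A rule: infinite_finite_induct) (simp_all add: poly_to_fls_add)

lemma fls_subdegree_poly_to_fls:
  assumes "f \<noteq> 0"
  shows "fls_subdegree (poly_to_fls f) = - int (degree f)"
  by (rule fls_subdegree_eqI)
    (use assms in \<open>auto simp: fls_nth_poly_to_fls coeff_eq_0 simp del: bit_not_zero_iff\<close>)

lemma poly_to_fls_eq_0_iff [simp]: "poly_to_fls f = 0 \<longleftrightarrow> f = 0"
proof
  assume "poly_to_fls f = 0"
  moreover have "coeff f n = fls_nth (poly_to_fls f) (- int n)" for n
    by (simp add: fls_nth_poly_to_fls)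
  ultimately show "f = 0" by (intro poly_eqI) simp
qed simp

lemma
  assumes "irreducible_enumeration p" "j \<ge> 1"
  shows irreducible_enumeration_irreducible: "irreducible (p j)"
    and irreducible_enumeration_degree: "degree (p j) \<ge> 1"
proof -
  show *: "irreducible (p j)"
  proof (cases "j = 1")
    case True
    then show ?thesis using assms irreducible_linear_field_poly[of 1 0] by (simp add: irreducible_enumeration_def)
  next
    case False
    then have "p j \<in> p ` {2..}" using assms by auto
    then show ?thesis using assms by (simp add: irreducible_enumeration_def bij_betw_def)
  qed
  show "degree (p j) \<ge> 1"
  proof (rule ccontr)
    assume "\<not> ?thesis"
    then have "degree (p j) = 0" by simp
    moreover have "p j \<noteq> 0" using * by auto
    ultimately have "p j dvd 1" by (metis is_unit_iff_degree)
    then show False using * irreducible_not_unit by blast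
  qed
qed

lemma irreducible_enumeration_not_dvd:
  assumes p: "irreducible_enumeration p" and "i \<ge> 1" "j \<ge> 1" "i \<noteq> j"
  shows "\<not> p i dvd p j"
proof
  assume "p i dvd p j"
  then obtain c where c: "p j = p i * c" by (elim dvdE)
  have "\<not> p i dvd 1" using irreducible_enumeration_irreducible[OF p \<open>i \<ge> 1\<close>] irreducible_not_unit by blast
  then have "c dvd 1" using irreducible_enumeration_irreducible[OF p \<open>j \<ge> 1\<close>] c irreducibleD by blast
  then obtain b where b: "c = [:b:]" "b dvd 1" using is_unit_poly_iff by blast
  then have "b = 1" by (cases b) auto
  then have eq: "p j = p i" using b c by simp
  have 1: "p k \<noteq> [:0, 1:]" if "k \<ge> 2" for k
  proof -
    have "p k \<in> p ` {2..}" using that by simp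
    then show ?thesis using p by (simp add: irreducible_enumeration_def bij_betw_def)
  qed
  have "inj_on p {2..}" "p 1 = [:0, 1:]" using p by (auto simp: irreducible_enumeration_def bij_betw_def)
  moreover have "i = 1 \<or> i \<ge> 2" "j = 1 \<or> j \<ge> 2" using assms by auto
  ultimately show False using eq 1[of i] 1[of j] \<open>i \<noteq> j\<close> by (auto dest: inj_onD)
qed

lemma fls_subdegree_row:
  assumes "f \<noteq> 0"
  shows "fls_subdegree (poly_to_fls (monom 1 d) / poly_to_fls f ^ i) = int (i * degree f) - int d"
proof -
  define G where "G = poly_to_fls (monom 1 d) / poly_to_fls f ^ i"
  have mon: "monom (1::bit) d \<noteq> 0" by (simp add: monom_eq_0_iff)
  have eq: "G * poly_to_fls (f ^ i) = poly_to_fls (monom 1 d)"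
    using assms by (simp add: G_def poly_to_fls_power)
  moreover from this mon have "G \<noteq> 0" by auto
  ultimately have "fls_subdegree G + fls_subdegree (poly_to_fls (f ^ i)) = fls_subdegree (poly_to_fls (monom 1 d))"
    using assms by (simp flip: eq)
  then show ?thesis
    using assms mon by (simp add: G_def fls_subdegree_poly_to_fls degree_monom_eq degree_power_eq)
qed

text \<open>The rational function behind row \<open>k\<close> vanishes at infinity to the order i e
  - (e - z - 1) = (i - 1) e + z + 1 = k.\<close>

lemma gen_matrix_eq_0:
  assumes p: "irreducible_enumeration p" and "j \<ge> 1" "1 \<le> k" "l < k"
  shows "gen_matrix p j k l = 0"
proof -
  define e where "e = degree (p j)"
  define z where "z = (k - 1) mod e"
  define i where "i = (k - 1) div e + 1"
  have p0: "p j \<noteq> 0" using irreducible_enumeration_irreducible[OF p \<open>j \<ge> 1\<close>] by auto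
  have "e \<ge> 1" unfolding e_def by (rule irreducible_enumeration_degree[OF p \<open>j \<ge> 1\<close>])
  then have z: "z < e" unfolding z_def by simp
  have "(i - 1) * e + z = k - 1"
    unfolding i_def z_def add_diff_cancel_right' by (rule div_mult_mod_eq)
  moreover have "i * e = (i - 1) * e + e" by (simp add: i_def)
  ultimately have "int l < int (i * e) - int (e - z - 1)"
    using z assms by linarith
  then have "int l < fls_subdegree (poly_to_fls (monom 1 (e - z - 1)) / poly_to_fls (p j) ^ i)"
    using fls_subdegree_row[OF p0, of "e - z - 1" i] by (simp add: e_def)
  then show ?thesis
    unfolding gen_matrix_def Let_def e_def z_def i_def by (rule fls_eq0_below_subdegree)
qed

text \<open>Multiplied by the common denominator \<open>Q\<close>, a combination of the rational functions that
  define the rows becomes a polynomial \<open>W\<close>. If the first \<open>m \<ge> deg Q\<close> coefficients of the combination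
  vanish, then \<open>W = 0\<close>; reducing \<open>W\<close> modulo some \<open>p\<^sub>j\<close> of maximal exponent isolates a
  nonzero polynomial of degree less than \<open>deg p\<^sub>j\<close>.\<close>

lemma gen_matrix_rows_independent:
  assumes p: "irreducible_enumeration p" and K: "K \<noteq> {}" "K \<subseteq> (SIGMA j:{1..S}. {1..d j})"
    and m: "(\<Sum>j\<in>{1..S}. d j + degree (p j) - 1) \<le> m"
  shows "\<exists>l\<in>{1..m}. (\<Sum>(j, k)\<in>K. gen_matrix p j k l) \<noteq> 0"
proof (rule ccontr)
  assume "\<not> ?thesis"
  then have zero: "(\<Sum>(j, k)\<in>K. gen_matrix p j k l) = 0" if "l \<in> {1..m}" for l
    using that by (meson bexI)
  define e where "e j = degree (p j)" for j
  define ex where "ex j k = (k - 1) div e j + 1" for j k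
  define z where "z j k = (k - 1) mod e j" for j k
  \<comment> \<open>The exponent of \<open>p j\<close> in the common denominator. The inserted 0
    covers components from which \<open>K\<close> takes no row.\<close>
  define q where "q j = Max (insert 0 (ex j ` {k. (j, k) \<in> K}))" for j
  define G where "G j k = poly_to_fls (monom 1 (e j - z j k - 1)) / poly_to_fls (p j) ^ ex j k" for j k
  define rest where "rest j = (\<Prod>j'\<in>{1..S} - {j}. p j' ^ q j')" for j
  define Q where "Q = (\<Prod>j\<in>{1..S}. p j ^ q j)"
  define w where "w = (\<lambda>(j, k). monom 1 (e j - z j k - 1) * p j ^ (q j - ex j k) * rest j)"
  define W where "W = (\<Sum>x\<in>K. w x)"
  define L where "L = (\<Sum>(j, k)\<in>K. G j k)"
  have finK: "finite K" using K(2) by (rule finite_subset) auto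
  have finKj: "finite {k. (j, k) \<in> K}" for j
    using finK by (intro finite_surj[of K _ snd]) force+
  have e: "e j \<ge> 1" if "j \<ge> 1" for j using irreducible_enumeration_degree[OF p that] by (simp add: e_def)
  have irr: "irreducible (p j)" if "j \<ge> 1" for j by (rule irreducible_enumeration_irreducible[OF p that])
  have p0: "p j \<noteq> 0" if "j \<ge> 1" for j using irr[OF that] by auto
  have k: "k = (ex j k - 1) * e j + z j k + 1" "k \<ge> 1" "k \<le> d j" "j \<in> {1..S}" if "(j, k) \<in> K" for j k
  proof -
    have "(j, k) \<in> (SIGMA j:{1..S}. {1..d j})" using K(2) that by (rule subsetD)
    then show *: "k \<ge> 1" "k \<le> d j" "j \<in> {1..S}" by auto
    have "(ex j k - 1) * e j + z j k = k - 1"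
      unfolding ex_def z_def add_diff_cancel_right' by (rule div_mult_mod_eq)
    then show "k = (ex j k - 1) * e j + z j k + 1" using *(1) by linarith
  qed
  have z: "z j k < e j" if "(j, k) \<in> K" for j k
    using e[of j] k[OF that] unfolding z_def by simp
  have ex_le: "ex j k \<le> q j" if "(j, k) \<in> K" for j k
    unfolding q_def using that finKj by (intro Max_ge) auto
  \<comment> \<open>A row index k <= d forces (q - 1) e <= d - 1. Rounding up to a multiple of e
    thus costs at most e - 1 per component, which is the quality parameter of the sequence.\<close>
  have qe: "q j * e j \<le> d j + e j - 1" if j: "j \<in> {1..S}" for j
  proof -
    have "q j \<in> insert 0 (ex j ` {k. (j, k) \<in> K})" unfolding q_def using finKj by (intro Max_in) auto
    then consider "q j = 0" | k where "(j, k) \<in> K" "q j = ex j k" by auto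
    then show ?thesis
    proof cases
      case 2
      have "q j * e j = (ex j k - 1) * e j + e j"
        unfolding 2 by (simp add: ex_def)
      then show ?thesis using k[OF 2(1)] by linarith
    qed simp
  qed
  have degQ: "degree Q \<le> m"
  proof -
    have "degree Q = (\<Sum>j\<in>{1..S}. q j * e j)"
      unfolding Q_def e_def using p0 by (subst degree_prod_eq_sum_degree) (auto simp: degree_power_eq)
    also have "\<dots> \<le> (\<Sum>j\<in>{1..S}. d j + e j - 1)" by (intro sum_mono qe)
    finally show ?thesis using m by (simp add: e_def)
  qed
  have Q0: "Q \<noteq> 0" unfolding Q_def using p0 by auto
  have Gw: "G j k * poly_to_fls Q = poly_to_fls (w (j, k))" if jk: "(j, k) \<in> K" for j k
  proof -
    have j: "j \<in> {1..S}" "poly_to_fls (p j) \<noteq> 0" using k(4)[OF jk] p0 by auto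
    have "Q = p j ^ q j * rest j" unfolding Q_def rest_def using j by (subst prod.remove[of _ j]) auto
    also have "p j ^ q j = p j ^ ex j k * p j ^ (q j - ex j k)"
      using ex_le[OF jk] by (simp flip: power_add)
    finally show ?thesis
      using j by (simp add: G_def w_def poly_to_fls_mult poly_to_fls_power)
  qed
  have LW: "L * poly_to_fls Q = poly_to_fls W"
    unfolding L_def W_def poly_to_fls_sum sum_distrib_right by (intro sum.cong refl) (auto simp: Gw)
  have nthG: "fls_nth (G j k) l = 0" if jk: "(j, k) \<in> K" and l: "l \<le> 0" for j k l
  proof (rule fls_eq0_below_subdegree)
    have "e j \<le> ex j k * e j" by (simp add: ex_def)
    moreover have "fls_subdegree (G j k) = int (ex j k * e j) - int (e j - z j k - 1)"
      unfolding G_def e_def using k(4)[OF jk] p0 by (intro fls_subdegree_row) auto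
    ultimately show "l < fls_subdegree (G j k)" using l z[OF jk] by linarith
  qed
  have nthL: "fls_nth L l = 0" if "l \<le> int m" for l
  proof (cases "l \<le> 0")
    case True
    then show ?thesis unfolding L_def fls_nth_sum by (intro sum.neutral) (auto simp: nthG)
  next
    case False
    then have l: "nat l \<in> {1..m}" "int (nat l) = l" using that by auto
    have "fls_nth L l = (\<Sum>(j, k)\<in>K. gen_matrix p j k (nat l))"
      unfolding L_def fls_nth_sum gen_matrix_def Let_def G_def ex_def z_def e_def l(2)
      by (intro sum.cong refl) (simp add: case_prod_unfold)
    then show ?thesis using zero[OF l(1)] by simp
  qed
  \<comment> \<open>\<open>L\<close> starts at order m + 1 or later and multiplication by
    \<open>Q\<close> lowers this by at most m, so \<open>W\<close> would have positive order,
    whereas a nonzero polynomial has order at most 0.\<close>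
  have W0: "W = 0"
  proof (rule ccontr)
    assume W: "W \<noteq> 0"
    then have L0: "L \<noteq> 0" using LW by auto
    have "int m + 1 \<le> fls_subdegree L" using L0 nthL by (intro fls_subdegree_geI) auto
    moreover have "fls_subdegree L + fls_subdegree (poly_to_fls Q) = fls_subdegree (poly_to_fls W)"
      using L0 Q0 by (simp flip: LW)
    ultimately show False using degQ Q0 W by (simp add: fls_subdegree_poly_to_fls)
  qed
  obtain j0 k1 where jk1: "(j0, k1) \<in> K" using K(1) by auto
  have j0: "j0 \<in> {1..S}" "j0 \<ge> 1" using k(4)[OF jk1] by auto
  have q0: "q j0 \<ge> 1" using ex_le[OF jk1] by (simp add: ex_def)
  have "q j0 \<in> insert 0 (ex j0 ` {k. (j0, k) \<in> K})" unfolding q_def using finKj by (intro Max_in) auto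
  then obtain k0 where k0: "(j0, k0) \<in> K" "ex j0 k0 = q j0" using q0 by auto
  define Z where "Z = {k. (j0, k) \<in> K \<and> ex j0 k = q j0}"
  define A where "A = (\<Sum>k\<in>Z. monom (1::bit) (e j0 - z j0 k - 1))"
  have finZ: "finite Z" unfolding Z_def using finKj[of j0] by (rule rev_finite_subset) auto
  have prime: "prime_elem (p j0)" using irr[OF j0(2)] by (rule field_poly_irreducible_imp_prime)
  have dvd_w: "p j0 dvd w x" if "x \<in> K - Pair j0 ` Z" for x
  proof -
    obtain j k where x: "x = (j, k)" by fastforce
    show ?thesis
    proof (cases "j = j0")
      case True
      then have "ex j k < q j0" using that ex_le[of j k] unfolding x Z_def by force
      then have "p j0 dvd p j ^ (q j - ex j k)" using True by (simp add: dvd_power)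
      then show ?thesis unfolding x w_def by (simp add: dvd_mult dvd_mult2)
    next
      case False
      have "p j0 dvd p j0 ^ q j0" using q0 by (simp add: dvd_power)
      also have "\<dots> dvd rest j" unfolding rest_def using j0 False by (intro dvd_prodI) auto
      finally show ?thesis unfolding x w_def by (simp add: dvd_mult)
    qed
  qed
  have "W = (\<Sum>x\<in>K - Pair j0 ` Z. w x) + (\<Sum>x\<in>Pair j0 ` Z. w x)"
    unfolding W_def using finK by (intro sum.subset_diff) (auto simp: Z_def)
  also have "(\<Sum>x\<in>Pair j0 ` Z. w x) = (\<Sum>k\<in>Z. w (j0, k))"
    by (simp add: sum.reindex inj_on_def)
  also have "\<dots> = A * rest j0" unfolding A_def sum_distrib_right
    by (intro sum.cong refl) (auto simp: w_def Z_def)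
  finally have "(\<Sum>x\<in>K - Pair j0 ` Z. w x) + A * rest j0 = 0" using W0 by simp
  moreover have "p j0 dvd (\<Sum>x\<in>K - Pair j0 ` Z. w x)" by (intro dvd_sum dvd_w)
  ultimately have "p j0 dvd A * rest j0" by (metis dvd_0_right dvd_add_right_iff)
  moreover have "\<not> p j0 dvd rest j0"
  proof
    assume "p j0 dvd rest j0"
    then obtain x where "x \<in># image_mset (\<lambda>j. p j ^ q j) (mset_set ({1..S} - {j0}))" "p j0 dvd x"
      unfolding rest_def prod_unfold_prod_mset by (elim prime_elem_dvd_prod_msetE[OF prime])
    then have "\<exists>j\<in>{1..S} - {j0}. p j0 dvd p j ^ q j" by auto
    then obtain j where "j \<in> {1..S} - {j0}" "p j0 dvd p j ^ q j" by blast
    then show False using prime_elem_dvd_power[OF prime] irreducible_enumeration_not_dvd[OF p j0(2), of j] by auto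
  qed
  ultimately have dvdA: "p j0 dvd A" using prime_elem_dvd_multD[OF prime] by blast
  \<comment> \<open>Rows with equal exponent differ in \<open>z\<close>, so their monomials are
    distinct and cannot cancel in \<open>A\<close>.\<close>
  have zinj: "k = k0" if "k \<in> Z" "z j0 k = z j0 k0" for k
  proof -
    have a: "(j0, k) \<in> K" "ex j0 k = q j0" using that(1) by (auto simp: Z_def)
    have "k = (ex j0 k - 1) * e j0 + z j0 k + 1" by (rule k(1)[OF a(1)])
    also have "\<dots> = (ex j0 k0 - 1) * e j0 + z j0 k0 + 1" by (simp only: a(2) k0(2) that(2))
    also have "\<dots> = k0" by (rule k(1)[OF k0(1), symmetric])
    finally show ?thesis .
  qed
  have "coeff A (e j0 - z j0 k0 - 1) = (\<Sum>k\<in>Z. if k = k0 then 1 else 0)"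
    unfolding A_def coeff_sum
  proof (intro sum.cong refl)
    fix k assume kZ: "k \<in> Z"
    then have "e j0 - z j0 k - 1 = e j0 - z j0 k0 - 1 \<longleftrightarrow> k = k0"
      using zinj[OF kZ] z[of j0 k] z[OF k0(1)] unfolding Z_def by force
    then show "coeff (monom 1 (e j0 - z j0 k - 1)) (e j0 - z j0 k0 - 1) = (if k = k0 then 1 else 0 :: bit)"
      by simp
  qed
  also have "\<dots> = 1" using finZ k0 by (simp add: Z_def)
  finally have "A \<noteq> 0" by auto
  moreover have "degree A < e j0"
  proof -
    have "degree A \<le> e j0 - 1" unfolding A_def
      by (intro degree_sum_le finZ order_trans[OF degree_monom_le]) simp
    then show ?thesis using e[OF j0(2)] by simp
  qed
  moreover have "A \<noteq> 0 \<Longrightarrow> e j0 \<le> degree A" unfolding e_def by (rule dvd_imp_degree_le[OF dvdA])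
  ultimately show False by linarith
qed

section \<open>The interlaced blocks are order 2 nets\<close>

definition digit_prefix :: "(nat \<Rightarrow> bool) \<Rightarrow> nat \<Rightarrow> nat" where
  "digit_prefix b l = (\<Sum>d<l. of_bool (b (d + 1)) * 2 ^ (l - 1 - d))"

lemma digit_prefix_0 [simp]: "digit_prefix b 0 = 0"
  by (simp add: digit_prefix_def)

lemma digit_prefix_Suc: "digit_prefix b (Suc l) = 2 * digit_prefix b l + of_bool (b (Suc l))"
proof -
  have "(\<Sum>d<l. of_bool (b (d + 1)) * 2 ^ (l - d)) = 2 * (\<Sum>d<l. of_bool (b (d + 1)) * (2::nat) ^ (l - 1 - d))"
    unfolding sum_distrib_left
  proof (intro sum.cong refl)
    fix d assume "d \<in> {..<l}"
    then have "l - d = Suc (l - 1 - d)" by auto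
    then show "of_bool (b (d + 1)) * 2 ^ (l - d) = 2 * (of_bool (b (d + 1)) * (2::nat) ^ (l - 1 - d))" by simp
  qed
  then show ?thesis by (simp add: digit_prefix_def)
qed

lemma digit_prefix_less: "digit_prefix b l < 2 ^ l"
  by (induction l) (auto simp: digit_prefix_Suc)

lemma digit_prefix_div:
  assumes "l \<le> m"
  shows "digit_prefix b m div 2 ^ (m - l) = digit_prefix b l"
  using assms
proof (induction m rule: dec_induct)
  case (step m)
  have "digit_prefix b (Suc m) div 2 ^ (Suc m - l) = digit_prefix b (Suc m) div 2 div 2 ^ (m - l)"
    using step.hyps by (simp add: Suc_diff_le div_mult2_eq)
  also have "digit_prefix b (Suc m) div 2 = digit_prefix b m" by (simp add: digit_prefix_Suc)
  finally show ?case using step.IH by simp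
qed simp

lemma bit_digit_prefix:
  assumes "1 \<le> l" "l \<le> m"
  shows "bit (digit_prefix b m) (m - l) \<longleftrightarrow> b l"
proof -
  obtain l' where "l = Suc l'" using assms by (cases l) auto
  then show ?thesis using digit_prefix_div[OF assms(2)] by (simp add: bit_iff_odd digit_prefix_Suc)
qed

lemma digit_prefix_real: "real (digit_prefix b l) / 2 ^ l = (\<Sum>d<l. of_bool (b (d + 1)) / 2 ^ (d + 1))"
  by (induction l) (auto simp: digit_prefix_Suc add_divide_distrib)

lemma digit_prefix_add: "2 ^ t * digit_prefix b l \<le> digit_prefix b (l + t)"
    "digit_prefix b (l + t) < 2 ^ t * (digit_prefix b l + 1)"
  by (induction t) (auto simp: digit_prefix_Suc)

text \<open>Finitely many nonzero digits exclude an expansion that ends in ones; hence the tail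
  after digit \<open>l\<close> is strictly less than one unit and the floor reads off the
  digits.\<close>

lemma
  assumes x: "x = (\<Sum>d. of_bool (b (d + 1)) / 2 ^ (d + 1) :: real)" and b: "\<And>l. l > D \<Longrightarrow> \<not> b l"
  shows floor_digit_series: "\<lfloor>2 ^ l * x\<rfloor> = int (digit_prefix b l)"
    and dyadic_digit_series: "l \<ge> 1 \<Longrightarrow> dyadic_digit x l = of_bool (b l)"
proof -
  have "x = (\<Sum>d<l + D. of_bool (b (d + 1)) / 2 ^ (d + 1))"
    unfolding x by (intro suminf_finite) (auto simp: b)
  also have "\<dots> = real (digit_prefix b (l + D)) / 2 ^ (l + D)" by (rule digit_prefix_real[symmetric])
  finally have x2: "2 ^ l * x = real (digit_prefix b (l + D)) / 2 ^ D" by (simp add: power_add)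
  have "real (2 ^ D * digit_prefix b l) \<le> real (digit_prefix b (l + D))"
    using digit_prefix_add(1)[of D b l] by (simp only: of_nat_le_iff)
  moreover have "real (digit_prefix b (l + D)) < real (2 ^ D * (digit_prefix b l + 1))"
    using digit_prefix_add(2)[of b l D] by (simp only: of_nat_less_iff)
  ultimately have "real (digit_prefix b l) \<le> 2 ^ l * x" "2 ^ l * x < real (digit_prefix b l) + 1"
    unfolding x2 by (simp_all add: field_simps)
  then show *: "\<lfloor>2 ^ l * x\<rfloor> = int (digit_prefix b l)" by linarith
  show "dyadic_digit x l = of_bool (b l)" if l: "l \<ge> 1"
  proof -
    obtain l' where "l = Suc l'" using l by (cases l) auto
    then show ?thesis unfolding dyadic_digit_def * by (auto simp: digit_prefix_Suc)
  qed
qed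

lemma bit_imp_less: "bit (n::nat) i \<Longrightarrow> i < n"
proof (rule ccontr)
  assume "bit n i" "\<not> i < n"
  then have "n < 2 ^ i" using less_exp[of i] by linarith
  then show False using \<open>bit n i\<close> by (simp add: bit_iff_odd)
qed

lemma finite_bits: "finite {i. bit (n::nat) i}"
  by (rule finite_subset[of _ "{..<n}"]) (auto dest: bit_imp_less)

lemma sum_lessThan_add:
  fixes f :: "nat \<Rightarrow> 'a::comm_monoid_add"
  shows "(\<Sum>n<a + b. f n) = (\<Sum>n<a. f n) + (\<Sum>n<b. f (a + n))"
  by (induction b) (simp_all add: add.assoc)

text \<open>Digit \<open>2 d - 1\<close> of coordinate \<open>j\<close> is digit \<open>d\<close> of the component \<open>2 j - 1\<close>, and digit \<open>2 d\<close> is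
  digit \<open>d\<close> of the component \<open>2 j\<close>.\<close>

definition interlaced_digit :: "(nat \<Rightarrow> bit poly) \<Rightarrow> nat \<Rightarrow> nat \<Rightarrow> nat \<Rightarrow> bit" where
  "interlaced_digit p n j l = digital_digit p (2 * j - l mod 2) n ((l + 1) div 2)"

text \<open>The matrices are upper triangular and bit \<open>i\<close> of \<open>n\<close> is set
  only for \<open>i < n\<close>. The crude bound \<open>n\<close> on the number of digits suffices
  to make all expansions finite.\<close>

lemma digital_digit_eq_0:
  assumes p: "irreducible_enumeration p" and "j \<ge> 1" "k > n" "k \<ge> 1"
  shows "digital_digit p j n k = 0"
  unfolding digital_digit_def
proof (intro sum.neutral ballI)
  fix i assume "i \<in> {i. bit n i}"
  then have "i < n" by (simp add: bit_imp_less)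
  then show "gen_matrix p j k (i + 1) = 0" using assms by (intro gen_matrix_eq_0) auto
qed

lemma dyadic_digit_digital_seq:
  assumes p: "irreducible_enumeration p" and "j \<ge> 1" "k \<ge> 1"
  shows "dyadic_digit (digital_seq p n j) k = of_bit (digital_digit p j n k)"
  by (rule dyadic_digit_series[where D = n])
    (use assms digital_digit_eq_0[OF p \<open>j \<ge> 1\<close>] in \<open>auto simp: digital_seq_def\<close>)

lemma floor_interlaced_seq:
  assumes p: "irreducible_enumeration p" and "j \<ge> 1"
  shows "\<lfloor>2 ^ m * interlaced_seq p n j\<rfloor> = int (digit_prefix (\<lambda>l. odd (interlaced_digit p n j l)) m)"
proof (rule floor_digit_series[where D = "2 * n"])
  define f where "f l = (of_bit (interlaced_digit p n j l) :: real)" for l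
  have z: "interlaced_digit p n j l = 0" if "l > 2 * n" for l
    unfolding interlaced_digit_def using that \<open>j \<ge> 1\<close>
    by (intro digital_digit_eq_0[OF p]) (auto simp: mod_2_eq_odd)
  then show "\<not> odd (interlaced_digit p n j l)" if "l > 2 * n" for l using that by simp
  have d1: "dyadic_digit (digital_seq p n (2 * j - 1)) (d + 1) = f (2 * d + 1)" for d
    using \<open>j \<ge> 1\<close> by (subst dyadic_digit_digital_seq[OF p]) (auto simp: f_def interlaced_digit_def)
  have d2: "dyadic_digit (digital_seq p n (2 * j)) (d + 1) = f (2 * d + 2)" for d
    using \<open>j \<ge> 1\<close> by (subst dyadic_digit_digital_seq[OF p]) (auto simp: f_def interlaced_digit_def)
  have "interlaced_seq p n j = (\<Sum>d. f (2 * d + 1) / 2 ^ (2 * d + 1) + f (2 * d + 2) / 2 ^ (2 * d + 2))"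
    unfolding interlaced_seq_def interlace_point_def interlace_def d1 d2 by simp
  also have "\<dots> = (\<Sum>d<n. f (2 * d + 1) / 2 ^ (2 * d + 1) + f (2 * d + 2) / 2 ^ (2 * d + 2))"
    by (intro suminf_finite) (auto simp: f_def z)
  also have "\<dots> = (\<Sum>l<2 * n. f (l + 1) / 2 ^ (l + 1))"
    by (induction n) auto
  also have "\<dots> = (\<Sum>l. f (l + 1) / 2 ^ (l + 1))"
    by (rule suminf_finite[symmetric]) (auto simp: f_def z)
  finally show "interlaced_seq p n j = (\<Sum>d. of_bool (odd (interlaced_digit p n j (d + 1))) / 2 ^ (d + 1))"
    by (simp add: f_def)
qed

section \<open>Character sums over a block of indices\<close>

definition bit_sgn :: "bit \<Rightarrow> real" where
  "bit_sgn b = (if b = 0 then 1 else -1)"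

lemma bit_sgn_add: "bit_sgn (a + b) = bit_sgn a * bit_sgn b"
  by (cases a; cases b) (simp_all add: bit_sgn_def)

lemma bit_sgn_sum: "bit_sgn (\<Sum>i\<in>A. f i) = (\<Prod>i\<in>A. bit_sgn (f i))"
proof (induction A rule: infinite_finite_induct)
  case (insert x A)
  then show ?case
    by (simp only: sum.insert[OF insert.hyps] prod.insert[OF insert.hyps] bit_sgn_add insert.IH)
qed (simp_all add: bit_sgn_def)

text \<open>The bits of n < 2^m and of 2^m c do not overlap. The digital shift of a block therefore
  affects its character sums only through a constant factor.\<close>

lemma prod_bits_add:
  fixes f :: "nat \<Rightarrow> real" and n c :: nat
  assumes "n < 2 ^ m"
  shows "(\<Prod>i\<in>{i. bit (2 ^ m * c + n) i}. f i) = (\<Prod>i\<in>{i. bit (2 ^ m * c) i}. f i) * (\<Prod>i\<in>{i. bit n i}. f i)"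
proof -
  have low: "\<not> bit n i" if "m \<le> i" for i
  proof -
    have "n < 2 ^ i" using assms that by (meson less_le_trans one_le_numeral power_increasing)
    then show ?thesis by (simp add: bit_iff_odd)
  qed
  have high: "\<not> bit (2 ^ m * c) i" if "i < m" for i
    using that bit_push_bit_iff_nat[of m c i] by (simp add: push_bit_eq_mult mult.commute)
  have "bit (2 ^ m * c + n) i \<longleftrightarrow> bit (2 ^ m * c) i \<or> bit n i" for i
    using low high by (subst bit_disjunctive_add_iff) (metis not_le)+
  then have "{i. bit (2 ^ m * c + n) i} = {i. bit (2 ^ m * c) i} \<union> {i. bit n i}" by auto
  moreover have "{i. bit (2 ^ m * c) i} \<inter> {i. bit n i} = {}" using low high by (auto) (metis not_le)
  ultimately show ?thesis using finite_bits by (simp add: prod.union_disjoint)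
qed

lemma sum_prod_bits:
  fixes f :: "nat \<Rightarrow> real"
  shows "(\<Sum>n<(2::nat) ^ m. \<Prod>i\<in>{i. bit n i}. f i) = (\<Prod>i<m. 1 + f i)"
proof (induction m)
  case (Suc m)
  have "(\<Sum>n<(2::nat) ^ Suc m. \<Prod>i\<in>{i. bit n i}. f i)
      = (\<Sum>n<(2::nat) ^ m. \<Prod>i\<in>{i. bit n i}. f i) + (\<Sum>n<(2::nat) ^ m. \<Prod>i\<in>{i. bit (2 ^ m + n) i}. f i)"
    by (simp add: mult_2 sum_lessThan_add)
  also have "(\<Sum>n<(2::nat) ^ m. \<Prod>i\<in>{i. bit (2 ^ m + n) i}. f i) = f m * (\<Sum>n<(2::nat) ^ m. \<Prod>i\<in>{i. bit n i}. f i)"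
    unfolding sum_distrib_left
  proof (intro sum.cong refl)
    fix n :: nat assume "n \<in> {..<2 ^ m}"
    moreover have "{i. bit (2 ^ m :: nat) i} = {m}" by (auto simp: bit_simps)
    ultimately show "(\<Prod>i\<in>{i. bit (2 ^ m + n) i}. f i) = f m * (\<Prod>i\<in>{i. bit n i}. f i)"
      using prod_bits_add[where n = n and m = m and c = 1 and f = f] by simp
  qed
  finally show ?case using Suc by (simp add: algebra_simps)
qed simp

text \<open>A character on the interlaced digits selects rows of 2s generating matrices. If these
  are independent in the first m columns, some column has sum 1, and the corresponding bit of
  \<open>n\<close> makes the character sum vanish. In \<open>T\<close>, the summand \<open>s\<close>
  pays for rounding in the interlacing and the degrees for the defect of the matrices.\<close>

lemma order2_net_interlaced:
  assumes p: "irreducible_enumeration p"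
  shows "order2_net s (s + (\<Sum>j\<in>{1..2 * s}. degree (p j) - 1)) m
     (\<lambda>n j. digit_prefix (\<lambda>l. odd (interlaced_digit p (2 ^ m * c + n) j l)) m)"
  unfolding order2_net_def
proof (intro conjI allI impI ballI)
  fix u v :: "nat \<Rightarrow> nat" and K :: "(nat \<times> nat) set"
  define t where "t = (\<Sum>j\<in>{1..2 * s}. degree (p j) - 1)"
  assume *: "(\<forall>j\<in>{1..s}. u j \<le> v j) \<and> K \<noteq> {} \<and>
        K \<subseteq> (SIGMA j:{1..s}. ({1..u j} \<union> {v j}) \<inter> {1..m}) \<and>
        (\<Sum>j\<in>{1..s}. u j + v j) + 2 * (s + (\<Sum>j\<in>{1..2 * s}. degree (p j) - 1)) \<le> 2 * m"
  have uv: "u j \<le> v j" if "j \<in> {1..s}" for j by (rule bspec[OF conjunct1[OF *] that])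
  note ** = *[THEN conjunct2]
  have K: "K \<noteq> {}" "K \<subseteq> (SIGMA j:{1..s}. ({1..u j} \<union> {v j}) \<inter> {1..m})"
    by (rule **[THEN conjunct1], rule **[THEN conjunct2, THEN conjunct1])
  have sum_uv: "(\<Sum>j\<in>{1..s}. u j + v j) + 2 * (s + t) \<le> 2 * m"
    unfolding t_def by (rule **[THEN conjunct2, THEN conjunct2])
  define h where "h = (\<lambda>(j, l). (2 * j - l mod 2, (l + 1) div 2 :: nat))"
  \<comment> \<open>Bounds the rows taken from component \<open>j'\<close>: the digits up to
    \<open>u j\<close> are shared by both components of a coordinate, while \<open>v j\<close> falls
    into the one of matching parity only.\<close>
  define d where "d j' = (let j = (j' + 1) div 2 in
      max ((u j + j' mod 2) div 2) (if v j mod 2 = j' mod 2 then (v j + 1) div 2 else 0))" for j'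
  \<comment> \<open>Sum over column \<open>i + 1\<close> of the selected rows, so that the character
    at an index is the product of \<open>bit_sgn (V i)\<close> over its bits
    \<open>i\<close>.\<close>
  define V where "V i = (\<Sum>(j, l)\<in>K. gen_matrix p (2 * j - l mod 2) ((l + 1) div 2) (i + 1))" for i
  have inj: "inj_on h K"
  proof (rule inj_onI)
    fix x y assume xy: "x \<in> K" "y \<in> K" "h x = h y"
    obtain j l j' l' where [simp]: "x = (j, l)" "y = (j', l')" by (cases x, cases y) auto
    have "j \<ge> 1" "l \<ge> 1" "j' \<ge> 1" "l' \<ge> 1" using xy K(2) by auto
    moreover have eq: "2 * j - l mod 2 = 2 * j' - l' mod 2" "(l + 1) div 2 = (l' + 1) div 2"
      using xy(3) by (simp_all add: h_def)
    moreover have "l mod 2 < 2" "l' mod 2 < 2" by simp_all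
    ultimately have "j = j'" by linarith
    moreover from this eq(1) \<open>j \<ge> 1\<close> have "l mod 2 = l' mod 2" by presburger
    moreover have "n + n mod 2 = 2 * ((n + 1) div 2)" for n :: nat by presburger
    from this[of l] this[of l'] have "l + l mod 2 = l' + l' mod 2" by (simp only: eq(2))
    ultimately show "x = y" by simp
  qed
  have sub: "h ` K \<subseteq> (SIGMA j':{1..2 * s}. {1..d j'})"
  proof
    fix x assume "x \<in> h ` K"
    then obtain j l where x: "x = (2 * j - l mod 2, (l + 1) div 2)" "(j, l) \<in> K" by (auto simp: h_def)
    have jl: "j \<in> {1..s}" "1 \<le> l" "l \<le> u j \<or> l = v j" using x(2) K(2) by auto
    obtain j1 where "j = Suc j1" using jl(1) by (cases j) auto
    moreover have "l mod 2 = 0 \<or> l mod 2 = 1" by (simp add: mod_2_eq_odd)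
    ultimately have j': "(2 * j - l mod 2 + 1) div 2 = j" "(2 * j - l mod 2) mod 2 = l mod 2"
      "1 \<le> 2 * j - l mod 2" "2 * j - l mod 2 \<le> 2 * j"
      by (elim disjE; simp)+
    have "(l + 1) div 2 \<le> d (2 * j - l mod 2)"
    proof (cases "l = v j")
      case True
      then show ?thesis unfolding d_def Let_def j' by simp
    next
      case False
      then have "(l + 1) div 2 \<le> (u j + l mod 2) div 2" using jl by presburger
      then show ?thesis unfolding d_def Let_def j' by (rule order_trans[OF _ max.cobounded1])
    qed
    moreover have "2 * j - l mod 2 \<in> {1..2 * s}"
      using jl(1) j'(3,4) unfolding atLeastAtMost_iff by linarith
    moreover have "1 \<le> (l + 1) div 2" using jl(2) by presburger
    ultimately show "x \<in> (SIGMA j':{1..2 * s}. {1..d j'})"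
      unfolding x(1) by (intro SigmaI) (simp_all only: atLeastAtMost_iff)
  qed
  \<comment> \<open>The gain from interlacing: of the two components of a coordinate, one has depth
    about v/2 and the other only about u/2. Rounding costs at most 1 per coordinate after
    doubling.\<close>
  have sum_d: "2 * (\<Sum>j'\<in>{1..2 * s}. d j') \<le> (\<Sum>j\<in>{1..s}. u j + v j) + s"
  proof -
    have "(\<Sum>j'\<in>{1..2 * n}. d j') = (\<Sum>j\<in>{1..n}. d (2 * j - 1) + d (2 * j))" for n
      by (induction n) auto
    then have "2 * (\<Sum>j'\<in>{1..2 * s}. d j') = (\<Sum>j\<in>{1..s}. 2 * (d (2 * j - 1) + d (2 * j)))"
      by (simp add: sum_distrib_left)
    also have "\<dots> \<le> (\<Sum>j\<in>{1..s}. u j + v j + 1)"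
    proof (rule sum_mono)
      fix j assume j: "j \<in> {1..s}"
      obtain j1 where "j = Suc j1" using j by (cases j) auto
      then have [simp]: "(2 * j - 1 + 1) div 2 = j" "(2 * j - 1) mod 2 = 1" "(2 * j + 1) div 2 = j" by simp_all
      show "2 * (d (2 * j - 1) + d (2 * j)) \<le> u j + v j + 1"
        unfolding d_def Let_def using uv[OF j] j by (cases "odd (v j)") (auto simp: mod_2_eq_odd max_def)
    qed
    also have "\<dots> = (\<Sum>j\<in>{1..s}. u j + v j) + s" by (subst sum.distrib) simp
    finally show ?thesis .
  qed
  have "\<exists>l\<in>{1..m}. (\<Sum>(j, k)\<in>h ` K. gen_matrix p j k l) \<noteq> 0"
  proof (rule gen_matrix_rows_independent[OF p _ sub])
    have "(\<Sum>j\<in>{1..2 * s}. d j + degree (p j) - 1) = (\<Sum>j\<in>{1..2 * s}. d j + (degree (p j) - 1))"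
    proof (intro sum.cong refl)
      fix j assume "j \<in> {1..2 * s}"
      then have "degree (p j) \<ge> 1" using irreducible_enumeration_degree[OF p] by simp
      then show "d j + degree (p j) - 1 = d j + (degree (p j) - 1)" by simp
    qed
    also have "\<dots> = (\<Sum>j\<in>{1..2 * s}. d j) + t" unfolding t_def by (rule sum.distrib)
    also have "\<dots> \<le> m"
    proof -
      have "a + t \<le> m" if "2 * a \<le> b + s" "b + 2 * (s + t) \<le> 2 * m" for a b :: nat using that by presburger
      from this[OF sum_d sum_uv] show ?thesis .
    qed
    finally show "(\<Sum>j\<in>{1..2 * s}. d j + degree (p j) - 1) \<le> m" .
  qed (use K in auto)
  then obtain l where l: "l \<in> {1..m}" "(\<Sum>(j, k)\<in>h ` K. gen_matrix p j k l) \<noteq> 0" by blast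
  have V: "V i = (\<Sum>(j, k)\<in>h ` K. gen_matrix p j k (i + 1))" for i
    unfolding V_def by (subst sum.reindex[OF inj]) (auto simp: h_def intro!: sum.cong)
  have rad_eq: "(\<Prod>(j, l)\<in>K. rad m l (digit_prefix (\<lambda>l. odd (interlaced_digit p N j l)) m))
      = (\<Prod>i\<in>{i. bit N i}. bit_sgn (V i))" for N
  proof -
    have "(\<Prod>(j, l)\<in>K. rad m l (digit_prefix (\<lambda>l. odd (interlaced_digit p N j l)) m))
        = (\<Prod>(j, l)\<in>K. bit_sgn (interlaced_digit p N j l))"
    proof (intro prod.cong refl)
      fix x assume "x \<in> K"
      then obtain j l where x: "x = (j, l)" "1 \<le> l" "l \<le> m" using K(2) by auto
      then show "(case x of (j, l) \<Rightarrow> rad m l (digit_prefix (\<lambda>l. odd (interlaced_digit p N j l)) m))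
          = (case x of (j, l) \<Rightarrow> bit_sgn (interlaced_digit p N j l))"
        by (cases "interlaced_digit p N j l") (simp_all add: rad_def bit_digit_prefix bit_sgn_def)
    qed
    also have "\<dots> = bit_sgn (\<Sum>(j, l)\<in>K. interlaced_digit p N j l)"
      unfolding bit_sgn_sum by (simp add: case_prod_unfold)
    also have "(\<Sum>(j, l)\<in>K. interlaced_digit p N j l) = (\<Sum>i\<in>{i. bit N i}. V i)"
      unfolding V_def interlaced_digit_def digital_digit_def case_prod_unfold by (rule sum.swap)
    finally show ?thesis unfolding bit_sgn_sum .
  qed
  have "(\<Sum>n<2 ^ m. \<Prod>(j, l)\<in>K. rad m l (digit_prefix (\<lambda>l. odd (interlaced_digit p (2 ^ m * c + n) j l)) m))
      = (\<Sum>n<(2::nat) ^ m. (\<Prod>i\<in>{i. bit (2 ^ m * c) i}. bit_sgn (V i)) * (\<Prod>i\<in>{i. bit n i}. bit_sgn (V i)))"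
    unfolding rad_eq by (intro sum.cong refl prod_bits_add) auto
  also have "\<dots> = (\<Prod>i\<in>{i. bit (2 ^ m * c) i}. bit_sgn (V i)) * (\<Prod>i<m. 1 + bit_sgn (V i))"
    unfolding sum_distrib_left[symmetric] sum_prod_bits ..
  also have "(\<Prod>i<m. 1 + bit_sgn (V i)) = 0"
  proof (rule prod_zero)
    have "V (l - 1) \<noteq> 0" using l V[of "l - 1"] by simp
    then show "\<exists>i\<in>{..<m}. 1 + bit_sgn (V i) = 0"
      using l(1) by (intro bexI[of _ "l - 1"]) (auto simp: bit_sgn_def)
  qed simp
  finally show "(\<Sum>n<2 ^ m. \<Prod>(j, l)\<in>K. rad m l (digit_prefix (\<lambda>l. odd (interlaced_digit p (2 ^ m * c + n) j l)) m)) = 0"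
    by simp
qed (rule digit_prefix_less)

section \<open>Bounds for the norm of the discrepancy\<close>

text \<open>The unnormalised discrepancy of the points with index \<open>2\<^sup>m c, \<dots>, 2\<^sup>m (c + 1) - 1\<close>; these form a
  digitally shifted order 2 net.\<close>

definition block_discrepancy :: "(nat \<Rightarrow> bit poly) \<Rightarrow> nat \<Rightarrow> nat \<Rightarrow> nat \<Rightarrow> (nat \<Rightarrow> real) \<Rightarrow> real" where
  "block_discrepancy p s m c \<theta> =
     (\<Sum>n<2 ^ m. \<Prod>j\<in>{1..s}. of_bool (interlaced_seq p (2 ^ m * c + n) j < \<theta> j)) - 2 ^ m * (\<Prod>j\<in>{1..s}. \<theta> j)"

section \<open>From the grid to integrable majorants on the cube\<close>

abbreviation cube_measure :: "nat \<Rightarrow> (nat \<Rightarrow> real) measure" where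
  "cube_measure s \<equiv> (\<Pi>\<^sub>M j\<in>{1..s}. lborel)"

text \<open>Closed cells also cover the faces with \<theta>_j = 1. Their overlaps can only enlarge a
  majorant with nonnegative values.\<close>

definition cell :: "nat \<Rightarrow> nat \<Rightarrow> (nat \<Rightarrow> nat) \<Rightarrow> (nat \<Rightarrow> real) set" where
  "cell s m a = PiE {1..s} (\<lambda>j. {real (a j) / 2 ^ m .. (real (a j) + 1) / 2 ^ m})"

lemma
  fixes l u :: "nat \<Rightarrow> real"
  assumes lu: "\<And>j. j \<in> {1..s} \<Longrightarrow> l j \<le> u j"
  defines "B \<equiv> PiE {1..s} (\<lambda>j. {l j..u j})"
  shows integrable_indicator_box: "integrable (cube_measure s) (indicator B :: _ \<Rightarrow> real)"
    and integral_indicator_box: "integral\<^sup>L (cube_measure s) (indicator B :: _ \<Rightarrow> real) = (\<Prod>j\<in>{1..s}. u j - l j)"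
proof -
  interpret product_sigma_finite "\<lambda>_. lborel :: real measure"
    by standard
  have meas: "B \<in> sets (cube_measure s)"
    unfolding B_def by (rule sets_PiM_I_finite) auto
  have "emeasure (cube_measure s) B = (\<Prod>j\<in>{1..s}. ennreal (u j - l j))"
    unfolding B_def using lu by (subst emeasure_PiM) auto
  also have "\<dots> = ennreal (\<Prod>j\<in>{1..s}. u j - l j)"
    by (rule prod_ennreal) (use lu in auto)
  finally have em: "emeasure (cube_measure s) B = ennreal (\<Prod>j\<in>{1..s}. u j - l j)" .
  then show "integrable (cube_measure s) (indicator B :: _ \<Rightarrow> real)"
    using meas by (simp add: integrable_indicator_iff)
  have "measure (cube_measure s) B = (\<Prod>j\<in>{1..s}. u j - l j)"
    unfolding measure_def em by (intro enn2real_ennreal prod_nonneg) (use lu in auto)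
  then show "integral\<^sup>L (cube_measure s) (indicator B :: _ \<Rightarrow> real) = (\<Prod>j\<in>{1..s}. u j - l j)"
    using meas by (simp add: sets.sets_into_space Int_absorb2 Int_absorb1)
qed

lemma Lq_discrepancy_le:
  assumes "q > 0" and H: "integrable (cube_measure s) H" "\<And>\<theta>. H \<theta> \<ge> 0"
    and le: "\<And>\<theta>. \<theta> \<in> PiE {1..s} (\<lambda>_. {0..1}) \<Longrightarrow> \<bar>local_discrepancy s P \<theta>\<bar> powr q \<le> H \<theta>"
    and B: "integral\<^sup>L (cube_measure s) H \<le> B"
  shows "Lq_discrepancy s q P \<le> B powr (1 / q)"
proof -
  define I where "I = (LINT \<theta>:({1..s} \<rightarrow>\<^sub>E {0..1})|cube_measure s. \<bar>local_discrepancy s P \<theta>\<bar> powr q)"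
  have "0 \<le> I" unfolding I_def set_lebesgue_integral_def by (intro Bochner_Integration.integral_nonneg) simp
  moreover have "I \<le> integral\<^sup>L (cube_measure s) H"
    unfolding I_def set_lebesgue_integral_def
    by (rule integral_mono'[OF H(1)]) (use H(2) le in \<open>auto split: split_indicator\<close>)
  ultimately have "I powr (1 / q) \<le> B powr (1 / q)"
    using B \<open>q > 0\<close> by (intro powr_mono2) auto
  then show ?thesis by (simp add: Lq_discrepancy_def I_def)
qed

lemma interlaced_seq_nonneg:
  assumes "irreducible_enumeration p" "j \<ge> 1"
  shows "interlaced_seq p n j \<ge> 0"
  using floor_interlaced_seq[OF assms, where m = 0 and n = n] by simp linarith

lemma prod_of_bool:
  "finite J \<Longrightarrow> (\<Prod>j\<in>J. of_bool (P j)) = (of_bool (\<forall>j\<in>J. P j) :: real)"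
  by (induction J rule: finite_induct) auto

lemma local_discrepancy_interlaced_points:
  assumes p: "irreducible_enumeration p" and "N > 0"
  shows "real N * local_discrepancy s (interlaced_points p N s) \<theta>
    = (\<Sum>n<N. \<Prod>j\<in>{1..s}. of_bool (interlaced_seq p n j < \<theta> j)) - real N * (\<Prod>j\<in>{1..s}. \<theta> j)"
proof -
  have "{n. n < length (interlaced_points p N s) \<and> (\<forall>j\<in>{1..s}. (interlaced_points p N s ! n) j \<in> {0..<\<theta> j})}
      = {n\<in>{..<N}. \<forall>j\<in>{1..s}. interlaced_seq p n j < \<theta> j}"
    using interlaced_seq_nonneg[OF p] by (auto simp: interlaced_points_def)
  moreover have "real (card {n\<in>{..<N}. \<forall>j\<in>{1..s}. interlaced_seq p n j < \<theta> j})
      = (\<Sum>n<N. of_bool (\<forall>j\<in>{1..s}. interlaced_seq p n j < \<theta> j))"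
    by (simp add: of_bool_def flip: sum.inter_filter)
  moreover have "length (interlaced_points p N s) = N" by (simp add: interlaced_points_def)
  ultimately show ?thesis using \<open>N > 0\<close>
    unfolding local_discrepancy_def by (simp add: prod_of_bool right_diff_distrib)
qed

text \<open>Comparing with \<open>half_step\<close>, coordinate \<open>j\<close> can matter only for
  the points in the slab \<open>Y n j = a j\<close>, at most 2^T in number; the volume term moves by
  at most 1 per coordinate. On the right end of its cell \<theta>_j could also count points of the
  next slab, which the last assumption prevents: if \<theta>_j = 1, there is no next slab.\<close>

lemma block_discrepancy_discretize:
  assumes p: "irreducible_enumeration p"
    and net: "order2_net s T m Y"
    and Y: "\<And>n j. j \<ge> 1 \<Longrightarrow> \<lfloor>2 ^ m * interlaced_seq p (2 ^ m * c + n) j\<rfloor> = int (Y n j)"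
    and a: "a \<in> PiE {1..s} (\<lambda>_. {..<2 ^ m})" and \<theta>: "\<theta> \<in> cell s m a"
    and \<theta>': "\<And>j. j \<in> {1..s} \<Longrightarrow> \<theta> j < (real (a j) + 1) / 2 ^ m \<or> \<theta> j = 1"
  shows "\<bar>block_discrepancy p s m c \<theta> - discrete_discrepancy s m Y a\<bar> \<le> real s * (2 ^ T + 1)"
proof -
  have aj: "a j < 2 ^ m" if "j \<in> {1..s}" for j using a that by auto
  have \<theta>j: "real (a j) \<le> 2 ^ m * \<theta> j" "2 ^ m * \<theta> j \<le> real (a j) + 1"
    "2 ^ m * \<theta> j < real (a j) + 1 \<or> \<theta> j = 1" if "j \<in> {1..s}" for j
    using \<theta> \<theta>'[OF that] that unfolding cell_def by (auto simp: PiE_iff field_simps)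
  have Yj: "Y n j < 2 ^ m" if "n < 2 ^ m" "j \<in> {1..s}" for n j
    using net that unfolding order2_net_def by blast
  define A where "A n j = (of_bool (interlaced_seq p (2 ^ m * c + n) j < \<theta> j) :: real)" for n j
  define H where "H n j = half_step (Y n j) (a j)" for n j
  define M where "M j = (real (a j) + 1 / 2) / 2 ^ m" for j
  have AH: "\<bar>A n j - H n j\<bar> \<le> of_bool (a j = Y n j)" if n: "n < 2 ^ m" and j: "j \<in> {1..s}" for n j
  proof -
    define y where "y = interlaced_seq p (2 ^ m * c + n) j"
    have fl: "real (Y n j) \<le> 2 ^ m * y" "2 ^ m * y < real (Y n j) + 1"
      using Y[of j n] j unfolding y_def by (simp_all; linarith)+
    have y\<theta>: "y < \<theta> j \<longleftrightarrow> 2 ^ m * y < 2 ^ m * \<theta> j" by simp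
    consider "Y n j < a j" | "Y n j = a j" | "a j < Y n j" by linarith
    then show ?thesis
    proof cases
      case 1
      then have "real (Y n j) + 1 \<le> real (a j)" by simp
      then have "y < \<theta> j" unfolding y\<theta> using fl \<theta>j[OF j] by linarith
      then show ?thesis using 1 by (simp add: A_def H_def half_step_def y_def)
    next
      case 2
      then show ?thesis by (simp add: A_def H_def half_step_def)
    next
      case 3
      then have ge: "real (a j) + 1 \<le> real (Y n j)" by simp
      moreover have "real (Y n j) + 1 \<le> 2 ^ m" using Yj[OF n j] by (metis Suc_leI of_nat_Suc of_nat_le_iff of_nat_numeral of_nat_power add.commute)
      moreover have "2 ^ m * \<theta> j = 2 ^ m" if "\<theta> j = 1" using that by simp
      ultimately have "\<not> 2 ^ m * y < 2 ^ m * \<theta> j" using fl \<theta>j[OF j] by linarith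
      then have "\<not> y < \<theta> j" unfolding y\<theta> .
      then show ?thesis using 3 by (simp add: A_def H_def half_step_def y_def)
    qed
  qed
  have single: "(\<Sum>n<2 ^ m. of_bool (a j = Y n j)) \<le> (2 ^ T :: real)" if j: "j \<in> {1..s}" for j
  proof -
    define r where "r j' = (if j' = j then m else 0)" for j'
    have "(\<Sum>n<2 ^ m. of_bool (a j = Y n j)) = box_count s m Y r a"
      unfolding box_count_def
    proof (intro sum.cong refl)
      fix n :: nat assume n: "n \<in> {..<2 ^ m}"
      have "(\<forall>j'\<in>{1..s}. a j' div 2 ^ (m - r j') = Y n j' div 2 ^ (m - r j')) \<longleftrightarrow> a j = Y n j"
        using j n aj Yj by (auto simp: r_def)
      then show "of_bool (a j = Y n j) = (\<Prod>j'\<in>{1..s}. of_bool (a j' div 2 ^ (m - r j') = Y n j' div 2 ^ (m - r j')) :: real)"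
        by (simp only: prod_of_bool finite_atLeastAtMost)
    qed
    also have "\<dots> \<le> 2 ^ (T + (m - (\<Sum>j\<in>{1..s}. r j)))"
      by (rule box_count_le[OF net]) (use aj in \<open>auto simp: r_def\<close>)
    also have "(\<Sum>j\<in>{1..s}. r j) = m" using j by (simp add: r_def)
    finally show ?thesis by simp
  qed
  have "\<bar>(\<Sum>n<2 ^ m. \<Prod>j\<in>{1..s}. A n j) - (\<Sum>n<2 ^ m. \<Prod>j\<in>{1..s}. H n j)\<bar>
      \<le> (\<Sum>n<2 ^ m. \<Sum>j\<in>{1..s}. of_bool (a j = Y n j))"
    unfolding sum_subtractf[symmetric]
  proof (rule order_trans[OF sum_abs sum_mono])
    fix n :: nat assume n: "n \<in> {..<2 ^ m}"
    have "norm ((\<Prod>j\<in>{1..s}. A n j) - (\<Prod>j\<in>{1..s}. H n j)) \<le> (\<Sum>j\<in>{1..s}. norm (A n j - H n j))"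
      by (rule norm_prod_diff) (auto simp: A_def H_def half_step_def)
    also have "\<dots> \<le> (\<Sum>j\<in>{1..s}. of_bool (a j = Y n j))"
      using AH n by (intro sum_mono) auto
    finally show "\<bar>(\<Prod>j\<in>{1..s}. A n j) - (\<Prod>j\<in>{1..s}. H n j)\<bar> \<le> (\<Sum>j\<in>{1..s}. of_bool (a j = Y n j))" by simp
  qed
  also have "\<dots> \<le> (\<Sum>j\<in>{1..s}. 2 ^ T)"
    by (subst sum.swap) (intro sum_mono single)
  finally have 1: "\<bar>(\<Sum>n<2 ^ m. \<Prod>j\<in>{1..s}. A n j) - (\<Sum>n<2 ^ m. \<Prod>j\<in>{1..s}. H n j)\<bar> \<le> real s * 2 ^ T"
    by simp
  have "norm ((\<Prod>j\<in>{1..s}. \<theta> j) - (\<Prod>j\<in>{1..s}. M j)) \<le> (\<Sum>j\<in>{1..s}. norm (\<theta> j - M j))"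
  proof (rule norm_prod_diff)
    fix j assume j: "j \<in> {1..s}"
    have a1: "real (a j) + 1 \<le> 2 ^ m" using aj[OF j] by (metis Suc_leI of_nat_Suc of_nat_le_iff of_nat_numeral of_nat_power add.commute)
    have "2 ^ m * \<theta> j \<le> 2 ^ m * 1" "2 ^ m * 0 \<le> 2 ^ m * \<theta> j" using \<theta>j[OF j] a1 by linarith+
    then have "\<theta> j \<le> 1" "0 \<le> \<theta> j" by (simp_all only: mult_le_cancel_left_pos zero_less_power zero_less_numeral)
    then show "norm (\<theta> j) \<le> 1" by simp
    show "norm (M j) \<le> 1" using a1 by (simp add: M_def)
  qed
  also have "\<dots> \<le> (\<Sum>j\<in>{1..s}. 1 / 2 ^ m)"
  proof (rule sum_mono)
    fix j assume j: "j \<in> {1..s}"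
    have "\<bar>2 ^ m * (\<theta> j - M j)\<bar> \<le> 1" using \<theta>j[OF j] by (simp add: M_def right_diff_distrib)
    then have "\<bar>\<theta> j - M j\<bar> * 2 ^ m \<le> 1" by (simp only: abs_mult power_abs abs_numeral mult.commute)
    then show "norm (\<theta> j - M j) \<le> 1 / 2 ^ m" by (simp add: pos_le_divide_eq)
  qed
  finally have "2 ^ m * \<bar>(\<Prod>j\<in>{1..s}. \<theta> j) - (\<Prod>j\<in>{1..s}. M j)\<bar> \<le> real s"
    by (simp add: field_simps)
  then have 2: "\<bar>2 ^ m * (\<Prod>j\<in>{1..s}. \<theta> j) - 2 ^ m * (\<Prod>j\<in>{1..s}. M j)\<bar> \<le> real s"
    by (simp add: abs_mult flip: right_diff_distrib)
  show ?thesis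
    using 1 2 unfolding block_discrepancy_def discrete_discrepancy_def A_def[symmetric] H_def[symmetric] M_def[symmetric]
    by (simp only: distrib_left)
qed

lemma exists_cell:
  assumes \<theta>: "\<theta> \<in> PiE {1..s} (\<lambda>_. {0..1})"
  shows "\<exists>a\<in>PiE {1..s} (\<lambda>_. {..<2 ^ m}). \<theta> \<in> cell s m a \<and>
    (\<forall>j\<in>{1..s}. \<theta> j < (real (a j) + 1) / 2 ^ m \<or> \<theta> j = 1)"
proof -
  define a where "a = restrict (\<lambda>j. if \<theta> j = 1 then 2 ^ m - 1 else nat \<lfloor>2 ^ m * \<theta> j\<rfloor>) {1..s}"
  have *: "a j < 2 ^ m \<and> real (a j) / 2 ^ m \<le> \<theta> j \<and> \<theta> j \<le> (real (a j) + 1) / 2 ^ m \<and>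
      (\<theta> j < (real (a j) + 1) / 2 ^ m \<or> \<theta> j = 1)" if j: "j \<in> {1..s}" for j
  proof (cases "\<theta> j = 1")
    case True
    then have "a j = 2 ^ m - 1" using j by (simp add: a_def)
    then show ?thesis using True by (simp add: of_nat_diff)
  next
    case False
    then have t: "0 \<le> \<theta> j" "\<theta> j < 1" using \<theta> j by (auto simp: PiE_iff order_le_less)
    then have "real (a j) = of_int \<lfloor>2 ^ m * \<theta> j\<rfloor>" using False j by (simp add: a_def)
    then have fl: "real (a j) \<le> 2 ^ m * \<theta> j" "2 ^ m * \<theta> j < real (a j) + 1" by linarith+
    moreover have "2 ^ m * \<theta> j < 2 ^ m * 1" using t by (intro mult_strict_left_mono) auto
    ultimately have "real (a j) < 2 ^ m" by linarith
    then have "a j < 2 ^ m" by simp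
    then show ?thesis using fl by (simp add: field_simps)
  qed
  moreover have "a \<in> PiE {1..s} (\<lambda>_. {..<2 ^ m})" using * by (auto simp: a_def)
  moreover have "\<theta> \<in> cell s m a" using * \<theta> unfolding cell_def by (auto simp: PiE_iff)
  ultimately show ?thesis by blast
qed

lemma add_power_le:
  fixes x y :: real
  assumes "0 \<le> x" "0 \<le> y"
  shows "(x + y) ^ n \<le> 2 ^ n * (x ^ n + y ^ n)"
proof -
  have "(x + y) ^ n \<le> (2 * max x y) ^ n" using assms by (intro power_mono) auto
  also have "\<dots> = 2 ^ n * max x y ^ n" by (simp add: power_mult_distrib)
  also have "\<dots> \<le> 2 ^ n * (x ^ n + y ^ n)" using assms by (intro mult_left_mono) (auto simp: max_def)
  finally show ?thesis .
qed

text \<open>The constant is chosen before \<open>m\<close> and \<open>c\<close>, so the bound is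
  uniform in the digital shift. \<open>G\<close> is a step function built from the grid values, and
  the discretization error is absorbed because (m+1)^(s-1) >= 1.\<close>

lemma block_discrepancy_majorant:
  assumes p: "irreducible_enumeration p" and "s \<ge> 1" "k \<ge> 1"
  shows "\<exists>C>0. \<forall>m c. \<exists>G. integrable (cube_measure s) G \<and> (\<forall>\<theta>. G \<theta> \<ge> 0) \<and>
     (\<forall>\<theta>\<in>PiE {1..s} (\<lambda>_. {0..1}). \<bar>block_discrepancy p s m c \<theta>\<bar> ^ (2 * k) \<le> G \<theta>) \<and>
     integral\<^sup>L (cube_measure s) G \<le> C * (real (m + 1) ^ (s - 1)) ^ k"
proof -
  define T where "T = s + (\<Sum>j\<in>{1..2 * s}. degree (p j) - 1)"
  \<comment> \<open>The least ratio that meets both requirements of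
    \<open>haar_block_moment_le\<close>; it depends on \<open>k\<close> but stays below 1.\<close>
  define \<rho> :: real where "\<rho> = max (64 / 81) (root k (1 / 2))"
  define C1 :: real where "C1 = ((2 * real k)\<^sup>2) ^ s * (2 ^ (T + s + 1) * (9 / 4) ^ T * 4 ^ s)\<^sup>2 * (2 / (1 - \<rho>))"
  define E where "E = real s * (2 ^ T + 1)"
  define C where "C = 2 ^ (2 * k) * (C1 ^ k + E ^ (2 * k))"
  have "root k (1 / 2) < root k 1" using \<open>k \<ge> 1\<close> by (intro real_root_less_mono) auto
  then have \<rho>1: "\<rho> < 1" using \<open>k \<ge> 1\<close> by (simp add: \<rho>_def)
  have "1 / 2 = root k (1 / 2) ^ k" using \<open>k \<ge> 1\<close> by simp
  also have "\<dots> \<le> \<rho> ^ k" using \<open>k \<ge> 1\<close> unfolding \<rho>_def by (intro power_mono) auto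
  finally have \<rho>: "64 / 81 \<le> \<rho>" "1 / 2 \<le> \<rho> ^ k" "\<rho> < 1" using \<rho>1 by (simp_all add: \<rho>_def)
  have C1: "C1 \<ge> 0" using \<rho> by (simp add: C1_def)
  have E: "E > 0" using \<open>s \<ge> 1\<close> by (simp add: E_def add_pos_pos)
  have C: "C > 0" using C1 E by (simp add: C_def add_nonneg_pos)
  have "\<exists>G. integrable (cube_measure s) G \<and> (\<forall>\<theta>. G \<theta> \<ge> 0) \<and>
     (\<forall>\<theta>\<in>PiE {1..s} (\<lambda>_. {0..1}). \<bar>block_discrepancy p s m c \<theta>\<bar> ^ (2 * k) \<le> G \<theta>) \<and>
     integral\<^sup>L (cube_measure s) G \<le> C * (real (m + 1) ^ (s - 1)) ^ k" for m c
  proof -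
    define Y where "Y n j = digit_prefix (\<lambda>l. odd (interlaced_digit p (2 ^ m * c + n) j l)) m" for n j
    have net: "order2_net s T m Y"
      using order2_net_interlaced[OF p, of s m c] unfolding T_def Y_def .
    have Y: "\<lfloor>2 ^ m * interlaced_seq p (2 ^ m * c + n) j\<rfloor> = int (Y n j)" if "j \<ge> 1" for n j
      unfolding Y_def by (rule floor_interlaced_seq[OF p that])
    define X where "X = PiE {1..s} (\<lambda>_. {..<(2::nat) ^ m})"
    have finX: "finite X" unfolding X_def by (intro finite_PiE) auto
    have cardX: "real (card X) = (2 ^ m) ^ s" unfolding X_def by (simp add: card_PiE)
    define g where "g a = 2 ^ (2 * k) * (discrete_discrepancy s m Y a ^ (2 * k) + E ^ (2 * k))" for a
    have g: "g a \<ge> 0" for a unfolding g_def using E by (simp add: zero_le_even_power)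
    define G where "G \<theta> = (\<Sum>a\<in>X. g a * indicator (cell s m a) \<theta>)" for \<theta>
    have cell_int: "integrable (cube_measure s) (indicator (cell s m a) :: _ \<Rightarrow> real)"
      "integral\<^sup>L (cube_measure s) (indicator (cell s m a) :: _ \<Rightarrow> real) = 1 / (2 ^ m) ^ s" for a
    proof -
      have le: "real (a j) / 2 ^ m \<le> (real (a j) + 1) / 2 ^ m" for j by (simp add: divide_right_mono)
      show "integrable (cube_measure s) (indicator (cell s m a) :: _ \<Rightarrow> real)"
        unfolding cell_def by (rule integrable_indicator_box[OF le])
      show "integral\<^sup>L (cube_measure s) (indicator (cell s m a) :: _ \<Rightarrow> real) = 1 / (2 ^ m) ^ s"
        unfolding cell_def by (subst integral_indicator_box[OF le])
          (simp add: add_divide_distrib power_divide)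
    qed
    have "integrable (cube_measure s) G"
      unfolding G_def using cell_int by (intro Bochner_Integration.integrable_sum integrable_mult_right)
    moreover have G0: "G \<theta> \<ge> 0" for \<theta> unfolding G_def using g by (intro sum_nonneg) auto
    moreover have "\<bar>block_discrepancy p s m c \<theta>\<bar> ^ (2 * k) \<le> G \<theta>" if \<theta>: "\<theta> \<in> PiE {1..s} (\<lambda>_. {0..1})" for \<theta>
    proof -
      obtain a where a: "a \<in> X" "\<theta> \<in> cell s m a" "\<forall>j\<in>{1..s}. \<theta> j < (real (a j) + 1) / 2 ^ m \<or> \<theta> j = 1"
        using exists_cell[OF \<theta>] unfolding X_def by blast
      have "\<bar>block_discrepancy p s m c \<theta> - discrete_discrepancy s m Y a\<bar> \<le> E"
        unfolding E_def using a(1,3) unfolding X_def by (intro block_discrepancy_discretize[OF p net Y _ a(2)]) auto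
      then have "\<bar>block_discrepancy p s m c \<theta>\<bar> ^ (2 * k) \<le> (\<bar>discrete_discrepancy s m Y a\<bar> + E) ^ (2 * k)"
        by (intro power_mono) auto
      also have "\<dots> \<le> 2 ^ (2 * k) * (\<bar>discrete_discrepancy s m Y a\<bar> ^ (2 * k) + E ^ (2 * k))"
        using E by (intro add_power_le) auto
      also have "\<bar>discrete_discrepancy s m Y a\<bar> ^ (2 * k) = discrete_discrepancy s m Y a ^ (2 * k)"
        by (rule power_even_abs) simp
      also have "2 ^ (2 * k) * (discrete_discrepancy s m Y a ^ (2 * k) + E ^ (2 * k))
          = g a * indicator (cell s m a) \<theta>" using a(2) by (simp add: g_def)
      also have "\<dots> \<le> G \<theta>" unfolding G_def
        using a(1) finX g by (intro member_le_sum) auto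
      finally show ?thesis .
    qed
    moreover have "integral\<^sup>L (cube_measure s) G \<le> C * (real (m + 1) ^ (s - 1)) ^ k"
    proof -
      define R where "R = real (m + 1) ^ (s - 1)"
      have R: "R \<ge> 1" unfolding R_def by (intro one_le_power) simp
      have "integral\<^sup>L (cube_measure s) G = (\<Sum>a\<in>X. g a * (1 / (2 ^ m) ^ s))"
        unfolding G_def using cell_int by (subst Bochner_Integration.integral_sum) auto
      also have "\<dots> = 2 ^ (2 * k) * ((\<Sum>a\<in>X. discrete_discrepancy s m Y a ^ (2 * k)) / (2 ^ m) ^ s + E ^ (2 * k))"
        unfolding g_def sum_distrib_right[symmetric] sum_distrib_left[symmetric] sum.distrib
        using cardX by (simp add: field_simps)
      also have "\<dots> \<le> 2 ^ (2 * k) * ((C1 * R) ^ k + E ^ (2 * k))"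
      proof -
        have "(\<Sum>a\<in>X. discrete_discrepancy s m Y a ^ (2 * k)) \<le> (2 ^ m) ^ s * (C1 * R) ^ k"
          using discrete_discrepancy_moment_le[OF net \<open>s \<ge> 1\<close> \<open>k \<ge> 1\<close> \<rho>] unfolding X_def C1_def R_def .
        then have "(\<Sum>a\<in>X. discrete_discrepancy s m Y a ^ (2 * k)) / (2 ^ m) ^ s \<le> (C1 * R) ^ k"
          by (simp add: divide_le_eq mult.commute)
        then show ?thesis by (intro mult_left_mono add_mono) auto
      qed
      also have "\<dots> \<le> 2 ^ (2 * k) * (C1 ^ k * R ^ k + E ^ (2 * k) * R ^ k)"
      proof -
        have "E ^ (2 * k) * 1 \<le> E ^ (2 * k) * R ^ k" using R by (intro mult_left_mono one_le_power) auto
        then show ?thesis by (simp add: power_mult_distrib)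
      qed
      also have "\<dots> = C * R ^ k" by (simp add: C_def algebra_simps)
      finally show ?thesis unfolding R_def .
    qed
    ultimately show ?thesis by blast
  qed
  then show ?thesis using C by blast
qed

section \<open>Assembling the blocks\<close>

lemma sum_blocks:
  fixes g :: "nat \<Rightarrow> 'a::comm_monoid_add" and r :: nat
  shows "(\<Sum>n<(\<Sum>v=1..r. b v). g n) = (\<Sum>v=1..r. \<Sum>n<b v. g ((\<Sum>w=1..<v. b w) + n))"
proof (induction r)
  case (Suc r)
  have "(\<Sum>v=1..Suc r. b v) = (\<Sum>v=1..r. b v) + b (Suc r)" by simp
  then show ?case using Suc by (simp add: sum_lessThan_add atLeastLessThanSuc_atLeastAtMost)
qed simp

text \<open>Block \<open>v\<close> starts at the sum of the preceding powers of two. As the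
  exponents decrease, this is a multiple of \<open>2 ^ m v\<close>, so the block has the aligned
  form that \<open>block_discrepancy\<close> requires.\<close>

lemma discrepancy_eq_sum_blocks:
  fixes r :: nat
  assumes p: "irreducible_enumeration p" and "N > 0"
    and m: "strict_antimono_on {1..r} m" and N: "N = (\<Sum>v=1..r. 2 ^ m v)"
  shows "\<exists>c. \<forall>\<theta>. real N * local_discrepancy s (interlaced_points p N s) \<theta>
    = (\<Sum>v=1..r. block_discrepancy p s (m v) (c v) \<theta>)"
proof -
  define c where "c v = (\<Sum>w=1..<v. (2::nat) ^ m w) div 2 ^ m v" for v
  have c: "(\<Sum>w=1..<v. (2::nat) ^ m w) = 2 ^ m v * c v" if v: "v \<in> {1..r}" for v
  proof -
    have "2 ^ m v dvd (\<Sum>w=1..<v. (2::nat) ^ m w)"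
    proof (intro dvd_sum le_imp_power_dvd less_imp_le)
      fix w assume "w \<in> {1..<v}"
      then show "m v < m w" using m v by (auto simp: monotone_on_def)
    qed
    then show ?thesis unfolding c_def by simp
  qed
  have "real N * local_discrepancy s (interlaced_points p N s) \<theta>
      = (\<Sum>v=1..r. block_discrepancy p s (m v) (c v) \<theta>)" for \<theta>
  proof -
    have "(\<Sum>n<N. \<Prod>j\<in>{1..s}. of_bool (interlaced_seq p n j < \<theta> j))
       = (\<Sum>v=1..r. \<Sum>n<2 ^ m v. \<Prod>j\<in>{1..s}. of_bool (interlaced_seq p (2 ^ m v * c v + n) j < \<theta> j))"
      unfolding N sum_blocks using c by (intro sum.cong refl) simp
    moreover have "real N * (\<Prod>j\<in>{1..s}. \<theta> j) = (\<Sum>v=1..r. 2 ^ m v * (\<Prod>j\<in>{1..s}. \<theta> j))"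
      unfolding N by (simp add: sum_distrib_right)
    ultimately show ?thesis
      unfolding local_discrepancy_interlaced_points[OF p \<open>N > 0\<close>] block_discrepancy_def sum_subtractf by simp
  qed
  then show ?thesis by blast
qed

lemma powr_eq_power:
  fixes x :: real
  assumes "x \<ge> 0" "n \<ge> 1"
  shows "x powr real n = x ^ n"
  using assms by (cases "x = 0") (auto simp: powr_realpow)

lemma sqrt_power_two_mult:
  assumes "x \<ge> 0"
  shows "sqrt x ^ (2 * k) = x ^ k"
  using assms by (simp add: power_mult)

text \<open>The weights \<open>\<alpha> v = sqrt (R v)\<close> are proportional to the norm bounds
  of the blocks. After normalisation every block integrates to at most \<open>C\<close>, and so does
  their weighted mean.\<close>

lemma Lq_discrepancy_general:
  assumes p: "irreducible_enumeration p" and "s \<ge> 1" and q: "even q" "q \<ge> 2"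
  shows "\<exists>C>0. \<forall>N r m. N \<ge> 2 \<and> strict_antimono_on {1..r} m \<and> N = (\<Sum>v=1..r. 2 ^ m v) \<longrightarrow>
          Lq_discrepancy s (real q) (interlaced_points p N s)
            \<le> C * (real r powr (3 / 2 - 1 / real q) / real N) * sqrt (\<Sum>v=1..r. real (m v) ^ (s - 1))"
proof -
  obtain k where k: "q = 2 * k" "k \<ge> 1" using q by (auto elim: evenE)
  obtain C where C: "C > 0" and major: "\<And>m c. \<exists>G. integrable (cube_measure s) G \<and> (\<forall>\<theta>. G \<theta> \<ge> 0) \<and>
     (\<forall>\<theta>\<in>PiE {1..s} (\<lambda>_. {0..1}). \<bar>block_discrepancy p s m c \<theta>\<bar> ^ (2 * k) \<le> G \<theta>) \<and>
     integral\<^sup>L (cube_measure s) G \<le> C * (real (m + 1) ^ (s - 1)) ^ k"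
    using block_discrepancy_majorant[OF p \<open>s \<ge> 1\<close> k(2)] by blast
  define D where "D = C powr (1 / real q) * sqrt (2 ^ (s - 1) + 1)"
  have D: "D > 0" unfolding D_def using C by (simp add: add_pos_pos)
  have "Lq_discrepancy s (real q) (interlaced_points p N s)
       \<le> D * (real r powr (3 / 2 - 1 / real q) / real N) * sqrt (\<Sum>v=1..r. real (m v) ^ (s - 1))"
    if N: "N \<ge> 2" and m: "strict_antimono_on {1..r} m" and Nm: "N = (\<Sum>v=1..r. 2 ^ m v)" for N r :: nat and m
  proof -
    have r: "r \<ge> 1" using N Nm by (cases r) auto
    obtain c where c: "\<And>\<theta>. real N * local_discrepancy s (interlaced_points p N s) \<theta>
        = (\<Sum>v=1..r. block_discrepancy p s (m v) (c v) \<theta>)"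
      using discrepancy_eq_sum_blocks[OF p _ m Nm] N by fastforce
    define R where "R v = real (m v + 1) ^ (s - 1)" for v
    define \<alpha> where "\<alpha> v = sqrt (R v)" for v
    define A where "A = (\<Sum>v=1..r. \<alpha> v)"
    have R: "R v > 0" for v unfolding R_def by simp
    have \<alpha>: "\<alpha> v > 0" for v unfolding \<alpha>_def using R by simp
    have \<alpha>k: "\<alpha> v ^ (2 * k) = R v ^ k" for v
      unfolding \<alpha>_def using R by (intro sqrt_power_two_mult less_imp_le)
    have A: "A > 0" unfolding A_def using \<alpha> r by (intro sum_pos) auto
    obtain G where G: "\<And>v. integrable (cube_measure s) (G v)" "\<And>v \<theta>. G v \<theta> \<ge> 0"
      "\<And>v \<theta>. \<theta> \<in> PiE {1..s} (\<lambda>_. {0..1}) \<Longrightarrow> \<bar>block_discrepancy p s (m v) (c v) \<theta>\<bar> ^ (2 * k) \<le> G v \<theta>"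
      "\<And>v. integral\<^sup>L (cube_measure s) (G v) \<le> C * R v ^ k"
    proof -
      have "\<exists>G. \<forall>v. integrable (cube_measure s) (G v) \<and> (\<forall>\<theta>. G v \<theta> \<ge> 0) \<and>
        (\<forall>\<theta>\<in>PiE {1..s} (\<lambda>_. {0..1}). \<bar>block_discrepancy p s (m v) (c v) \<theta>\<bar> ^ (2 * k) \<le> G v \<theta>) \<and>
        integral\<^sup>L (cube_measure s) (G v) \<le> C * R v ^ k"
        unfolding R_def by (intro choice allI major)
      then show thesis using that by blast
    qed
    define H where "H \<theta> = (A / real N) ^ q * (\<Sum>v=1..r. \<alpha> v / A * (G v \<theta> / R v ^ k))" for \<theta>
    have "Lq_discrepancy s (real q) (interlaced_points p N s) \<le> ((A / real N) ^ q * C) powr (1 / real q)"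
    proof (rule Lq_discrepancy_le)
      show "integrable (cube_measure s) H"
        unfolding H_def using G(1)
        by (intro integrable_mult_right Bochner_Integration.integrable_sum integrable_divide) auto
      show "0 \<le> H \<theta>" for \<theta> unfolding H_def using A \<alpha> R G(2)
        by (intro mult_nonneg_nonneg sum_nonneg divide_nonneg_nonneg zero_le_power) (auto simp: less_imp_le)
      show "\<bar>local_discrepancy s (interlaced_points p N s) \<theta>\<bar> powr real q \<le> H \<theta>"
        if \<theta>: "\<theta> \<in> PiE {1..s} (\<lambda>_. {0..1})" for \<theta>
      proof -
        define f where "f v = \<bar>block_discrepancy p s (m v) (c v) \<theta>\<bar>" for v
        have "real N * \<bar>local_discrepancy s (interlaced_points p N s) \<theta>\<bar>
            = \<bar>\<Sum>v=1..r. block_discrepancy p s (m v) (c v) \<theta>\<bar>"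
          unfolding c[symmetric] by (simp add: abs_mult)
        also have "\<dots> \<le> (\<Sum>v=1..r. f v)" unfolding f_def by (rule sum_abs)
        finally have "\<bar>local_discrepancy s (interlaced_points p N s) \<theta>\<bar> \<le> (\<Sum>v=1..r. f v) / real N"
          using N by (simp add: pos_le_divide_eq mult.commute)
        then have "\<bar>local_discrepancy s (interlaced_points p N s) \<theta>\<bar> ^ q \<le> ((\<Sum>v=1..r. f v) / real N) ^ q"
          by (intro power_mono) auto
        also have "\<dots> = (\<Sum>v=1..r. f v) ^ q / real N ^ q" by (rule power_divide)
        also have "\<dots> \<le> (A ^ q * (\<Sum>v=1..r. \<alpha> v / A * (f v / \<alpha> v) ^ q)) / real N ^ q"
          unfolding A_def using \<alpha> r
          by (intro divide_right_mono weighted_power_mean) (auto simp: f_def)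
        also have "\<dots> \<le> (A ^ q * (\<Sum>v=1..r. \<alpha> v / A * (G v \<theta> / R v ^ k))) / real N ^ q"
        proof (intro divide_right_mono mult_left_mono sum_mono)
          fix v
          show "(f v / \<alpha> v) ^ q \<le> G v \<theta> / R v ^ k"
            unfolding k(1) power_divide \<alpha>k f_def using G(3)[OF \<theta>, of v] R[of v] by (intro divide_right_mono) auto
        qed (use A \<alpha> in \<open>auto simp: less_imp_le\<close>)
        also have "\<dots> = H \<theta>" by (simp add: H_def power_divide)
        finally show ?thesis using q by (subst powr_eq_power) auto
      qed
      have "integral\<^sup>L (cube_measure s) H
          = (A / real N) ^ q * (\<Sum>v=1..r. \<alpha> v / A * (integral\<^sup>L (cube_measure s) (G v) / R v ^ k))"
        unfolding H_def using G(1)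
        by (simp add: Bochner_Integration.integral_sum integrable_mult_right integrable_divide)
      also have "\<dots> \<le> (A / real N) ^ q * (\<Sum>v=1..r. \<alpha> v / A * C)"
      proof (intro mult_left_mono sum_mono)
        show "integral\<^sup>L (cube_measure s) (G v) / R v ^ k \<le> C" for v
          using G(4)[of v] R[of v] by (simp add: divide_le_eq)
      qed (use A \<alpha> in \<open>auto simp: less_imp_le\<close>)
      also have "(\<Sum>v=1..r. \<alpha> v / A * C) = C"
        using A by (simp add: A_def flip: sum_distrib_right sum_divide_distrib)
      finally show "integral\<^sup>L (cube_measure s) H \<le> (A / real N) ^ q * C" .
    qed (use q in auto)
    also have "\<dots> = A / real N * C powr (1 / real q)"
    proof -
      have "((A / real N) ^ q) powr (1 / real q) = A / real N"
        using A N q by (simp add: powr_powr flip: powr_realpow)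
      then show ?thesis using A C by (simp add: powr_mult)
    qed
    also have "A \<le> real r powr (3 / 2 - 1 / real q) * (sqrt (2 ^ (s - 1) + 1) * sqrt (\<Sum>v=1..r. real (m v) ^ (s - 1)))"
    proof -
      define S where "S = (\<Sum>v=1..r. real (m v) ^ (s - 1))"
      have "A\<^sup>2 = (\<Sum>v=1..r. 1 * \<alpha> v)\<^sup>2" by (simp add: A_def)
      also have "\<dots> \<le> (\<Sum>v=1..r. 1\<^sup>2) * (\<Sum>v=1..r. (\<alpha> v)\<^sup>2)" by (rule Cauchy_Schwarz_ineq_sum)
      also have "\<dots> = real r * (\<Sum>v=1..r. R v)" using R by (simp add: \<alpha>_def less_imp_le)
      \<comment> \<open>Passing from m_v + 1 to m_v costs 2^(s-1), except where m_v = 0. This can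
        happen only for v = r and adds at most 1, which is at most \<open>S\<close> because N >= 2
        forces m_1 >= 1.\<close>
      also have "(\<Sum>v=1..r. R v) \<le> (2 ^ (s - 1) + 1) * S"
      proof -
        have m1: "m 1 \<ge> 1"
        proof (rule ccontr)
          assume "\<not> m 1 \<ge> 1"
          moreover have "m 2 < m 1" if "r \<ge> 2" using m that by (auto simp: monotone_on_def)
          ultimately have "r = 1" "m 1 = 0" using r by linarith+
          then show False using N Nm by simp
        qed
        have "R v \<le> 2 ^ (s - 1) * real (m v) ^ (s - 1) + (if v = r then 1 else 0)" if v: "v \<in> {1..r}" for v
        proof (cases "m v = 0")
          case False
          have "R v \<le> (2 * real (m v)) ^ (s - 1)" unfolding R_def using False by (intro power_mono) auto
          then show ?thesis by (cases "v = r") (simp_all add: power_mult_distrib)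
        next
          case True
          have "v = r"
          proof (rule ccontr)
            assume "v \<noteq> r"
            then have "m r < m v" using m v by (auto simp: monotone_on_def)
            then show False using True by simp
          qed
          then show ?thesis using True by (simp add: R_def)
        qed
        then have "(\<Sum>v=1..r. R v) \<le> (\<Sum>v=1..r. 2 ^ (s - 1) * real (m v) ^ (s - 1) + (if v = r then 1 else 0))"
          by (rule sum_mono)
        also have "\<dots> = 2 ^ (s - 1) * S + 1" using r by (simp add: sum.distrib S_def sum_distrib_left)
        also have "1 \<le> S"
        proof -
          have "1 \<le> real (m 1) ^ (s - 1)" using m1 by (intro one_le_power) simp
          also have "\<dots> \<le> S" unfolding S_def using r by (intro member_le_sum) auto
          finally show ?thesis .
        qed
        finally show ?thesis by (simp add: algebra_simps)
      qed
      finally have "A\<^sup>2 \<le> real r * ((2 ^ (s - 1) + 1) * S)" by (simp add: mult_left_mono)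
      then have "A \<le> sqrt (real r * ((2 ^ (s - 1) + 1) * S))" by (rule real_le_rsqrt)
      also have "\<dots> = sqrt (real r) * (sqrt (2 ^ (s - 1) + 1) * sqrt S)" by (simp add: real_sqrt_mult)
      also have "sqrt (real r) = real r powr (1 / 2)" by (simp add: powr_half_sqrt)
      also have "real r powr (1 / 2) * (sqrt (2 ^ (s - 1) + 1) * sqrt S)
          \<le> real r powr (3 / 2 - 1 / real q) * (sqrt (2 ^ (s - 1) + 1) * sqrt S)"
      proof (intro mult_right_mono powr_mono)
        show "1 / 2 \<le> 3 / 2 - 1 / real q" using q by (simp add: divide_simps)
        show "0 \<le> sqrt (2 ^ (s - 1) + 1) * sqrt S" by (simp add: S_def sum_nonneg)
      qed (use r in auto)
      finally show ?thesis unfolding S_def .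
    qed
    then have "A / real N * C powr (1 / real q) \<le> (real r powr (3 / 2 - 1 / real q) *
        (sqrt (2 ^ (s - 1) + 1) * sqrt (\<Sum>v=1..r. real (m v) ^ (s - 1)))) / real N * C powr (1 / real q)"
      by (intro mult_right_mono divide_right_mono) auto
    also have "\<dots> = D * (real r powr (3 / 2 - 1 / real q) / real N) * sqrt (\<Sum>v=1..r. real (m v) ^ (s - 1))"
      by (simp add: D_def)
    finally show ?thesis .
  qed
  then show ?thesis using D by blast
qed

text \<open>The first 2^m points form one block. With the discrepancy divided by the scale
  \<open>A\<close>, x^q <= 1 + x^(2k) for the least even 2k >= q reduces a real exponent to the even
  case.\<close>

lemma Lq_discrepancy_power_two:
  assumes p: "irreducible_enumeration p" and "s \<ge> 1" and q: "q \<ge> 2"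
  shows "\<exists>C>0. \<forall>m\<ge>1. Lq_discrepancy s q (interlaced_points p (2 ^ m) s)
            \<le> C * (real m powr ((real s - 1) / 2) / 2 ^ m)"
proof -
  define k where "k = nat \<lceil>q / 2\<rceil>"
  have k: "k \<ge> 1" "q \<le> real (2 * k)" unfolding k_def using q by linarith+
  obtain C where C: "C > 0" and major: "\<And>m c. \<exists>G. integrable (cube_measure s) G \<and> (\<forall>\<theta>. G \<theta> \<ge> 0) \<and>
     (\<forall>\<theta>\<in>PiE {1..s} (\<lambda>_. {0..1}). \<bar>block_discrepancy p s m c \<theta>\<bar> ^ (2 * k) \<le> G \<theta>) \<and>
     integral\<^sup>L (cube_measure s) G \<le> C * (real (m + 1) ^ (s - 1)) ^ k"
    using block_discrepancy_majorant[OF p \<open>s \<ge> 1\<close> k(1)] by blast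
  define D where "D = (1 + C) powr (1 / q) * 2 powr ((real s - 1) / 2)"
  have D: "D > 0" unfolding D_def using C by simp
  have "Lq_discrepancy s q (interlaced_points p (2 ^ m) s) \<le> D * (real m powr ((real s - 1) / 2) / 2 ^ m)"
    if m: "m \<ge> 1" for m
  proof -
    define R where "R = real (m + 1) ^ (s - 1)"
    define A where "A = sqrt R"
    have R: "R > 0" unfolding R_def by simp
    then have A: "A > 0" unfolding A_def by simp
    have Ak: "A ^ (2 * k) = R ^ k" unfolding A_def using R by (intro sqrt_power_two_mult less_imp_le)
    obtain G where G: "integrable (cube_measure s) G" "\<And>\<theta>. G \<theta> \<ge> 0"
      "\<And>\<theta>. \<theta> \<in> PiE {1..s} (\<lambda>_. {0..1}) \<Longrightarrow> \<bar>block_discrepancy p s m 0 \<theta>\<bar> ^ (2 * k) \<le> G \<theta>"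
      "integral\<^sup>L (cube_measure s) G \<le> C * R ^ k"
      using major[of m 0] unfolding R_def by blast
    \<comment> \<open>The whole space has infinite measure, so the summand 1 is cut off to the unit
      cube.\<close>
    define Q where "Q = PiE {1..s} (\<lambda>_::nat. {0..1::real})"
    have Q: "integrable (cube_measure s) (indicator Q :: _ \<Rightarrow> real)"
      "integral\<^sup>L (cube_measure s) (indicator Q :: _ \<Rightarrow> real) = 1"
      unfolding Q_def using integrable_indicator_box[of s "\<lambda>_. 0" "\<lambda>_. 1"]
        integral_indicator_box[of s "\<lambda>_. 0" "\<lambda>_. 1"] by simp_all
    define H where "H \<theta> = (A / 2 ^ m) powr q * (indicator Q \<theta> + G \<theta> / R ^ k)" for \<theta>
    have "Lq_discrepancy s q (interlaced_points p (2 ^ m) s) \<le> ((A / 2 ^ m) powr q * (1 + C)) powr (1 / q)"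
    proof (rule Lq_discrepancy_le)
      show "integrable (cube_measure s) H"
        unfolding H_def using G(1) Q(1) by simp
      show "0 \<le> H \<theta>" for \<theta> unfolding H_def using R G(2) by simp
      show "\<bar>local_discrepancy s (interlaced_points p (2 ^ m) s) \<theta>\<bar> powr q \<le> H \<theta>"
        if \<theta>: "\<theta> \<in> PiE {1..s} (\<lambda>_. {0..1})" for \<theta>
      proof -
        define x where "x = \<bar>block_discrepancy p s m 0 \<theta>\<bar> / A"
        have x0: "x \<ge> 0" unfolding x_def using A by simp
        have "real (2 ^ m) * local_discrepancy s (interlaced_points p (2 ^ m) s) \<theta> = block_discrepancy p s m 0 \<theta>"
          by (subst local_discrepancy_interlaced_points[OF p]) (simp_all add: block_discrepancy_def)
        then have "2 ^ m * \<bar>local_discrepancy s (interlaced_points p (2 ^ m) s) \<theta>\<bar> = \<bar>block_discrepancy p s m 0 \<theta>\<bar>"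
          by (metis abs_mult abs_of_nonneg of_nat_0_le_iff of_nat_numeral of_nat_power)
        then have eq: "\<bar>local_discrepancy s (interlaced_points p (2 ^ m) s) \<theta>\<bar> = A / 2 ^ m * x"
          unfolding x_def using A by (simp add: field_simps)
        have "x powr q \<le> 1 + x ^ (2 * k)"
        proof (cases "x \<le> 1")
          case True
          then have "x powr q \<le> 1 powr q" using x0 q by (intro powr_mono2) auto
          then show ?thesis using x0 by (simp add: add_increasing2)
        next
          case False
          then have "x powr q \<le> x powr real (2 * k)" using k by (intro powr_mono) auto
          also have "\<dots> = x ^ (2 * k)" using x0 k by (intro powr_eq_power) auto
          finally show ?thesis by simp
        qed
        also have "\<dots> \<le> indicator Q \<theta> + G \<theta> / R ^ k"
        proof -
          have "x ^ (2 * k) \<le> G \<theta> / R ^ k"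
            unfolding x_def power_divide Ak using G(3)[OF \<theta>] R by (intro divide_right_mono) auto
          then show ?thesis using \<theta> by (simp add: Q_def)
        qed
        finally have "(A / 2 ^ m) powr q * x powr q \<le> H \<theta>"
          unfolding H_def by (intro mult_left_mono) auto
        then show ?thesis unfolding eq using A x0 by (subst powr_mult) auto
      qed
      have "integral\<^sup>L (cube_measure s) H = (A / 2 ^ m) powr q * (1 + integral\<^sup>L (cube_measure s) G / R ^ k)"
        unfolding H_def using G(1) Q by simp
      also have "\<dots> \<le> (A / 2 ^ m) powr q * (1 + C)"
        using G(4) R by (intro mult_left_mono add_left_mono) (auto simp: divide_le_eq)
      finally show "integral\<^sup>L (cube_measure s) H \<le> (A / 2 ^ m) powr q * (1 + C)" .
    qed (use q in auto)
    also have "\<dots> = A / 2 ^ m * (1 + C) powr (1 / q)"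
      using A C q by (simp add: powr_mult powr_powr)
    also have "A \<le> 2 powr ((real s - 1) / 2) * real m powr ((real s - 1) / 2)"
    proof -
      have "R = real (m + 1) powr real (s - 1)" unfolding R_def by (subst powr_realpow) auto
      then have "A = real (m + 1) powr ((real s - 1) / 2)"
        using \<open>s \<ge> 1\<close> unfolding A_def by (simp add: powr_half_sqrt[symmetric] powr_powr of_nat_diff)
      also have "\<dots> \<le> (2 * real m) powr ((real s - 1) / 2)"
        using m \<open>s \<ge> 1\<close> by (intro powr_mono2) auto
      finally show ?thesis by (simp add: powr_mult)
    qed
    then have "A / 2 ^ m * (1 + C) powr (1 / q)
        \<le> 2 powr ((real s - 1) / 2) * real m powr ((real s - 1) / 2) / 2 ^ m * (1 + C) powr (1 / q)"
      by (intro mult_right_mono divide_right_mono) auto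
    also have "\<dots> = D * (real m powr ((real s - 1) / 2) / 2 ^ m)" by (simp add: D_def)
    finally show ?thesis .
  qed
  then show ?thesis using D by blast
qed

theorem theorem1:
  fixes p :: "nat \<Rightarrow> bit poly"
  assumes "irreducible_enumeration p"
  shows "\<forall>s::nat. s \<ge> 1 \<longrightarrow>
    (\<forall>q::nat. even q \<and> q \<ge> 2 \<longrightarrow>
      (\<exists>C::real. C > 0 \<and>
        (\<forall>(N::nat) (r::nat) (m::nat \<Rightarrow> nat).
          N \<ge> 2 \<and> strict_antimono_on {1..r} m \<and> N = (\<Sum>v=1..r. 2 ^ m v) \<longrightarrow>
          Lq_discrepancy s (real q) (interlaced_points p N s)
            \<le> C * (real r powr (3 / 2 - 1 / real q) / real N)
                * sqrt (\<Sum>v=1..r. real (m v) ^ (s - 1))))) \<and>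
    (\<forall>q::real. q \<ge> 2 \<longrightarrow>
      (\<exists>C::real. C > 0 \<and>
        (\<forall>m::nat. m \<ge> 1 \<longrightarrow>
          Lq_discrepancy s q (interlaced_points p (2 ^ m) s)
            \<le> C * (real m powr ((real s - 1) / 2) / 2 ^ m))))"
  by (intro allI impI conjI Lq_discrepancy_general[OF assms] Lq_discrepancy_power_two[OF assms]) auto

end
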